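(* Under assumption (AS), $$\lim_{t\to T}\frac{K-b(t)}{(T-t)^{1/\alpha}|\ln(T-t)|^{1-\frac1\alpha}}=K\Big(\eta_0\frac{\Gamma(2-\alpha)}{\alpha-1}\Big)^{1/\alpha}.$$
   Context: Fix $T>0$, $K>0$, $r>0$, $\delta\ge0$. Assumption (AS): $X$ is a real Lévy process with Lévy measure $\nu$ such that $\mathbb E(e^{iuX_t})=\exp\big(t\int(e^{iuy}-1-iu(e^y-1))\nu(dy)\big)$ for all $u\in\mathbb R$, $t\ge0$; $\int(e^y-1)_+\nu(dy)<r-\delta$; and for some $a_0<0$, $\mathbf 1_{\{a_0<y<0\}}\nu(dy)=\frac{\eta(y)}{|y|^{1+\alpha}}\mathbf 1_{\{a_0<y<0\}}dy$, where $1<\alpha<2$ and $\eta$ is a positive bounded Borel function on $[a_0,0)$ with $\lim_{y\to0}\eta(y)=\eta_0>0$. Let $(\mathcal F_t)$ be the usual augmentation of the natural filtration of $X$. For $x\ge0$ let $S^x_t=xe^{(r-\delta)t+X_t}$; $P(t,x)=\sup_{\tau\in\mathcal T_{0,T-t}}\mathbb E[e^{-r\tau}(K-S^x_\tau)_+]$ (American put, $\mathcal T_{0,s}$ = stopping times in $[0,s]$), and $b(t)=\inf\{x\ge0:P(t,x)>(K-x)_+\}$, $t\in[0,T)$, its critical price. *)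

theory Defs
  imports "HOL-Probability.Probability"
begin

definition levy_process ::
  "'a measure \<Rightarrow> (real \<Rightarrow> 'a \<Rightarrow> real) \<Rightarrow> real measure \<Rightarrow> bool" where
  "levy_process M X \<nu> \<longleftrightarrow>
     prob_space M \<and>
     (\<forall>t. X t \<in> borel_measurable M) \<and>
     (\<forall>\<omega>\<in>space M. X 0 \<omega> = 0) \<and>
     (\<forall>\<omega>\<in>space M. \<forall>t\<ge>0. continuous (at_right t) (\<lambda>s. X s \<omega>)) \<and>
     (\<forall>\<omega>\<in>space M. \<forall>t>0. \<exists>l. ((\<lambda>s. X s \<omega>) \<longlongrightarrow> l) (at_left t)) \<and>
     (\<forall>(n::nat) (ts::nat \<Rightarrow> real). 0 \<le> ts 0 \<and> (\<forall>i<n. ts i < ts (Suc i)) \<longrightarrow>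
        prob_space.indep_vars M (\<lambda>_. borel) (\<lambda>i \<omega>. X (ts (Suc i)) \<omega> - X (ts i) \<omega>) {..<n}) \<and>
     (\<forall>s h. 0 \<le> s \<and> 0 \<le> h \<longrightarrow>
        distr M borel (\<lambda>\<omega>. X (s + h) \<omega> - X s \<omega>) = distr M borel (X h)) \<and>
     \<comment> \<open>nu is a Levy measure\<close>
     sets \<nu> = sets borel \<and>
     emeasure \<nu> {0} = 0 \<and>
     (\<integral>\<^sup>+ y. ennreal (min 1 (y\<^sup>2)) \<partial>\<nu>) < \<infinity> \<and>
     \<comment> \<open>the characteristic function formula (the integrand is integrable)\<close>
     (\<forall>u::real. integrable \<nu> (\<lambda>y. cis (u * y) - 1 - \<i> * complex_of_real u * complex_of_real (exp y - 1))) \<and>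
     (\<forall>t\<ge>0. \<forall>u::real.
        (\<integral>\<omega>. cis (u * X t \<omega>) \<partial>M) =
        exp (complex_of_real t *
          (\<integral>y. cis (u * y) - 1 - \<i> * complex_of_real u * complex_of_real (exp y - 1) \<partial>\<nu>)))"

definition aug_filtration :: "'a measure \<Rightarrow> (real \<Rightarrow> 'a \<Rightarrow> real) \<Rightarrow> real \<Rightarrow> 'a measure" where
  "aug_filtration M X t = sigma (space M)
     (\<Inter>s\<in>{t<..}. sigma_sets (space M)
        ({X u -` B \<inter> space M | u B. 0 \<le> u \<and> u \<le> s \<and> B \<in> sets borel}
         \<union> null_sets (completion M)))"

definition stopping_times_upto :: "'a measure \<Rightarrow> (real \<Rightarrow> 'a \<Rightarrow> real) \<Rightarrow> real \<Rightarrow> ('a \<Rightarrow> real) set" where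
  "stopping_times_upto M X s =
     {\<tau>. stopping_time (aug_filtration M X) \<tau> \<and> (\<forall>\<omega>\<in>space M. 0 \<le> \<tau> \<omega> \<and> \<tau> \<omega> \<le> s)}"

text \<open>American put price P(t,x), with S^x_t = x exp((r-\<delta>)t + X_t).
  Expectations are taken on the completion of M (the augmented filtration contains its null sets).\<close>

definition american_put ::
  "'a measure \<Rightarrow> (real \<Rightarrow> 'a \<Rightarrow> real) \<Rightarrow> real \<Rightarrow> real \<Rightarrow> real \<Rightarrow> real \<Rightarrow> real \<Rightarrow> real \<Rightarrow> real" where
  "american_put M X r \<delta> K T t x =
     (SUP \<tau>\<in>stopping_times_upto M X (T - t).
        \<integral>\<omega>. exp (- r * \<tau> \<omega>) * max 0 (K - x * exp ((r - \<delta>) * \<tau> \<omega> + X (\<tau> \<omega>) \<omega>)) \<partial>completion M)"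

definition critical_price ::
  "'a measure \<Rightarrow> (real \<Rightarrow> 'a \<Rightarrow> real) \<Rightarrow> real \<Rightarrow> real \<Rightarrow> real \<Rightarrow> real \<Rightarrow> real \<Rightarrow> real" where
  "critical_price M X r \<delta> K T t =
     Inf {x. 0 \<le> x \<and> american_put M X r \<delta> K T t x > max 0 (K - x)}"

end

(* Write the law of X_t as A_t * J_t shifted by -kappa t, where A_t collects the compensated negative jumps,
   J_t >= 0 the positive ones and kappa is the integral of (e^y - 1)_+. The Laplace exponent psi of A satisfies
   psi(rho) ~ C rho^alpha with C = eta_0 Gamma(2 - alpha) / (alpha (alpha - 1)). With
   h(t) = t^(1/alpha) |ln t|^(1 - 1/alpha), the call E(A_t - l h(t))_+ is o(t) for l > lam = (alpha C)^(1/alpha)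
   (exponential Markov inequality) and dominates t for l < lam (exponential tilting).

   Let K = 1. At a price exp(-l h(t)) the cost of waiting until maturity is of order t. For l < lam the European
   put is therefore worth more than the payoff, hence b <= exp(-l h).
   For l2 > lam, the premium over 1 - e^y of any Bermudan option is at most a call H on A. If the option had a
   positive continuation premium at y0 = -l2 h(t), so would all options of longer maturity at higher prices.
   Starting at -l3 h(t) with lam < l3 < l2 and maturity (1 + eps) t, the process stays in the strip [y0, 0] with
   high probability, so for a time of order eps t the gap between H and the premium grows at rate gamma > 0. This
   contradicts H(-l3 h(t)) = o(t). Right-continuity reduces general stopping times to Bermudan ones. *)
theory Submission
  imports Defs "HOL-Real_Asymp.Real_Asymp"
begin

section \<open>Compound Poisson laws\<close>

text \<open>The scale h comes from a saddle point. The jumps of A are negative, so exponential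
  moments control its right tail: with the tilt q * \<open>rho\<close> t the bound on E(A_t - l
  h(t))_+ has the exponent -q l / lam + q^\<alpha> / \<alpha> in units of |ln t|, and the factor 1 /
  \<open>rho\<close> t contributes t^(1/\<alpha>) up to logarithms. At l = lam the best q is 1 and
  the product has order t, again up to logarithms, which is the size of the interest on the strike.
  This fixes both the logarithm in h and the constant lam. The process is never split pathwise. A_t
  and J_t are only laws, recovered from the characteristic function by compound Poisson
  approximation, and their convolution semigroups are all the dynamics there is. That is enough for
  backward induction, so the American price is reached through Bermudan ones. The delicate side is
  the lower bound on b. That H is o(t) at -l2 h(t) does not make the premium vanish there. What
  decides is the rate \<gamma> = r - \<delta> - \<kappa> > 0: a positive premium would force a gap
  of order t between H and the premium at a higher price, where H itself is still o(t).\<close>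

lemma prob_space_convolution:
  fixes A B :: "real measure"
  assumes "real_distribution A" "real_distribution B"
  shows "real_distribution (A \<star> B)"
proof -
  interpret A: real_distribution A by fact
  interpret B: real_distribution B by fact
  interpret P: pair_prob_space A B ..
  show ?thesis unfolding convolution_def by (rule P.real_distribution_distr) simp
qed

lemma char_convolution:
  fixes A B :: "real measure"
  assumes "real_distribution A" "real_distribution B"
  shows "char (A \<star> B) u = char A u * char B u"
proof -
  interpret A: real_distribution A by fact
  interpret B: real_distribution B by fact
  interpret P: pair_prob_space A B ..
  have int: "integrable (A \<Otimes>\<^sub>M B) (\<lambda>(x, y). iexp (u * x) * iexp (u * y))"
    by (rule P.integrable_const_bound[where B=1]) (auto simp: norm_mult case_prod_beta)
  have "char (A \<star> B) u = (CLINT z|(A \<Otimes>\<^sub>M B). iexp (u * (fst z + snd z)))"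
    unfolding char_def convolution_def by (subst integral_distr) (auto simp: case_prod_beta)
  also have "\<dots> = (CLINT z|(A \<Otimes>\<^sub>M B). (\<lambda>(x, y). iexp (u * x) * iexp (u * y)) z)"
    by (intro Bochner_Integration.integral_cong) (auto simp: algebra_simps exp_add)
  also have "\<dots> = (CLINT x|A. CLINT y|B. iexp (u * x) * iexp (u * y))"
    using P.integral_fst[OF int] by simp
  also have "\<dots> = char A u * char B u" by (simp add: char_def)
  finally show ?thesis .
qed

fun conv_power :: "real measure \<Rightarrow> nat \<Rightarrow> real measure" where
  "conv_power G 0 = return borel 0"
| "conv_power G (Suc n) = (G \<star> conv_power G n)"

lemma real_distribution_return: "real_distribution (return borel (x::real))"
  by (simp add: real_distribution_def real_distribution_axioms_def prob_space_return)

lemma real_distribution_conv_power: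
  assumes "real_distribution G" shows "real_distribution (conv_power G n)"
  by (induction n) (auto intro!: prob_space_convolution assms real_distribution_return)

lemma char_conv_power:
  assumes "real_distribution G" shows "char (conv_power G n) u = char G u ^ n"
proof (induction n)
  case 0 show ?case by (simp add: char_def integral_return)
next
  case (Suc n) then show ?case
    by (simp add: char_convolution[OF assms real_distribution_conv_power[OF assms]])
qed

text \<open>Stated in the extended nonnegative reals, so that Tonelli applies before any exponential
  moment is known to be finite; finiteness is read off from the closed form at the end.\<close>

lemma nn_integral_exp_convolution:
  fixes A B :: "real measure"
  assumes "real_distribution A" "real_distribution B"
  shows "(\<integral>\<^sup>+x. ennreal (exp (\<rho> * x)) \<partial>(A \<star> B)) =
    (\<integral>\<^sup>+x. ennreal (exp (\<rho> * x)) \<partial>A) * (\<integral>\<^sup>+x. ennreal (exp (\<rho> * x)) \<partial>B)"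
proof -
  interpret A: real_distribution A by fact
  interpret B: real_distribution B by fact
  show ?thesis
    by (simp add: nn_integral_convolution A.finite_measure_axioms B.finite_measure_axioms
      distrib_left exp_add ennreal_mult nn_integral_cmult nn_integral_multc)
qed

lemma nn_integral_exp_conv_power:
  assumes "real_distribution G"
  shows "(\<integral>\<^sup>+x. ennreal (exp (\<rho> * x)) \<partial>conv_power G n) = (\<integral>\<^sup>+x. ennreal (exp (\<rho> * x)) \<partial>G) ^ n"
proof (induction n)
  case 0 show ?case by (simp add: nn_integral_return)
next
  case (Suc n) then show ?case
    by (simp add: nn_integral_exp_convolution[OF assms real_distribution_conv_power[OF assms]])
qed

lemma convolution_nonneg:
  fixes A B :: "real measure"
  assumes "real_distribution A" "real_distribution B" "AE x in A. 0 \<le> x" "AE x in B. 0 \<le> x"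
  shows "AE x in (A \<star> B). 0 \<le> x"
proof -
  interpret A: real_distribution A by fact
  interpret B: real_distribution B by fact
  have "(\<integral>\<^sup>+x. indicator {..<0::real} x \<partial>(A \<star> B)) = (\<integral>\<^sup>+x. \<integral>\<^sup>+y. indicator {..<0} (x + y) \<partial>B \<partial>A)"
    by (rule nn_integral_convolution) (auto simp: A.finite_measure_axioms B.finite_measure_axioms)
  also have "\<dots> = (\<integral>\<^sup>+x. 0 \<partial>A)"
  proof (rule nn_integral_cong_AE, use assms(3) in eventually_elim)
    fix x :: real assume x: "0 \<le> x"
    have "(\<integral>\<^sup>+y. indicator {..<0} (x + y) \<partial>B) = (\<integral>\<^sup>+y. 0 \<partial>B)"
      by (rule nn_integral_cong_AE, use assms(4) in eventually_elim) (use x in \<open>auto split: split_indicator\<close>)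
    then show "(\<integral>\<^sup>+y. indicator {..<0} (x + y) \<partial>B) = 0" by simp
  qed
  finally have "emeasure (A \<star> B) {..<0} = 0" by simp
  then show ?thesis by (intro AE_I[where N="{..<0}"]) auto
qed

lemma conv_power_nonneg:
  assumes "real_distribution G" "AE x in G. 0 \<le> x"
  shows "AE x in conv_power G n. 0 \<le> x"
proof (induction n)
  case 0
  have "AE x in return borel 0. 0 \<le> (x::real)" by (subst AE_return) auto
  then show ?case unfolding conv_power.simps .
next
  case (Suc n)
  from convolution_nonneg[OF assms(1) real_distribution_conv_power[OF assms(1)] assms(2) this]
  show ?case unfolding conv_power.simps .
qed

lemma poisson_generating_function:
  fixes z :: complex
  assumes c: "0 < c"
  shows "(\<integral>n. z ^ n \<partial>measure_pmf (poisson_pmf c)) = exp (c * (z - 1))"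
proof -
  have s: "(\<lambda>n. exp (- complex_of_real c) * ((c * z) ^ n /\<^sub>R fact n)) sums (exp (- complex_of_real c) * exp (c * z))"
    by (intro sums_mult exp_converges)
  have eq: "pmf (poisson_pmf c) n *\<^sub>R z ^ n = exp (- complex_of_real c) * ((c * z) ^ n /\<^sub>R fact n)" for n
    using c by (simp add: scaleR_conv_of_real exp_of_real[symmetric] power_mult_distrib field_simps)
  have ns: "summable (\<lambda>n. norm (pmf (poisson_pmf c) n *\<^sub>R z ^ n))"
    unfolding eq norm_mult by (intro summable_mult summable_norm_exp)
  have "(\<integral>n. z ^ n \<partial>measure_pmf (poisson_pmf c)) = (\<integral>n. pmf (poisson_pmf c) n *\<^sub>R z ^ n \<partial>count_space UNIV)"
    unfolding measure_pmf_eq_density by (subst integral_density) auto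
  also have "\<dots> = (\<Sum>n. pmf (poisson_pmf c) n *\<^sub>R z ^ n)"
    by (rule integral_count_space_nat) (use ns in \<open>simp add: integrable_count_space_nat_iff\<close>)
  also have "\<dots> = exp (- complex_of_real c) * exp (c * z)"
    unfolding eq using s by (simp add: sums_iff)
  also have "\<dots> = exp (c * (z - 1))" by (simp add: exp_add[symmetric] algebra_simps)
  finally show ?thesis .
qed

lemma poisson_nn_generating_function:
  assumes c: "0 < c" and z: "0 \<le> z"
  shows "(\<integral>\<^sup>+n. ennreal z ^ n \<partial>measure_pmf (poisson_pmf c)) = ennreal (exp (c * (z - 1)))"
proof -
  have s: "(\<lambda>n. exp (- c) * ((c * z) ^ n /\<^sub>R fact n)) sums (exp (- c) * exp (c * z))"
    by (intro sums_mult exp_converges)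
  have eq: "ennreal (pmf (poisson_pmf c) n) * ennreal z ^ n = ennreal (exp (- c) * ((c * z) ^ n /\<^sub>R fact n))" for n
    using c z by (simp add: ennreal_power ennreal_mult[symmetric] power_mult_distrib field_simps)
  have "(\<integral>\<^sup>+n. ennreal z ^ n \<partial>measure_pmf (poisson_pmf c)) = (\<integral>\<^sup>+n. ennreal (pmf (poisson_pmf c) n) * ennreal z ^ n \<partial>count_space UNIV)"
    unfolding measure_pmf_eq_density by (subst nn_integral_density) auto
  also have "\<dots> = (\<Sum>n. ennreal (exp (- c) * ((c * z) ^ n /\<^sub>R fact n)))"
    unfolding eq by (rule nn_integral_count_space_nat)
  also have "\<dots> = ennreal (exp (- c) * exp (c * z))"
    using s z c by (intro suminf_ennreal_eq) auto
  also have "exp (- c) * exp (c * z) = exp (c * (z - 1))" by (simp add: exp_add[symmetric] algebra_simps)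
  finally show ?thesis .
qed

text \<open>The law is the Poisson mixture of the convolution powers of G, formed with the monadic
  bind. Its transforms are then the Poisson generating function evaluated at the transform of
  G.\<close>

lemma compound_poisson_exists:
  assumes G: "real_distribution G" and c: "0 < c"
  obtains L where "real_distribution L"
    "\<And>u. char L u = exp (c * (char G u - 1))"
    "\<And>\<rho>. integrable G (\<lambda>y. exp (\<rho> * y)) \<Longrightarrow>
       (\<integral>\<^sup>+x. ennreal (exp (\<rho> * x)) \<partial>L) = ennreal (exp (c * ((\<integral>y. exp (\<rho> * y) \<partial>G) - 1)))"
    "(AE y in G. 0 \<le> y) \<Longrightarrow> (AE x in L. 0 \<le> x)"
proof -
  interpret G: real_distribution G by fact
  define P where "P = measure_pmf (poisson_pmf c)"
  interpret P: prob_space P unfolding P_def by (rule measure_pmf.prob_space_axioms)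
  interpret pw: real_distribution "conv_power G n" for n by (rule real_distribution_conv_power[OF G])
  have K: "conv_power G \<in> measurable P (subprob_algebra borel)"
    by (auto simp: P_def space_subprob_algebra measurable_measure_pmf intro!: pw.subprob_space_axioms prob_space_imp_subprob_space pw.prob_space_axioms)
  define L where "L = P \<bind> conv_power G"
  have sL: "sets L = sets borel" unfolding L_def by (rule sets_bind) (auto simp: P_def)
  have L: "real_distribution L"
    unfolding real_distribution_def real_distribution_axioms_def
  proof
    show "prob_space L" unfolding L_def
      by (rule P.prob_space_bind[OF _ K]) (auto intro: pw.prob_space_axioms)
  qed (auto simp: sL sets_eq_imp_space_eq[OF sL])
  interpret L: real_distribution L by fact
  have nn: "(\<integral>\<^sup>+x. f x \<partial>L) = (\<integral>\<^sup>+n. \<integral>\<^sup>+x. f x \<partial>conv_power G n \<partial>P)" if "f \<in> borel_measurable borel" for f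
    unfolding L_def by (rule nn_integral_bind[OF that K])
  have bd: "(\<integral>x. f x \<partial>L) = (\<integral>n. \<integral>x. f x \<partial>conv_power G n \<partial>P)"
    if f[measurable]: "f \<in> borel_measurable borel" and b: "\<And>x. \<bar>f x\<bar> \<le> 1" for f :: "real \<Rightarrow> real"
  proof -
    have K': "conv_power G \<in> P \<rightarrow>\<^sub>M subprob_algebra borel" by (rule K)
    have "(\<integral>x. f x \<partial>L) = (\<integral>M'. \<integral>x. f x \<partial>M' \<partial>distr P (subprob_algebra borel) (conv_power G))"
      unfolding L_def bind_nonempty''[OF K P.not_empty]
      by (rule integral_join[OF f b, where ?B'=1])
         (auto simp: AE_distr_iff K intro!: AE_I2 finite_measure.finite_measure_distr P.finite_measure_axioms K'
            prob_space.finite_measure P.prob_space_distr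
            subprob_space.emeasure_space_le_1 simp: space_subprob_algebra)
    also have "\<dots> = (\<integral>n. \<integral>x. f x \<partial>conv_power G n \<partial>P)"
      by (rule integral_distr[OF K']) (rule integral_measurable_subprob_algebra[OF f])
    finally show ?thesis .
  qed
  have intP: "integrable P (\<lambda>n. g n)" if "\<And>n. norm (g n) \<le> 1" for g :: "nat \<Rightarrow> complex"
    by (rule P.integrable_const_bound[where B=1]) (auto simp: P_def that)
  have ch: "char L u = exp (c * (char G u - 1))" for u
  proof -
    have iL: "integrable L (\<lambda>x. iexp (u * x))" by (rule L.integrable_const_bound[where B=1]) auto
    have ip: "integrable (conv_power G n) (\<lambda>x. iexp (u * x))" for n
      by (rule pw.integrable_const_bound[where B=1]) auto
    have iP: "integrable P (\<lambda>n. char (conv_power G n) u)"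
      by (rule intP) (rule pw.cmod_char_le_1)
    \<comment> \<open>The interchange \<open>bd\<close> concerns bounded real integrands, so the
      identity is checked on real and imaginary parts.\<close>
    have "char L u = (\<integral>n. char (conv_power G n) u \<partial>P)"
    proof (rule complex_eqI)
      have "Re (char L u) = (\<integral>x. Re (iexp (u * x)) \<partial>L)" unfolding char_def by (rule integral_Re[OF iL, symmetric])
      also have "\<dots> = (\<integral>n. \<integral>x. Re (iexp (u * x)) \<partial>conv_power G n \<partial>P)"
        by (rule bd) (auto simp: Re_exp)
      also have "\<dots> = (\<integral>n. Re (char (conv_power G n) u) \<partial>P)"
        unfolding char_def by (simp only: integral_Re[OF ip])
      also have "\<dots> = Re (\<integral>n. char (conv_power G n) u \<partial>P)" by (rule integral_Re[OF iP])
      finally show "Re (char L u) = Re (\<integral>n. char (conv_power G n) u \<partial>P)" .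
    next
      have "Im (char L u) = (\<integral>x. Im (iexp (u * x)) \<partial>L)" unfolding char_def by (rule integral_Im[OF iL, symmetric])
      also have "\<dots> = (\<integral>n. \<integral>x. Im (iexp (u * x)) \<partial>conv_power G n \<partial>P)"
        by (rule bd) (auto simp: Im_exp)
      also have "\<dots> = (\<integral>n. Im (char (conv_power G n) u) \<partial>P)"
        unfolding char_def by (simp only: integral_Im[OF ip])
      also have "\<dots> = Im (\<integral>n. char (conv_power G n) u \<partial>P)" by (rule integral_Im[OF iP])
      finally show "Im (char L u) = Im (\<integral>n. char (conv_power G n) u \<partial>P)" .
    qed
    then show ?thesis
      using poisson_generating_function[OF c] by (simp add: char_conv_power[OF G] P_def)
  qed
  have lap: "(\<integral>\<^sup>+x. ennreal (exp (\<rho> * x)) \<partial>L) = ennreal (exp (c * ((\<integral>y. exp (\<rho> * y) \<partial>G) - 1)))"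
    if "integrable G (\<lambda>y. exp (\<rho> * y))" for \<rho>
  proof -
    have "(\<integral>\<^sup>+y. ennreal (exp (\<rho> * y)) \<partial>G) = ennreal (\<integral>y. exp (\<rho> * y) \<partial>G)"
      by (rule nn_integral_eq_integral[OF that]) auto
    then show ?thesis
      by (simp add: nn nn_integral_exp_conv_power[OF G] P_def poisson_nn_generating_function[OF c])
  qed
  have pos: "AE x in L. 0 \<le> x" if p: "AE y in G. 0 \<le> y"
  proof -
    have "emeasure (conv_power G n) {..<0} = 0" for n
      using conv_power_nonneg[OF G p, of n] by (subst (asm) AE_iff_measurable[OF _ refl]) (auto simp: not_le lessThan_def)
    then have "(\<integral>\<^sup>+x. indicator {..<0} x \<partial>L) = 0" by (subst nn) auto
    then have "emeasure L {..<0} = 0" by simp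
    then show ?thesis by (intro AE_I[where N="{..<0}"]) auto
  qed
  show ?thesis by (rule that[OF L ch lap pos])
qed

text \<open>Jumps from B arrive at rate \<nu>(B) and have the law \<nu> restricted to B and
  normalized; running for time t gives the Poisson parameter t * \<nu>(B).\<close>

lemma compound_poisson_restrict_exists:
  fixes \<nu> :: "real measure"
  assumes [measurable_cong]: "sets \<nu> = sets borel" and B[measurable]: "B \<in> sets borel"
    and fin: "emeasure \<nu> B < \<infinity>" and t: "0 \<le> t"
  obtains L where "real_distribution L"
    "\<And>u. char L u = exp (t * (\<integral>y. indicator B y *\<^sub>R (iexp (u * y) - 1) \<partial>\<nu>))"
    "\<And>\<rho>. integrable \<nu> (\<lambda>y. indicator B y * exp (\<rho> * y)) \<Longrightarrow>
       (\<integral>\<^sup>+x. ennreal (exp (\<rho> * x)) \<partial>L) = ennreal (exp (t * (\<integral>y. indicator B y * (exp (\<rho> * y) - 1) \<partial>\<nu>)))"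
    "B \<subseteq> {0..} \<Longrightarrow> (AE x in L. 0 \<le> x)"
proof (cases "t = 0 \<or> measure \<nu> B = 0")
  \<comment> \<open>With a vanishing Poisson parameter there are no jumps: every exponent is zero
    and the point mass at 0 serves.\<close>
  case True
  have "AE y in \<nu>. y \<notin> B" if "measure \<nu> B = 0"
    using that fin by (intro AE_I'[where N=B]) (auto simp: measure_def enn2real_eq_0_iff null_sets_def)
  then have 1: "t *\<^sub>R (\<integral>y. indicator B y *\<^sub>R f y \<partial>\<nu>) = 0" for f :: "real \<Rightarrow> 'b::{banach, second_countable_topology}"
    using True by (auto intro!: integral_eq_zero_AE elim!: AE_mp split: split_indicator)
  show ?thesis
  proof (rule that[of "return borel 0"])
    show "real_distribution (return borel 0)" by (rule real_distribution_return)
    show "char (return borel 0) u = exp (t * (\<integral>y. indicator B y *\<^sub>R (iexp (u * y) - 1) \<partial>\<nu>))" for u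
      using 1[of "\<lambda>y. iexp (u * y) - 1"] by (auto simp: char_def integral_return scaleR_conv_of_real)
    show "(\<integral>\<^sup>+x. ennreal (exp (\<rho> * x)) \<partial>return borel 0) = ennreal (exp (t * (\<integral>y. indicator B y * (exp (\<rho> * y) - 1) \<partial>\<nu>)))" for \<rho>
      using 1[of "\<lambda>y. exp (\<rho> * y) - 1"] by (auto simp: nn_integral_return)
    show "AE x in return borel 0. 0 \<le> (x::real)" by (subst AE_return) auto
  qed
next
  case False
  define c where "c = measure \<nu> B"
  have c: "0 < c" and t': "0 < t" using False t by (auto simp: c_def zero_less_measure_iff less_le)
  have ec: "emeasure \<nu> B = ennreal c" using fin by (simp add: c_def emeasure_eq_ennreal_measure)
  define G where "G = density \<nu> (\<lambda>y. ennreal (indicator B y / c))"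
  have sG: "sets G = sets borel" by (simp add: G_def assms(1))
  have "prob_space G"
  proof
    have "emeasure G (space G) = (\<integral>\<^sup>+y. ennreal (1 / c) * indicator B y \<partial>\<nu>)"
      unfolding G_def by (subst emeasure_density) (auto intro!: nn_integral_cong split: split_indicator)
    also have "\<dots> = ennreal (1 / c) * ennreal c" by (subst nn_integral_cmult) (auto simp: ec)
    also have "\<dots> = 1" using c by (simp add: ennreal_mult[symmetric])
    finally show "emeasure G (space G) = 1" .
  qed
  then have G: "real_distribution G"
    by (auto simp: real_distribution_def real_distribution_axioms_def sG sets_eq_imp_space_eq[OF sG])
  interpret G: real_distribution G by fact
  have iG: "(\<integral>y. f y \<partial>G) = (\<integral>y. indicator B y *\<^sub>R f y \<partial>\<nu>) /\<^sub>R c"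
    if [measurable]: "f \<in> borel_measurable borel" for f :: "real \<Rightarrow> 'b::{banach, second_countable_topology}"
  proof -
    have "(\<integral>y. f y \<partial>G) = (\<integral>y. (indicator B y / c) *\<^sub>R f y \<partial>\<nu>)"
      unfolding G_def using c by (subst integral_density) auto
    also have "\<dots> = (\<integral>y. inverse c *\<^sub>R (indicator B y *\<^sub>R f y) \<partial>\<nu>)" by (simp add: divide_inverse_commute)
    finally show ?thesis by (simp only: integral_scaleR_right)
  qed
  have bG: "integrable G f \<longleftrightarrow> integrable \<nu> (\<lambda>y. indicator B y *\<^sub>R f y)"
    if [measurable]: "f \<in> borel_measurable borel" for f :: "real \<Rightarrow> 'b::{banach, second_countable_topology}"
  proof -
    have "integrable G f \<longleftrightarrow> integrable \<nu> (\<lambda>y. inverse c *\<^sub>R (indicator B y *\<^sub>R f y))"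
      unfolding G_def using c by (subst integrable_density) (auto simp: divide_inverse_commute)
    then show ?thesis
      using c integrable_scaleR_right[of c \<nu> "\<lambda>y. inverse c *\<^sub>R (indicator B y *\<^sub>R f y)"]
        integrable_scaleR_right[of "inverse c" \<nu> "\<lambda>y. indicator B y *\<^sub>R f y"] by (auto simp: mult.assoc[symmetric])
  qed
  have diff: "t * c * ((\<integral>y. f y \<partial>G) - 1) = t * (\<integral>y. indicator B y * (f y - 1) \<partial>\<nu>)"
    if "integrable G f" for f :: "real \<Rightarrow> real"
  proof -
    have [measurable]: "f \<in> borel_measurable borel" using borel_measurable_integrable[OF that] by simp
    have "(\<integral>y. f y \<partial>G) - 1 = (\<integral>y. f y - 1 \<partial>G)" using that by (simp add: G.prob_space[simplified])
    also have "\<dots> = (\<integral>y. indicator B y * (f y - 1) \<partial>\<nu>) / c" by (simp add: iG divide_inverse_commute)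
    finally show ?thesis using c by simp
  qed
  have diffc: "complex_of_real (t * c) * ((\<integral>y. f y \<partial>G) - 1) = t * (\<integral>y. indicator B y *\<^sub>R (f y - 1) \<partial>\<nu>)"
    if "integrable G f" for f :: "real \<Rightarrow> complex"
  proof -
    have [measurable]: "f \<in> borel_measurable borel" using borel_measurable_integrable[OF that] by simp
    have "(\<integral>y. f y \<partial>G) - 1 = (\<integral>y. f y - 1 \<partial>G)" using that by (simp add: G.prob_space[simplified])
    also have "\<dots> = (\<integral>y. indicator B y *\<^sub>R (f y - 1) \<partial>\<nu>) /\<^sub>R c" by (simp add: iG)
    finally show ?thesis using c by (simp add: scaleR_conv_of_real)
  qed
  obtain L where L: "real_distribution L"
    and ch: "\<And>u. char L u = exp ((t * c) * (char G u - 1))"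
    and lap: "\<And>\<rho>. integrable G (\<lambda>y. exp (\<rho> * y)) \<Longrightarrow>
       (\<integral>\<^sup>+x. ennreal (exp (\<rho> * x)) \<partial>L) = ennreal (exp ((t * c) * ((\<integral>y. exp (\<rho> * y) \<partial>G) - 1)))"
    and pos: "(AE y in G. 0 \<le> y) \<Longrightarrow> (AE x in L. 0 \<le> x)"
    using compound_poisson_exists[OF G, of "t * c"] t' c by auto
  show ?thesis
  proof (rule that[OF L])
    fix u :: real
    have "integrable G (\<lambda>y. iexp (u * y))" by (rule G.integrable_const_bound[where B=1]) auto
    from diffc[OF this] show "char L u = exp (t * (\<integral>y. indicator B y *\<^sub>R (iexp (u * y) - 1) \<partial>\<nu>))"
      unfolding ch unfolding char_def by (simp only: of_real_mult)
  next
    fix \<rho> :: real assume "integrable \<nu> (\<lambda>y. indicator B y * exp (\<rho> * y))"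
    then have "integrable G (\<lambda>y. exp (\<rho> * y))" by (subst bG) auto
    from lap[OF this] diff[OF this]
    show "(\<integral>\<^sup>+x. ennreal (exp (\<rho> * x)) \<partial>L) = ennreal (exp (t * (\<integral>y. indicator B y * (exp (\<rho> * y) - 1) \<partial>\<nu>)))"
      by simp
  next
    assume "B \<subseteq> {0..}"
    then have "AE y in G. 0 \<le> y" unfolding G_def
      by (subst AE_density) (auto intro!: AE_I2 split: split_indicator)
    then show "AE x in L. 0 \<le> x" by (rule pos)
  qed
qed

section \<open>Weak limits and Laplace transforms\<close>

text \<open>Here \<phi> is not known to be a characteristic function. Tightness supplies a limit law
  along a subsequence, its characteristic function must be \<phi>, and only then does the continuity
  theorem give convergence of the whole sequence.\<close>

lemma tight_char_limit:
  fixes L :: "nat \<Rightarrow> real measure" and \<phi> :: "real \<Rightarrow> complex"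
  assumes L: "\<And>n. real_distribution (L n)" and t: "tight L"
    and ch: "\<And>u. (\<lambda>n. char (L n) u) \<longlonglongrightarrow> \<phi> u"
  obtains A where "real_distribution A" "\<And>u. char A u = \<phi> u"
    "weak_conv_m L A"
proof -
  obtain r A where r: "strict_mono (r::nat \<Rightarrow> nat)" and A: "real_distribution A"
    and w: "weak_conv_m (L \<circ> id \<circ> r) A"
    using tight_imp_convergent_subsubsequence[OF t, of id] by (auto simp: strict_mono_def)
  have c: "char A u = \<phi> u" for u
  proof (rule LIMSEQ_unique)
    show "(\<lambda>n. char ((L \<circ> id \<circ> r) n) u) \<longlonglongrightarrow> char A u"
      by (rule levy_continuity1[OF _ A w]) (auto intro: L)
    show "(\<lambda>n. char ((L \<circ> id \<circ> r) n) u) \<longlonglongrightarrow> \<phi> u"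
      using LIMSEQ_subseq_LIMSEQ[OF ch r, of u] by (simp add: o_def)
  qed
  have w': "weak_conv_m L A" by (rule levy_continuity[OF L A]) (simp add: c ch)
  show ?thesis by (rule that[OF A c w'])
qed

text \<open>The exponential is unbounded, so weak convergence is applied to its truncation at R;
  Fatou's lemma then removes the truncation. This yields an upper bound only.\<close>

lemma laplace_limit_le:
  fixes L :: "nat \<Rightarrow> real measure"
  assumes L: "\<And>n. real_distribution (L n)" and A: "real_distribution A"
    and w: "weak_conv_m L A"
    and i: "\<And>n. integrable (L n) (\<lambda>x. exp (\<rho> * x))"
    and a: "\<And>n. (\<integral>x. exp (\<rho> * x) \<partial>L n) \<le> a n" "a \<longlonglongrightarrow> a'"
  shows "integrable A (\<lambda>x. exp (\<rho> * x))" "(\<integral>x. exp (\<rho> * x) \<partial>A) \<le> a'"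
proof -
  interpret A: real_distribution A by fact
  interpret L: real_distribution "L n" for n by (rule L)
  have conv: "(\<lambda>n. (\<integral>x. f x \<partial>L n)) \<longlonglongrightarrow> (\<integral>x. f x \<partial>A)" if "\<And>x. isCont f x" "\<And>x. \<bar>f x\<bar> \<le> B"
    for f :: "real \<Rightarrow> real" and B
    using weak_conv_imp_integral_bdd_continuous_conv[OF L A w, of f B] that by simp
  have b: "(\<integral>x. min (exp (\<rho> * x)) (real R) \<partial>A) \<le> a'" for R
  proof (rule LIMSEQ_le[OF conv a(2)])
    show "isCont (\<lambda>x. min (exp (\<rho> * x)) (real R)) x" for x by (intro continuous_intros)
    show "\<bar>min (exp (\<rho> * x)) (real R)\<bar> \<le> real R" for x by (auto simp: abs_if min_def)
    have "(\<integral>x. min (exp (\<rho> * x)) (real R) \<partial>L n) \<le> (\<integral>x. exp (\<rho> * x) \<partial>L n)" for n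
      by (intro integral_mono i L.integrable_const_bound[where B="real R"]) (auto simp: abs_if min_def)
    then show "\<exists>N. \<forall>n\<ge>N. (\<integral>x. min (exp (\<rho> * x)) (real R) \<partial>L n) \<le> a n"
      using a(1) order_trans by blast
  qed
  have a0: "0 \<le> a'" using b[of 0] by (simp add: min_def split: if_splits)
  have "(\<integral>\<^sup>+x. ennreal (exp (\<rho> * x)) \<partial>A) = (\<integral>\<^sup>+x. liminf (\<lambda>R. ennreal (min (exp (\<rho> * x)) (real R))) \<partial>A)"
  proof (intro nn_integral_cong)
    fix x :: real
    have "(\<lambda>R. ennreal (min (exp (\<rho> * x)) (real R))) \<longlonglongrightarrow> ennreal (exp (\<rho> * x))"
    proof (rule tendsto_eventually)
      obtain R0 where "exp (\<rho> * x) \<le> real R0" using real_arch_simple by blast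
      then show "\<forall>\<^sub>F R in sequentially. ennreal (min (exp (\<rho> * x)) (real R)) = ennreal (exp (\<rho> * x))"
        by (intro eventually_sequentiallyI[of R0]) (auto simp: min_def)
    qed
    then show "ennreal (exp (\<rho> * x)) = liminf (\<lambda>R. ennreal (min (exp (\<rho> * x)) (real R)))"
      by (rule lim_imp_Liminf[OF sequentially_bot, symmetric])
  qed
  also have "\<dots> \<le> liminf (\<lambda>R. \<integral>\<^sup>+x. ennreal (min (exp (\<rho> * x)) (real R)) \<partial>A)"
    by (rule nn_integral_liminf) auto
  also have "\<dots> \<le> liminf (\<lambda>R. ennreal a')"
  proof (rule Liminf_mono, rule always_eventually, rule allI)
    fix R
    have "(\<integral>\<^sup>+x. ennreal (min (exp (\<rho> * x)) (real R)) \<partial>A) = ennreal (\<integral>x. min (exp (\<rho> * x)) (real R) \<partial>A)"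
      by (intro nn_integral_eq_integral A.integrable_const_bound[where B="real R"]) (auto simp: abs_if min_def)
    then show "(\<integral>\<^sup>+x. ennreal (min (exp (\<rho> * x)) (real R)) \<partial>A) \<le> ennreal a'" using b[of R] by (simp add: ennreal_leI)
  qed
  finally have c: "(\<integral>\<^sup>+x. ennreal (exp (\<rho> * x)) \<partial>A) \<le> ennreal a'" by (simp add: Liminf_const)
  show 1: "integrable A (\<lambda>x. exp (\<rho> * x))"
    by (rule integrableI_bounded) (use c in \<open>auto simp: le_less_trans\<close>)
  have "ennreal (\<integral>x. exp (\<rho> * x) \<partial>A) \<le> ennreal a'" using c by (subst (asm) nn_integral_eq_integral[OF 1]) auto
  then show "(\<integral>x. exp (\<rho> * x) \<partial>A) \<le> a'" using a0 by (simp add: ennreal_le_iff)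
qed

text \<open>Bounded moments at 2 \<rho> give uniform integrability at \<rho>, which supplies the
  missing lower bound: E - E^2 / R \<le> min E R for E = exp (\<rho> x), so truncating at R costs at
  most the moment at 2 \<rho> divided by R.\<close>

lemma laplace_limit:
  fixes L :: "nat \<Rightarrow> real measure"
  assumes L: "\<And>n. real_distribution (L n)" and A: "real_distribution A"
    and w: "weak_conv_m L A"
    and i: "\<And>n. integrable (L n) (\<lambda>x. exp (\<rho> * x))" "\<And>n. integrable (L n) (\<lambda>x. exp (2 * \<rho> * x))"
    and a: "(\<lambda>n. \<integral>x. exp (\<rho> * x) \<partial>L n) \<longlonglongrightarrow> a" and b: "(\<lambda>n. \<integral>x. exp (2 * \<rho> * x) \<partial>L n) \<longlonglongrightarrow> b"
  shows "(\<integral>x. exp (\<rho> * x) \<partial>A) = a"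
proof (rule antisym)
  show "(\<integral>x. exp (\<rho> * x) \<partial>A) \<le> a"
    by (rule laplace_limit_le(2)[OF L A w i(1) order_refl a])
next
  interpret A: real_distribution A by fact
  interpret L: real_distribution "L n" for n by (rule L)
  have conv: "(\<lambda>n. (\<integral>x. f x \<partial>L n)) \<longlonglongrightarrow> (\<integral>x. f x \<partial>A)" if "\<And>x. isCont f x" "\<And>x. \<bar>f x\<bar> \<le> B"
    for f :: "real \<Rightarrow> real" and B
    using weak_conv_imp_integral_bdd_continuous_conv[OF L A w, of f B] that by simp
  have iA: "integrable A (\<lambda>x. exp (\<rho> * x))"
    by (rule laplace_limit_le(1)[OF L A w i(1) order_refl a])
  have c: "a - b / R \<le> (\<integral>x. exp (\<rho> * x) \<partial>A)" if R: "0 < R" for R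
  proof -
    have m: "integrable M (\<lambda>x. min (exp (\<rho> * x)) R)" if "real_distribution M" for M
    proof -
      interpret real_distribution M by fact
      show ?thesis by (rule integrable_const_bound[where B=R]) (use R in \<open>auto simp: abs_if min_def\<close>)
    qed
    have "a - b / R \<le> (\<integral>x. min (exp (\<rho> * x)) R \<partial>A)"
    proof (rule LIMSEQ_le[OF tendsto_diff[OF a tendsto_divide[OF b tendsto_const]] conv])
      show "isCont (\<lambda>x. min (exp (\<rho> * x)) R) x" for x by (intro continuous_intros)
      show "\<bar>min (exp (\<rho> * x)) R\<bar> \<le> R" for x using R by (auto simp: abs_if min_def)
      have "(\<integral>x. exp (\<rho> * x) \<partial>L n) - (\<integral>x. exp (2 * \<rho> * x) \<partial>L n) / R \<le> (\<integral>x. min (exp (\<rho> * x)) R \<partial>L n)" for n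
      proof -
        have "(\<integral>x. exp (\<rho> * x) \<partial>L n) - (\<integral>x. exp (2 * \<rho> * x) \<partial>L n) / R = (\<integral>x. exp (\<rho> * x) - exp (2 * \<rho> * x) / R \<partial>L n)"
          using i by simp
        also have "\<dots> \<le> (\<integral>x. min (exp (\<rho> * x)) R \<partial>L n)"
        proof (intro integral_mono m L)
          show "integrable (L n) (\<lambda>x. exp (\<rho> * x) - exp (2 * \<rho> * x) / R)" using i by simp
          fix x
          have sq: "R * E \<le> R * R + E * E" if "0 < E" for E
            using zero_le_power2[of "E - R"] mult_pos_pos[OF R that]
            unfolding power2_eq_square by (simp only: algebra_simps)
          have "exp (2 * \<rho> * x) = exp (\<rho> * x) * exp (\<rho> * x)" by (simp add: exp_add[symmetric])
          then have "exp (\<rho> * x) \<le> R + exp (2 * \<rho> * x) / R"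
            using R sq[of "exp (\<rho> * x)"] by (simp add: field_simps)
          then show "exp (\<rho> * x) - exp (2 * \<rho> * x) / R \<le> min (exp (\<rho> * x)) R"
            using R by (auto simp: min_def)
        qed
        finally show ?thesis .
      qed
      then show "\<exists>N. \<forall>n\<ge>N. (\<integral>x. exp (\<rho> * x) \<partial>L n) - (\<integral>x. exp (2 * \<rho> * x) \<partial>L n) / R \<le> (\<integral>x. min (exp (\<rho> * x)) R \<partial>L n)"
        by blast
    qed (use R in simp)
    also have "\<dots> \<le> (\<integral>x. exp (\<rho> * x) \<partial>A)" by (intro integral_mono m A iA) simp
    finally show ?thesis .
  qed
  have "((\<lambda>R. a - b / R) \<longlongrightarrow> a - 0) at_top"
    by (intro tendsto_intros real_tendsto_divide_at_top[OF tendsto_const]) (rule filterlim_ident)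
  then have "a - 0 \<le> (\<integral>x. exp (\<rho> * x) \<partial>A)"
    by (rule tendsto_upperbound) (auto intro!: eventually_mono[OF eventually_gt_at_top[of 0]] c)
  then show "a \<le> (\<integral>x. exp (\<rho> * x) \<partial>A)" by simp
qed

text \<open>Chebyshev's inequality for exp (\<rho> x) around 1: if |\<rho> x| \<ge> 1, then exp
  (\<rho> x) is at distance at least 1/2 from 1, whence the factor 4. It gives two-sided control
  from exponential moments of one sign, both for tightness and for concentration.\<close>

lemma exp_Markov_inequality:
  assumes L: "real_distribution L"
    and i: "integrable L (\<lambda>x. exp (\<rho> * x))" "integrable L (\<lambda>x. exp (2 * \<rho> * x))"
  shows "measure L {x. 1 \<le> \<bar>\<rho> * x\<bar>} \<le> 4 * ((\<integral>x. exp (2 * \<rho> * x) \<partial>L) - 2 * (\<integral>x. exp (\<rho> * x) \<partial>L) + 1)"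
proof -
  interpret real_distribution L by (rule L)
  have sq: "(exp (\<rho> * x) - 1)\<^sup>2 = exp (2 * \<rho> * x) - 2 * exp (\<rho> * x) + 1" for x
  proof -
    have "exp (2 * \<rho> * x) = exp (\<rho> * x) * exp (\<rho> * x)" by (simp add: exp_add[symmetric])
    then show ?thesis by (simp add: power2_eq_square algebra_simps)
  qed
  have isq: "integrable L (\<lambda>x. (exp (\<rho> * x) - 1)\<^sup>2)" unfolding sq using i by simp
  have "1 / 4 \<le> (exp (\<rho> * x) - 1)\<^sup>2" if x: "1 \<le> \<bar>\<rho> * x\<bar>" for x
  proof -
    have e1: "2 \<le> exp (1::real)" using exp_ge_add_one_self[of 1] by simp
    have "\<rho> * x \<le> - 1 \<or> 1 \<le> \<rho> * x" using x by linarith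
    then have "exp (\<rho> * x) \<le> exp (- 1) \<or> exp 1 \<le> exp (\<rho> * x)" by auto
    moreover have "exp (- 1 :: real) \<le> 1 / 2" using e1 by (simp add: exp_minus field_simps)
    ultimately have "1 / 2 \<le> \<bar>exp (\<rho> * x) - 1\<bar>" using e1 by linarith
    from power_mono[OF this, of 2] show ?thesis by (simp add: power2_eq_square)
  qed
  then have "measure L {x. 1 \<le> \<bar>\<rho> * x\<bar>} \<le> measure L {x \<in> space L. 1 / 4 \<le> (exp (\<rho> * x) - 1)\<^sup>2}"
    by (intro finite_measure_mono) auto
  also have "\<dots> \<le> (\<integral>x. (exp (\<rho> * x) - 1)\<^sup>2 \<partial>L) / (1 / 4)"
    by (rule integral_Markov_inequality_measure[OF isq, of "{}"]) auto
  also have "(\<integral>x. (exp (\<rho> * x) - 1)\<^sup>2 \<partial>L) = (\<integral>x. exp (2 * \<rho> * x) \<partial>L) - 2 * (\<integral>x. exp (\<rho> * x) \<partial>L) + 1"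
    unfolding sq using i prob_space by simp
  finally show ?thesis by simp
qed

section \<open>Decomposition of the law into negative and positive jumps\<close>

lemma exp_nonpos_le_quadratic:
  fixes x :: real assumes "x \<le> 0" shows "exp x - 1 - x \<le> x\<^sup>2 / 2"
proof -
  define z where "z = - x"
  have z: "0 \<le> z" using assms by (simp add: z_def)
  \<comment> \<open>The product equals 1 + z^4 / 4; with the Taylor lower bound for exp z it becomes
    an upper bound for exp (- z).\<close>
  have "1 \<le> (1 - z + z\<^sup>2 / 2) * (1 + z + z\<^sup>2 / 2)"
    using zero_le_power2[of "z * z"] by (simp add: algebra_simps power2_eq_square)
  also have "\<dots> \<le> (1 - z + z\<^sup>2 / 2) * exp z"
  proof (rule mult_left_mono)
    show "1 + z + z\<^sup>2 / 2 \<le> exp z" using exp_lower_Taylor_quadratic[OF z] by simp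
    have "0 \<le> (1 - z)\<^sup>2 / 2 + 1 / 2" by simp
    also have "\<dots> = 1 - z + z\<^sup>2 / 2" by (simp add: power2_eq_square field_simps)
    finally show "0 \<le> 1 - z + z\<^sup>2 / 2" .
  qed
  finally have "exp (- z) \<le> 1 - z + z\<^sup>2 / 2" by (simp add: exp_minus field_simps)
  then show ?thesis by (simp add: z_def)
qed

text \<open>The compensator is exp y - 1 rather than y, as in the characteristic exponent. Hence the
  kernel vanishes at \<rho> = 1, and the exponential of the resulting variable has mean one.\<close>

definition neg_kernel :: "real \<Rightarrow> real \<Rightarrow> real" where
  "neg_kernel \<rho> y = exp (\<rho> * y) - 1 - \<rho> * (exp y - 1)"

definition neg_exponent :: "real measure \<Rightarrow> real \<Rightarrow> real" where
  "neg_exponent \<nu> \<rho> = (\<integral>y. indicator {..<0} y * neg_kernel \<rho> y \<partial>\<nu>)"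

lemma neg_kernel_measurable[measurable]: "neg_kernel \<rho> \<in> borel_measurable borel"
  unfolding neg_kernel_def by simp

lemma neg_kernel_abs_le_linear:
  assumes y: "y < 0" and \<rho>: "0 \<le> \<rho>"
  shows "\<bar>neg_kernel \<rho> y\<bar> \<le> 1 + \<rho>"
proof -
  have e: "0 \<le> exp (\<rho> * y)" "exp (\<rho> * y) \<le> 1" "0 \<le> exp y" "exp y \<le> 1"
    using y \<rho> by (auto simp: mult_nonneg_nonpos)
  have "\<bar>\<rho> * (exp y - 1)\<bar> \<le> \<rho> * 1" unfolding abs_mult using \<rho> e by (intro mult_mono) auto
  then show ?thesis unfolding neg_kernel_def using e by linarith
qed

text \<open>Near 0 the kernel is the second-order remainder of exp at \<rho> y minus \<rho> times
  the remainder at y, hence of order y^2; away from 0 the linear bound applies.\<close>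

lemma neg_kernel_abs_le:
  assumes y: "y < 0" and \<rho>: "0 \<le> \<rho>"
  shows "\<bar>neg_kernel \<rho> y\<bar> \<le> (1 + \<rho> + \<rho>\<^sup>2) * min 1 (y\<^sup>2)"
proof -
  note 1 = neg_kernel_abs_le_linear[OF y \<rho>]
  have "0 \<le> exp (\<rho> * y) - 1 - \<rho> * y" "exp (\<rho> * y) - 1 - \<rho> * y \<le> (\<rho> * y)\<^sup>2 / 2"
    using exp_nonpos_le_quadratic[of "\<rho> * y"] exp_ge_add_one_self[of "\<rho> * y"] y \<rho>
    by (linarith, simp add: mult_nonneg_nonpos)
  moreover have "0 \<le> exp y - 1 - y" "exp y - 1 - y \<le> y\<^sup>2 / 2"
    using exp_nonpos_le_quadratic[of y] exp_ge_add_one_self[of y] y by (linarith, simp)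
  then have "0 \<le> \<rho> * (exp y - 1 - y)" "\<rho> * (exp y - 1 - y) \<le> \<rho> * (y\<^sup>2 / 2)"
    using \<rho> by (auto intro!: mult_left_mono simp del: times_divide_eq_right)
  moreover have "neg_kernel \<rho> y = (exp (\<rho> * y) - 1 - \<rho> * y) - \<rho> * (exp y - 1 - y)"
    by (simp add: neg_kernel_def algebra_simps)
  moreover have "0 \<le> \<rho> * y\<^sup>2" "0 \<le> (\<rho> * y)\<^sup>2" using \<rho> by auto
  ultimately have 2: "\<bar>neg_kernel \<rho> y\<bar> \<le> (\<rho> + \<rho>\<^sup>2) * y\<^sup>2"
    unfolding distrib_right power_mult_distrib by linarith
  have "(1 + \<rho>) \<le> (1 + \<rho> + \<rho>\<^sup>2)" "(\<rho> + \<rho>\<^sup>2) * y\<^sup>2 \<le> (1 + \<rho> + \<rho>\<^sup>2) * y\<^sup>2"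
    by (auto intro!: mult_right_mono)
  moreover have "0 \<le> \<rho>\<^sup>2" by simp
  ultimately have "\<bar>neg_kernel \<rho> y\<bar> \<le> (1 + \<rho> + \<rho>\<^sup>2) * 1" "\<bar>neg_kernel \<rho> y\<bar> \<le> (1 + \<rho> + \<rho>\<^sup>2) * y\<^sup>2"
    using order_trans[OF 1] order_trans[OF 2] by auto
  then show ?thesis by (auto simp: min_def)
qed

text \<open>Convexity: exp (\<rho> y) lies below the chord (1 - \<rho>) + \<rho> exp y.\<close>

lemma neg_kernel_nonpos:
  assumes "0 \<le> \<rho>" "\<rho> \<le> 1" shows "neg_kernel \<rho> y \<le> 0"
  using convex_onD[OF exp_convex, of \<rho> 0 y] assms by (simp add: neg_kernel_def algebra_simps)

text \<open>Replacing \<rho> by 1 / \<rho> and y by \<rho> y multiplies the kernel by -1 / \<rho>,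
  so the sign reverses on the other side of 1.\<close>

lemma neg_kernel_nonneg:
  assumes "1 \<le> \<rho>" shows "0 \<le> neg_kernel \<rho> y"
proof -
  have "neg_kernel (1 / \<rho>) (\<rho> * y) \<le> 0" by (rule neg_kernel_nonpos) (use assms in auto)
  then show ?thesis using assms by (simp add: neg_kernel_def field_simps)
qed

text \<open>For y > 0 one has y \<le> exp y - 1, so \<open>int_pos\<close> makes the positive jumps
  summable. They can be left uncompensated, and their compensator becomes a drift.\<close>

locale exp_levy_measure =
  fixes \<nu> :: "real measure"
  assumes sets_nu[measurable_cong]: "sets \<nu> = sets borel"
    and fin: "(\<integral>\<^sup>+ y. ennreal (min 1 (y\<^sup>2)) \<partial>\<nu>) < \<infinity>"
    and int_char: "\<And>u::real. integrable \<nu> (\<lambda>y. cis (u * y) - 1 - \<i> * complex_of_real u * complex_of_real (exp y - 1))"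
    and int_pos: "integrable \<nu> (\<lambda>y. max 0 (exp y - 1))"
begin

lemma space_nu[simp]: "space \<nu> = UNIV"
  using sets_eq_imp_space_eq[OF sets_nu] by simp

lemma integrable_min: "integrable \<nu> (\<lambda>y. min 1 (y\<^sup>2))"
  by (rule integrableI_nonneg) (use fin in auto)

lemma finite_away:
  assumes "0 < e" shows "emeasure \<nu> {y. e \<le> \<bar>y\<bar>} < \<infinity>"
proof -
  have "emeasure \<nu> {y. e \<le> \<bar>y\<bar>} \<le> emeasure \<nu> {y \<in> space \<nu>. min 1 (e\<^sup>2) \<le> min 1 (y\<^sup>2)}"
  proof (rule emeasure_mono)
    show "{y \<in> space \<nu>. min 1 (e\<^sup>2) \<le> min 1 (y\<^sup>2)} \<in> sets \<nu>" by measurable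
    have "min 1 (e\<^sup>2) \<le> min 1 (y\<^sup>2)" if "e \<le> \<bar>y\<bar>" for y
      by (rule min.mono) (use power_mono[OF that, of 2] assms in auto)
    then show "{y. e \<le> \<bar>y\<bar>} \<subseteq> {y \<in> space \<nu>. min 1 (e\<^sup>2) \<le> min 1 (y\<^sup>2)}" by simp blast
  qed
  also have "\<dots> \<le> ennreal (1 / (min 1 (e\<^sup>2)) * (\<integral>y. min 1 (y\<^sup>2) \<partial>\<nu>))"
    by (rule integral_Markov_inequality[OF integrable_min]) (use assms in auto)
  also have "\<dots> < \<infinity>" by simp
  finally show ?thesis .
qed

lemma integrable_neg_kernel:
  assumes [measurable]: "B \<in> sets borel" and B: "B \<subseteq> {..<0}" and "0 \<le> \<rho>"
  shows "integrable \<nu> (\<lambda>y. indicator B y * neg_kernel \<rho> y)"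
proof (rule Bochner_Integration.integrable_bound)
  show "integrable \<nu> (\<lambda>y. (1 + \<rho> + \<rho>\<^sup>2) * min 1 (y\<^sup>2))" using integrable_min by simp
  show "AE y in \<nu>. norm (indicator B y * neg_kernel \<rho> y) \<le> norm ((1 + \<rho> + \<rho>\<^sup>2) * min 1 (y\<^sup>2))"
  proof (rule AE_I2)
    fix y
    have "0 \<le> (1 + \<rho> + \<rho>\<^sup>2) * min 1 (y\<^sup>2)" using assms by auto
    then show "norm (indicator B y * neg_kernel \<rho> y) \<le> norm ((1 + \<rho> + \<rho>\<^sup>2) * min 1 (y\<^sup>2))"
      using neg_kernel_abs_le[of y \<rho>] assms by (cases "y \<in> B") (auto simp: subset_eq)
  qed
qed simp

text \<open>Continuity of the exponent at 0 along a sequence. The tightness argument takes its small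
  tilt from here.\<close>

lemma neg_exponent_tendsto_0: "(\<lambda>n. neg_exponent \<nu> (1 / real (Suc n))) \<longlonglongrightarrow> 0"
proof -
  have "(\<lambda>n. \<integral>y. indicator {..<0} y * neg_kernel (1 / real (Suc n)) y \<partial>\<nu>) \<longlonglongrightarrow> (\<integral>y. 0 \<partial>\<nu>)"
  proof (rule integral_dominated_convergence[where w="\<lambda>y. 3 * min 1 (y\<^sup>2)"])
    show "integrable \<nu> (\<lambda>y. 3 * min 1 (y\<^sup>2))" using integrable_min by simp
    show "AE y in \<nu>. (\<lambda>n. indicator {..<0} y * neg_kernel (1 / real (Suc n)) y) \<longlonglongrightarrow> 0"
    proof (rule AE_I2)
      fix y :: real
      have "(\<lambda>n. exp (1 / real (Suc n) * y) - 1 - 1 / real (Suc n) * (exp y - 1)) \<longlonglongrightarrow> exp (0 * y) - 1 - 0 * (exp y - 1)"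
        by (intro tendsto_intros) (use LIMSEQ_inverse_real_of_nat in \<open>simp_all add: inverse_eq_divide\<close>)
      then have "(\<lambda>n. indicator {..<0} y * neg_kernel (1 / real (Suc n)) y) \<longlonglongrightarrow> indicator {..<0} y * 0"
        unfolding neg_kernel_def by (intro tendsto_mult) auto
      then show "(\<lambda>n. indicator {..<0} y * neg_kernel (1 / real (Suc n)) y) \<longlonglongrightarrow> 0" by simp
    qed
    show "AE y in \<nu>. norm (indicator {..<0} y * neg_kernel (1 / real (Suc n)) y) \<le> 3 * min 1 (y\<^sup>2)" for n
    proof (rule AE_I2)
      fix y :: real
      have r: "0 \<le> 1 / real (Suc n)" "1 / real (Suc n) \<le> 1" by auto
      have "1 + 1 / real (Suc n) + (1 / real (Suc n))\<^sup>2 \<le> 3"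
        using r(2) power_mono[OF r(2) r(1), of 2] unfolding power_one by linarith
      then have "(1 + 1 / real (Suc n) + (1 / real (Suc n))\<^sup>2) * min 1 (y\<^sup>2) \<le> 3 * min 1 (y\<^sup>2)"
        by (rule mult_right_mono) simp
      then show "norm (indicator {..<0} y * neg_kernel (1 / real (Suc n)) y) \<le> 3 * min 1 (y\<^sup>2)"
        using order_trans[OF neg_kernel_abs_le[OF _ r(1), of y]] by (auto split: split_indicator simp del: of_nat_Suc)
    qed
  qed auto
  then show ?thesis by (simp add: neg_exponent_def)
qed

definition cut :: "nat \<Rightarrow> real set" where "cut n = {.. - (1 / real (Suc n))}"

lemma cut_borel[measurable]: "cut n \<in> sets borel" by (simp add: cut_def)
lemma cut_sub: "cut n \<subseteq> {..<0}"
proof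
  fix y assume "y \<in> cut n"
  moreover have "0 < 1 / real (Suc n)" by simp
  ultimately show "y \<in> {..<0}" unfolding cut_def atMost_iff lessThan_iff by linarith
qed
lemma cut_finite: "emeasure \<nu> (cut n) < \<infinity>"
proof -
  have "emeasure \<nu> (cut n) \<le> emeasure \<nu> {y. 1 / real (Suc n) \<le> \<bar>y\<bar>}"
    by (rule emeasure_mono) (auto simp: cut_def simp del: of_nat_Suc)
  then show ?thesis using finite_away[of "1 / real (Suc n)"] by (auto simp: le_less_trans)
qed

lemma cut_tendsto: "(\<lambda>n. indicator (cut n) y *\<^sub>R c) \<longlonglongrightarrow> indicator {..<0} y *\<^sub>R (c::'c::real_normed_vector)"
proof (cases "y < 0")
  case True
  obtain N where N: "1 / real (Suc N) < - y" using reals_Archimedean[of "- y"] True by (auto simp: inverse_eq_divide)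
  show ?thesis
  proof (rule tendsto_eventually, rule eventually_sequentiallyI[of N])
    fix n assume "N \<le> n"
    then have "1 / real (Suc n) \<le> 1 / real (Suc N)" by (intro divide_left_mono) auto
    then have "y \<in> cut n" using N unfolding cut_def by (simp del: of_nat_Suc)
    then show "indicator (cut n) y *\<^sub>R c = indicator {..<0} y *\<^sub>R c" using True by simp
  qed
next
  case False
  then have "y \<notin> cut n" for n using cut_sub[of n] by auto
  then show ?thesis using False by simp
qed

text \<open>Jumps above -1/(n+1) are dropped, which leaves a compound Poisson law. Convolving with
  the point mass at \<open>s\<close> adds the compensator of the remaining jumps as a deterministic
  drift.\<close>

lemma neg_approx:
  assumes t: "0 \<le> t"
  obtains L where "real_distribution L"
    "\<And>u. char L u = exp (t * (\<integral>y. indicator (cut n) y *\<^sub>R (iexp (u * y) - 1 - \<i> * complex_of_real u * complex_of_real (exp y - 1)) \<partial>\<nu>))"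
    "\<And>\<rho>. 0 \<le> \<rho> \<Longrightarrow> integrable L (\<lambda>x. exp (\<rho> * x)) \<and>
       (\<integral>x. exp (\<rho> * x) \<partial>L) = exp (t * (\<integral>y. indicator (cut n) y * neg_kernel \<rho> y \<partial>\<nu>))"
proof -
  have ib: "integrable \<nu> (\<lambda>y. indicator (cut n) y *\<^sub>R f y)"
    if [measurable]: "f \<in> borel_measurable borel" and b: "\<And>y. y < 0 \<Longrightarrow> norm (f y) \<le> c"
    for f :: "real \<Rightarrow> 'b::{banach, second_countable_topology}" and c
  proof (rule Bochner_Integration.integrable_bound[of _ "\<lambda>y. c * indicator (cut n) y"])
    show "integrable \<nu> (\<lambda>y. c * indicator (cut n) y)" using cut_finite[of n] by simp
    show "AE y in \<nu>. norm (indicator (cut n) y *\<^sub>R f y) \<le> norm (c * indicator (cut n) y)"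
      using b cut_sub[of n] by (intro AE_I2) (auto split: split_indicator intro: order_trans[OF _ abs_ge_self])
  qed simp
  obtain L0 where L0: "real_distribution L0"
    and ch: "\<And>u. char L0 u = exp (t * (\<integral>y. indicator (cut n) y *\<^sub>R (iexp (u * y) - 1) \<partial>\<nu>))"
    and lap: "\<And>\<rho>. integrable \<nu> (\<lambda>y. indicator (cut n) y * exp (\<rho> * y)) \<Longrightarrow>
       (\<integral>\<^sup>+x. ennreal (exp (\<rho> * x)) \<partial>L0) = ennreal (exp (t * (\<integral>y. indicator (cut n) y * (exp (\<rho> * y) - 1) \<partial>\<nu>)))"
    by (rule compound_poisson_restrict_exists[OF sets_nu cut_borel[of n] cut_finite[of n] t]) (rule that)
  define s where "s = t * (\<integral>y. indicator (cut n) y * (1 - exp y) \<partial>\<nu>)"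
  define L where "L = (return borel s \<star> L0)"
  have L: "real_distribution L" unfolding L_def by (intro prob_space_convolution real_distribution_return L0)
  interpret L: real_distribution L by fact
  have ie: "integrable \<nu> (\<lambda>y. indicator (cut n) y * (1 - exp y))"
    using ib[of "\<lambda>y. 1 - exp y" 1] by (simp add: abs_if)
  show ?thesis
  proof (rule that[OF L])
    fix u :: real
    have i1: "integrable \<nu> (\<lambda>y. indicator (cut n) y *\<^sub>R (iexp (u * y) - 1))"
      by (rule ib[of _ 2]) (auto intro!: order_trans[OF norm_triangle_ineq4])
    have i2: "integrable \<nu> (\<lambda>y. complex_of_real (indicator (cut n) y * (1 - exp y)))"
      using ie by (rule integrable_of_real)
    have "char L u = iexp (u * s) * char L0 u"
      unfolding L_def char_convolution[OF real_distribution_return L0] by (simp add: char_def[of "return borel s"] integral_return)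
    also have "\<dots> = exp (t * ((\<integral>y. indicator (cut n) y *\<^sub>R (iexp (u * y) - 1) \<partial>\<nu>) + \<i> * u * (\<integral>y. complex_of_real (indicator (cut n) y * (1 - exp y)) \<partial>\<nu>)))"
      unfolding ch exp_add[symmetric] integral_complex_of_real by (rule arg_cong[where f=exp]) (simp add: s_def algebra_simps)
    also have "(\<integral>y. indicator (cut n) y *\<^sub>R (iexp (u * y) - 1) \<partial>\<nu>) + \<i> * u * (\<integral>y. complex_of_real (indicator (cut n) y * (1 - exp y)) \<partial>\<nu>)
      = (\<integral>y. indicator (cut n) y *\<^sub>R (iexp (u * y) - 1) + \<i> * u * complex_of_real (indicator (cut n) y * (1 - exp y)) \<partial>\<nu>)"
      using i1 i2 by (simp del: of_real_mult)
    also have "\<dots> = (\<integral>y. indicator (cut n) y *\<^sub>R (iexp (u * y) - 1 - \<i> * complex_of_real u * complex_of_real (exp y - 1)) \<partial>\<nu>)"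
      by (rule Bochner_Integration.integral_cong[OF refl]) (simp add: indicator_def right_diff_distrib)
    finally show "char L u = exp (t * (\<integral>y. indicator (cut n) y *\<^sub>R (iexp (u * y) - 1 - \<i> * complex_of_real u * complex_of_real (exp y - 1)) \<partial>\<nu>))" .
  next
    fix \<rho> :: real assume \<rho>: "0 \<le> \<rho>"
    have b: "exp (\<rho> * y) \<le> 1" if "y < 0" for y using that \<rho> by (simp add: mult_nonneg_nonpos)
    have i1: "integrable \<nu> (\<lambda>y. indicator (cut n) y * exp (\<rho> * y))"
      using ib[of "\<lambda>y. exp (\<rho> * y)" 1] b by simp
    have b2: "norm (exp (\<rho> * y) - 1) \<le> 1" if "y < 0" for y
      using b[OF that] exp_ge_zero[of "\<rho> * y"] unfolding real_norm_def abs_le_iff by linarith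
    have i3: "integrable \<nu> (\<lambda>y. indicator (cut n) y * (exp (\<rho> * y) - 1))"
      using ib[of "\<lambda>y. exp (\<rho> * y) - 1" 1] b2 by simp
    have "(\<integral>\<^sup>+x. ennreal (exp (\<rho> * x)) \<partial>L) = ennreal (exp (\<rho> * s)) * ennreal (exp (t * (\<integral>y. indicator (cut n) y * (exp (\<rho> * y) - 1) \<partial>\<nu>)))"
      unfolding L_def by (simp add: nn_integral_exp_convolution real_distribution_return L0 nn_integral_return lap[OF i1])
    also have "\<dots> = ennreal (exp (\<rho> * s + t * (\<integral>y. indicator (cut n) y * (exp (\<rho> * y) - 1) \<partial>\<nu>)))"
      by (simp add: ennreal_mult[symmetric] exp_add)
    also have "\<rho> * s + t * (\<integral>y. indicator (cut n) y * (exp (\<rho> * y) - 1) \<partial>\<nu>)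
        = t * (\<rho> * (\<integral>y. indicator (cut n) y * (1 - exp y) \<partial>\<nu>) + (\<integral>y. indicator (cut n) y * (exp (\<rho> * y) - 1) \<partial>\<nu>))"
      unfolding s_def by (simp only: algebra_simps)
    also have "\<rho> * (\<integral>y. indicator (cut n) y * (1 - exp y) \<partial>\<nu>) + (\<integral>y. indicator (cut n) y * (exp (\<rho> * y) - 1) \<partial>\<nu>)
        = (\<integral>y. \<rho> * (indicator (cut n) y * (1 - exp y)) + indicator (cut n) y * (exp (\<rho> * y) - 1) \<partial>\<nu>)"
      using Bochner_Integration.integral_add[of \<nu> "\<lambda>y. \<rho> * (indicator (cut n) y * (1 - exp y))", OF _ i3] ie by simp
    also have "\<dots> = (\<integral>y. indicator (cut n) y * neg_kernel \<rho> y \<partial>\<nu>)"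
      by (rule Bochner_Integration.integral_cong[OF refl]) (simp add: indicator_def neg_kernel_def right_diff_distrib)
    finally have e: "(\<integral>\<^sup>+x. ennreal (exp (\<rho> * x)) \<partial>L) = ennreal (exp (t * (\<integral>y. indicator (cut n) y * neg_kernel \<rho> y \<partial>\<nu>)))" .
    have i: "integrable L (\<lambda>x. exp (\<rho> * x))" by (rule integrableI_bounded) (auto simp: e)
    have "(\<integral>\<^sup>+x. ennreal (exp (\<rho> * x)) \<partial>L) = ennreal (\<integral>x. exp (\<rho> * x) \<partial>L)"
      by (intro nn_integral_eq_integral i AE_I2 exp_ge_zero)
    then have "ennreal (\<integral>x. exp (\<rho> * x) \<partial>L) = ennreal (exp (t * (\<integral>y. indicator (cut n) y * neg_kernel \<rho> y \<partial>\<nu>)))"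
      unfolding e by (rule sym)
    then have "(\<integral>x. exp (\<rho> * x) \<partial>L) = exp (t * (\<integral>y. indicator (cut n) y * neg_kernel \<rho> y \<partial>\<nu>))"
      by (subst (asm) ennreal_inj) auto
    with i show "integrable L (\<lambda>x. exp (\<rho> * x)) \<and>
       (\<integral>x. exp (\<rho> * x) \<partial>L) = exp (t * (\<integral>y. indicator (cut n) y * neg_kernel \<rho> y \<partial>\<nu>))"
      by (rule conjI)
  qed
qed

end

context exp_levy_measure
begin

text \<open>On \<open>0 \<le> \<rho> \<le> 1\<close> the exponent is negative and increases under truncation, which makes the bounds on
  the first two exponential moments in the tightness argument uniform in the truncation level.\<close>

lemma neg_law_exists:
  assumes t: "0 \<le> t"
  obtains A where "real_distribution A"
    "\<And>u. char A u = exp (t * (\<integral>y. indicator {..<0} y *\<^sub>R (iexp (u * y) - 1 - \<i> * complex_of_real u * complex_of_real (exp y - 1)) \<partial>\<nu>))"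
    "\<And>\<rho>. 0 \<le> \<rho> \<Longrightarrow> integrable A (\<lambda>x. exp (\<rho> * x)) \<and> (\<integral>x. exp (\<rho> * x) \<partial>A) = exp (t * neg_exponent \<nu> \<rho>)"
proof -
  define g where "g u y = iexp (u * y) - 1 - \<i> * complex_of_real u * complex_of_real (exp y - 1)" for u y :: real
  have gi: "integrable \<nu> (g u)" for u using int_char[of u] unfolding g_def[abs_def] cis_conv_exp by simp
  have gm[measurable]: "g u \<in> borel_measurable borel" for u unfolding g_def[abs_def] by simp
  define is_law where "is_law n L \<longleftrightarrow> real_distribution L \<and>
    (\<forall>u. char L u = exp (t * (\<integral>y. indicator (cut n) y *\<^sub>R g u y \<partial>\<nu>))) \<and>
    (\<forall>\<rho>\<ge>0. integrable L (\<lambda>x. exp (\<rho> * x)) \<and>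
       (\<integral>x. exp (\<rho> * x) \<partial>L) = exp (t * (\<integral>y. indicator (cut n) y * neg_kernel \<rho> y \<partial>\<nu>)))" for n L
  have "\<exists>L. is_law n L" for n
    unfolding is_law_def g_def by (rule neg_approx[OF t, of n]) blast
  then obtain L where "\<And>n. is_law n (L n)" by metis
  then have L: "\<And>n. real_distribution (L n)"
    and ch: "\<And>n u. char (L n) u = exp (t * (\<integral>y. indicator (cut n) y *\<^sub>R g u y \<partial>\<nu>))"
    and li: "\<And>n \<rho>. 0 \<le> \<rho> \<Longrightarrow> integrable (L n) (\<lambda>x. exp (\<rho> * x))"
    and lap: "\<And>n \<rho>. 0 \<le> \<rho> \<Longrightarrow> (\<integral>x. exp (\<rho> * x) \<partial>L n) = exp (t * (\<integral>y. indicator (cut n) y * neg_kernel \<rho> y \<partial>\<nu>))"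
    by (simp_all add: is_law_def)
  interpret L: real_distribution "L n" for n by (rule L)
  have conv_k: "(\<lambda>n. \<integral>y. indicator (cut n) y * neg_kernel \<rho> y \<partial>\<nu>) \<longlonglongrightarrow> neg_exponent \<nu> \<rho>" if "0 \<le> \<rho>" for \<rho>
    unfolding neg_exponent_def
  proof (rule integral_dominated_convergence[where w="\<lambda>y. \<bar>indicator {..<0} y * neg_kernel \<rho> y\<bar>"])
    show "integrable \<nu> (\<lambda>y. \<bar>indicator {..<0} y * neg_kernel \<rho> y\<bar>)"
      by (intro integrable_abs integrable_neg_kernel that) auto
    show "AE y in \<nu>. (\<lambda>n. indicator (cut n) y * neg_kernel \<rho> y) \<longlonglongrightarrow> indicator {..<0} y * neg_kernel \<rho> y"
      using cut_tendsto[of _ "neg_kernel \<rho> _"] by simp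
    show "AE y in \<nu>. norm (indicator (cut n) y * neg_kernel \<rho> y) \<le> \<bar>indicator {..<0} y * neg_kernel \<rho> y\<bar>" for n
      using cut_sub[of n] by (intro AE_I2) (auto split: split_indicator)
  qed auto
  have conv_g: "(\<lambda>n. \<integral>y. indicator (cut n) y *\<^sub>R g u y \<partial>\<nu>) \<longlonglongrightarrow> (\<integral>y. indicator {..<0} y *\<^sub>R g u y \<partial>\<nu>)" for u
  proof (rule integral_dominated_convergence[where w="\<lambda>y. norm (g u y)"])
    show "integrable \<nu> (\<lambda>y. norm (g u y))" using gi by (rule integrable_norm)
    show "AE y in \<nu>. (\<lambda>n. indicator (cut n) y *\<^sub>R g u y) \<longlonglongrightarrow> indicator {..<0} y *\<^sub>R g u y"
      by (intro AE_I2 cut_tendsto)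
    show "AE y in \<nu>. norm (indicator (cut n) y *\<^sub>R g u y) \<le> norm (g u y)" for n
      by (intro AE_I2) (auto split: split_indicator)
  qed auto
  have tight: "tight L"
    unfolding tight_def
  proof (intro conjI allI impI L)
    fix \<epsilon> :: real assume \<epsilon>: "0 < \<epsilon>"
    \<comment> \<open>If the second moment is at most 1 and the first is at least E, then
      \<open>exp_Markov_inequality\<close> gives 4 (1 - 2 E + 1) = 8 (1 - E). The condition 1 \<le>
      m added below ensures 2 \<rho> \<le> 1, the range in which the kernel is nonpositive.\<close>
    have "(\<lambda>m. 8 * (1 - exp (t * neg_exponent \<nu> (1 / real (Suc m))))) \<longlonglongrightarrow> 8 * (1 - exp (t * 0))"
      by (intro tendsto_intros neg_exponent_tendsto_0)
    then have "\<forall>\<^sub>F m in sequentially. 8 * (1 - exp (t * neg_exponent \<nu> (1 / real (Suc m)))) < \<epsilon>"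
      using \<epsilon> by (intro order_tendstoD(2)) auto
    then have "\<forall>\<^sub>F m in sequentially. 8 * (1 - exp (t * neg_exponent \<nu> (1 / real (Suc m)))) < \<epsilon> \<and> 1 \<le> m"
      by (intro eventually_conj eventually_ge_at_top)
    then obtain m where m: "8 * (1 - exp (t * neg_exponent \<nu> (1 / real (Suc m)))) < \<epsilon>" "1 \<le> m"
      by (auto simp: eventually_sequentially)
    define \<rho> where "\<rho> = 1 / real (Suc m)"
    have \<rho>: "0 < \<rho>" "2 * \<rho> \<le> 1" using m(2) by (auto simp: \<rho>_def field_simps)
    have "1 - \<epsilon> < measure (L n) {- 1 / \<rho> <.. 1 / \<rho>}" for n
    proof -
      have "neg_exponent \<nu> \<rho> \<le> (\<integral>y. indicator (cut n) y * neg_kernel \<rho> y \<partial>\<nu>)"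
        unfolding neg_exponent_def
      proof (intro integral_mono integrable_neg_kernel)
        fix y show "indicator {..<0} y * neg_kernel \<rho> y \<le> indicator (cut n) y * neg_kernel \<rho> y"
          using neg_kernel_nonpos[of \<rho> y] \<rho> cut_sub[of n] by (auto split: split_indicator)
      qed (use \<rho> cut_sub[of n] in auto)
      then have l1: "exp (t * neg_exponent \<nu> \<rho>) \<le> (\<integral>x. exp (\<rho> * x) \<partial>L n)"
        using \<rho> t by (simp add: lap mult_left_mono)
      have "(\<integral>y. indicator (cut n) y * neg_kernel (2 * \<rho>) y \<partial>\<nu>) \<le> (\<integral>y. 0 \<partial>\<nu>)"
        by (rule integral_mono[OF integrable_neg_kernel])
           (use \<rho> cut_sub[of n] neg_kernel_nonpos[of "2 * \<rho>"] in \<open>auto split: split_indicator\<close>)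
      then have l2: "(\<integral>x. exp (2 * \<rho> * x) \<partial>L n) \<le> 1"
        using \<rho> t by (simp add: lap mult_nonneg_nonpos)
      have "measure (L n) (- {- 1 / \<rho> <.. 1 / \<rho>}) \<le> measure (L n) {x. 1 \<le> \<bar>\<rho> * x\<bar>}"
        by (rule L.finite_measure_mono) (use \<rho> in \<open>auto simp: field_simps abs_if\<close>)
      also have "\<dots> \<le> 4 * ((\<integral>x. exp (2 * \<rho> * x) \<partial>L n) - 2 * (\<integral>x. exp (\<rho> * x) \<partial>L n) + 1)"
        by (rule exp_Markov_inequality[OF L]) (use li \<rho> in auto)
      also have "\<dots> \<le> 8 * (1 - exp (t * neg_exponent \<nu> \<rho>))" using l1 l2 by argo
      also have "\<dots> < \<epsilon>" using m(1) by (simp add: \<rho>_def)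
      finally have "measure (L n) (- {- 1 / \<rho> <.. 1 / \<rho>}) < \<epsilon>" .
      moreover have "measure (L n) (- {- 1 / \<rho> <.. 1 / \<rho>}) = 1 - measure (L n) {- 1 / \<rho> <.. 1 / \<rho>}"
        using L.prob_compl[of "{- 1 / \<rho> <.. 1 / \<rho>}" n] by (simp add: Compl_eq_Diff_UNIV)
      ultimately show ?thesis by linarith
    qed
    moreover have "- 1 / \<rho> < 1 / \<rho>" using \<rho> by (auto simp: field_simps intro: le_less_trans[of _ 0])
    ultimately show "\<exists>a b. a < b \<and> (\<forall>n. 1 - \<epsilon> < measure (L n) {a<..b})" by blast
  qed
  have chl: "(\<lambda>n. char (L n) u) \<longlonglongrightarrow> exp (t * (\<integral>y. indicator {..<0} y *\<^sub>R g u y \<partial>\<nu>))" for u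
    unfolding ch by (intro tendsto_intros conv_g)
  obtain A where A: "real_distribution A"
    and cA: "\<And>u. char A u = exp (t * (\<integral>y. indicator {..<0} y *\<^sub>R g u y \<partial>\<nu>))"
    and w: "weak_conv_m L A"
    by (rule tight_char_limit[OF L tight chl]) (rule that)
  have lim: "(\<lambda>n. \<integral>x. exp (\<rho> * x) \<partial>L n) \<longlonglongrightarrow> exp (t * neg_exponent \<nu> \<rho>)" if "0 \<le> \<rho>" for \<rho>
    unfolding lap[OF that] by (intro tendsto_intros conv_k that)
  show ?thesis
  proof (rule that[OF A])
    show "integrable A (\<lambda>x. exp (\<rho> * x)) \<and> (\<integral>x. exp (\<rho> * x) \<partial>A) = exp (t * neg_exponent \<nu> \<rho>)" if r: "0 \<le> \<rho>" for \<rho>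
    proof
      show "integrable A (\<lambda>x. exp (\<rho> * x))"
        by (rule laplace_limit_le(1)[OF L A w li[OF r] order_refl lim[OF r]])
      show "(\<integral>x. exp (\<rho> * x) \<partial>A) = exp (t * neg_exponent \<nu> \<rho>)"
        \<comment> \<open>Equality is available because negative jumps have all exponential moments
          of positive order, in particular the one at 2 \<rho>.\<close>
        by (rule laplace_limit[OF L A w li[OF r] li lim[OF r] lim]) (use r in auto)
    qed
  qed (use cA in \<open>simp add: g_def\<close>)
qed

section \<open>The law of the uncompensated positive jumps\<close>

definition kappa :: real where "kappa = (\<integral>y. max 0 (exp y - 1) \<partial>\<nu>)"

lemma kappa_nonneg: "0 \<le> kappa" unfolding kappa_def by (rule integral_nonneg_AE) simp

definition pcut :: "nat \<Rightarrow> real set" where "pcut n = {1 / real (Suc n)..}"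

lemma pcut_borel[measurable]: "pcut n \<in> sets borel" by (simp add: pcut_def)
lemma pcut_sub: "pcut n \<subseteq> {0<..}"
proof
  fix y assume "y \<in> pcut n"
  moreover have "0 < 1 / real (Suc n)" by simp
  ultimately show "y \<in> {0<..}" unfolding pcut_def atLeast_iff greaterThan_iff by linarith
qed
lemma pcut_finite: "emeasure \<nu> (pcut n) < \<infinity>"
proof -
  have "emeasure \<nu> (pcut n) \<le> emeasure \<nu> {y. 1 / real (Suc n) \<le> \<bar>y\<bar>}"
    by (rule emeasure_mono) (auto simp: pcut_def simp del: of_nat_Suc)
  then show ?thesis using finite_away[of "1 / real (Suc n)"] by (auto simp: le_less_trans)
qed

lemma pcut_tendsto: "(\<lambda>n. indicator (pcut n) y *\<^sub>R c) \<longlonglongrightarrow> indicator {0<..} y *\<^sub>R (c::'c::real_normed_vector)"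
proof -
  have "indicator (pcut n) y = (indicator (cut n) (- y) :: real)" for n
    by (auto simp: pcut_def cut_def split: split_indicator simp del: of_nat_Suc)
  moreover have "indicator {0<..} y = (indicator {..<0} (- y) :: real)" by (auto split: split_indicator)
  ultimately show ?thesis using cut_tendsto[of "- y" c] by simp
qed

text \<open>Tightness comes from nonnegativity on the left and from the uniform bound exp (t *
  kappa) on the first exponential moment on the right. With control at order one only, the limit
  inherits an upper bound for this moment.\<close>

lemma pos_law_exists:
  assumes t: "0 \<le> t"
  obtains J where "real_distribution J"
    "\<And>u. char J u = exp (t * (\<integral>y. indicator {0<..} y *\<^sub>R (iexp (u * y) - 1) \<partial>\<nu>))"
    "AE x in J. 0 \<le> x" "integrable J exp" "(\<integral>x. exp x \<partial>J) \<le> exp (t * kappa)"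
proof -
  define is_law where "is_law n L \<longleftrightarrow> real_distribution L \<and>
    (\<forall>u. char L u = exp (t * (\<integral>y. indicator (pcut n) y *\<^sub>R (iexp (u * y) - 1) \<partial>\<nu>))) \<and>
    (AE x in L. 0 \<le> x) \<and> integrable L (\<lambda>x. exp (1 * x)) \<and> (\<integral>x. exp (1 * x) \<partial>L) \<le> exp (t * kappa)" for n L
  have "\<exists>L. is_law n L" for n
  proof -
    obtain L where L: "real_distribution L"
      and ch: "\<And>u. char L u = exp (t * (\<integral>y. indicator (pcut n) y *\<^sub>R (iexp (u * y) - 1) \<partial>\<nu>))"
      and lap: "\<And>\<rho>. integrable \<nu> (\<lambda>y. indicator (pcut n) y * exp (\<rho> * y)) \<Longrightarrow>
         (\<integral>\<^sup>+x. ennreal (exp (\<rho> * x)) \<partial>L) = ennreal (exp (t * (\<integral>y. indicator (pcut n) y * (exp (\<rho> * y) - 1) \<partial>\<nu>)))"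
      and pos: "pcut n \<subseteq> {0..} \<Longrightarrow> (AE x in L. 0 \<le> x)"
      by (rule compound_poisson_restrict_exists[OF sets_nu pcut_borel[of n] pcut_finite[of n] t]) (rule that)
    interpret L: real_distribution L by (rule L)
    have ii: "integrable \<nu> (\<lambda>y. indicator (pcut n) y * max 0 (exp y - 1))"
      using integrable_mult_indicator[OF _ int_pos, of "pcut n"] by simp
    have eq: "indicator (pcut n) y * max 0 (exp y - 1) = indicator (pcut n) y * (exp (1 * y) - 1)" for y :: real
      using pcut_sub[of n] by (auto split: split_indicator)
    have i1: "integrable \<nu> (\<lambda>y. indicator (pcut n) y * exp (1 * y))"
    proof -
      have "integrable \<nu> (\<lambda>y. indicator (pcut n) y * (exp (1 * y) - 1) + indicator (pcut n) y)"
        using ii pcut_finite[of n] unfolding eq by (intro Bochner_Integration.integrable_add integrable_real_indicator) auto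
      then show ?thesis by (simp add: algebra_simps)
    qed
    have k: "(\<integral>y. indicator (pcut n) y * (exp (1 * y) - 1) \<partial>\<nu>) \<le> kappa"
      unfolding kappa_def eq[symmetric] by (intro integral_mono ii int_pos) (auto split: split_indicator)
    have fi: "(\<integral>\<^sup>+x. ennreal (exp (1 * x)) \<partial>L) < \<infinity>" using lap[OF i1] by simp
    have iL: "integrable L (\<lambda>x. exp (1 * x))" by (rule integrableI_nonneg) (use fi in auto)
    have "ennreal (\<integral>x. exp (1 * x) \<partial>L) = (\<integral>\<^sup>+x. ennreal (exp (1 * x)) \<partial>L)"
      by (intro nn_integral_eq_integral[symmetric] iL AE_I2 exp_ge_zero)
    also have "\<dots> = ennreal (exp (t * (\<integral>y. indicator (pcut n) y * (exp (1 * y) - 1) \<partial>\<nu>)))" by (rule lap[OF i1])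
    finally have "(\<integral>x. exp (1 * x) \<partial>L) = exp (t * (\<integral>y. indicator (pcut n) y * (exp (1 * y) - 1) \<partial>\<nu>))"
      by (subst (asm) ennreal_inj) auto
    also have "\<dots> \<le> exp (t * kappa)" using mult_left_mono[OF k t] by (subst exp_le_cancel_iff)
    finally have le: "(\<integral>x. exp (1 * x) \<partial>L) \<le> exp (t * kappa)" .
    have "pcut n \<subseteq> {0..}" using pcut_sub[of n] by auto
    from L ch pos[OF this] iL le have "is_law n L" unfolding is_law_def by blast
    then show ?thesis ..
  qed
  then obtain L where "\<And>n. is_law n (L n)" by metis
  then have L: "\<And>n. real_distribution (L n)"
    and ch: "\<And>n u. char (L n) u = exp (t * (\<integral>y. indicator (pcut n) y *\<^sub>R (iexp (u * y) - 1) \<partial>\<nu>))"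
    and pos: "\<And>n. AE x in L n. 0 \<le> x"
    and li: "\<And>n. integrable (L n) (\<lambda>x. exp (1 * x))"
    and lap: "\<And>n. (\<integral>x. exp (1 * x) \<partial>L n) \<le> exp (t * kappa)"
    by (simp_all add: is_law_def)
  interpret L: real_distribution "L n" for n by (rule L)
  have conv_g: "(\<lambda>n. \<integral>y. indicator (pcut n) y *\<^sub>R (iexp (u * y) - 1) \<partial>\<nu>) \<longlonglongrightarrow> (\<integral>y. indicator {0<..} y *\<^sub>R (iexp (u * y) - 1) \<partial>\<nu>)" for u
  proof (rule integral_dominated_convergence[where w="\<lambda>y. \<bar>u\<bar> * max 0 (exp y - 1)"])
    show "integrable \<nu> (\<lambda>y. \<bar>u\<bar> * max 0 (exp y - 1))" using int_pos by simp
    show "AE y in \<nu>. (\<lambda>n. indicator (pcut n) y *\<^sub>R (iexp (u * y) - 1)) \<longlonglongrightarrow> indicator {0<..} y *\<^sub>R (iexp (u * y) - 1)"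
      by (intro AE_I2 pcut_tendsto)
    show "AE y in \<nu>. norm (indicator (pcut n) y *\<^sub>R (iexp (u * y) - 1)) \<le> \<bar>u\<bar> * max 0 (exp y - 1)" for n
    proof (rule AE_I2)
      fix y :: real
      have "norm (iexp (u * y) - 1) \<le> \<bar>u\<bar> * \<bar>y\<bar>" using iexp_approx1[of "u * y" 0] by (simp add: abs_mult)
      moreover have "\<bar>u\<bar> * \<bar>y\<bar> \<le> \<bar>u\<bar> * max 0 (exp y - 1)" if "0 < y"
      proof (rule mult_left_mono)
        have "y \<le> exp y - 1" using exp_ge_add_one_self[of y] by linarith
        then show "\<bar>y\<bar> \<le> max 0 (exp y - 1)" using that by simp
      qed simp
      ultimately show "norm (indicator (pcut n) y *\<^sub>R (iexp (u * y) - 1)) \<le> \<bar>u\<bar> * max 0 (exp y - 1)"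
        using pcut_sub[of n] by (cases "y \<in> pcut n") (auto simp: subset_iff intro: order_trans)
    qed
  qed auto
  have chl: "(\<lambda>n. char (L n) u) \<longlonglongrightarrow> exp (t * (\<integral>y. indicator {0<..} y *\<^sub>R (iexp (u * y) - 1) \<partial>\<nu>))" for u
    unfolding ch by (intro tendsto_intros conv_g)
  have tight: "tight L"
    unfolding tight_def
  proof (intro conjI allI impI L)
    fix \<epsilon> :: real assume \<epsilon>: "0 < \<epsilon>"
    \<comment> \<open>Chosen so that exp (t * kappa) < \<epsilon> * b \<le> \<epsilon> * exp b,
      which is what Markov's inequality needs. The left end -1 of the interval is arbitrary, the
      laws being carried by [0, \<infinity>).\<close>
    define b where "b = 1 + exp (t * kappa) / \<epsilon>"
    have b: "0 < b" "exp (t * kappa) / \<epsilon> < b" using \<epsilon> by (auto simp: b_def add_pos_pos)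
    have "1 - \<epsilon> < measure (L n) {- 1 <.. b}" for n
    proof -
      have "measure (L n) {x \<in> space (L n). exp b \<le> exp (1 * x)} \<le> (\<integral>x. exp (1 * x) \<partial>L n) / exp b"
        by (rule integral_Markov_inequality_measure[OF li, of "{}"]) auto
      also have "\<dots> \<le> exp (t * kappa) / exp b" using lap by (simp add: divide_right_mono)
      also have "exp (t * kappa) < \<epsilon> * exp b"
      proof -
        have "exp (t * kappa) < \<epsilon> * b" using b(2) \<epsilon> by (simp add: field_simps)
        also have "\<epsilon> * b \<le> \<epsilon> * exp b" using exp_ge_add_one_self[of b] \<epsilon> by (intro mult_left_mono) linarith+
        finally show ?thesis .
      qed
      then have "exp (t * kappa) / exp b < \<epsilon>" by (simp add: field_simps)
      finally have a: "measure (L n) {x \<in> space (L n). exp b \<le> exp (1 * x)} < \<epsilon>" .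
      have "measure (L n) (- {- 1 <.. b}) \<le> measure (L n) {x \<in> space (L n). exp b \<le> exp (1 * x)}"
      proof (rule L.finite_measure_mono_AE)
        show "AE x in L n. x \<in> - {- 1 <.. b} \<longrightarrow> x \<in> {x \<in> space (L n). exp b \<le> exp (1 * x)}"
          using pos[of n] by eventually_elim auto
      qed auto
      with a show ?thesis using L.prob_compl[of "{- 1 <.. b}" n] by (simp add: Compl_eq_Diff_UNIV)
    qed
    then show "\<exists>a b. a < b \<and> (\<forall>n. 1 - \<epsilon> < measure (L n) {a<..b})" using b(1) by (intro exI[of _ "-1"] exI[of _ b]) auto
  qed
  obtain A where A: "real_distribution A"
    and cA: "\<And>u. char A u = exp (t * (\<integral>y. indicator {0<..} y *\<^sub>R (iexp (u * y) - 1) \<partial>\<nu>))"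
    and w: "weak_conv_m L A"
    by (rule tight_char_limit[OF L tight chl]) (rule that)
  interpret A: real_distribution A by (rule A)
  \<comment> \<open>A bounded continuous function that vanishes exactly on the nonnegative half-line
    carries nonnegativity over to the weak limit.\<close>
  let ?f = "\<lambda>x::real. min 1 (max 0 (- x))"
  have "(\<lambda>n. (\<integral>x. ?f x \<partial>L n)) \<longlonglongrightarrow> (\<integral>x. ?f x \<partial>A)"
    by (rule weak_conv_imp_integral_bdd_continuous_conv[OF L A w, of _ 1]) (auto intro!: continuous_intros)
  moreover have "(\<integral>x. ?f x \<partial>L n) = 0" for n
    by (rule integral_eq_zero_AE, use pos[of n] in eventually_elim) auto
  ultimately have "(\<integral>x. ?f x \<partial>A) = 0" by (simp add: LIMSEQ_const_iff)
  moreover have "integrable A ?f" by (rule A.integrable_const_bound[where B=1]) auto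
  ultimately have "AE x in A. ?f x = 0" by (subst (asm) integral_nonneg_eq_0_iff_AE) auto
  then have posA: "AE x in A. 0 \<le> x" by eventually_elim (auto simp: min_def max_def split: if_splits)
  note lim = laplace_limit_le[OF L A w li lap tendsto_const]
  show ?thesis by (rule that[OF A cA posA]) (use lim in auto)
qed

end

section \<open>Assembling the law of the process at each time\<close>

context exp_levy_measure
begin

text \<open>All three families are characterized by exponents linear in t, so the semigroup
  identities follow from uniqueness of characteristic functions. The statement concerns laws alone:
  no process with law A_t or J_t is constructed.\<close>

lemma law_decomposition:
  obtains A J \<mu> :: "real \<Rightarrow> real measure" where
    "\<And>t. 0 \<le> t \<Longrightarrow> real_distribution (A t)"
    "\<And>t. 0 \<le> t \<Longrightarrow> real_distribution (J t)"
    "\<And>t. 0 \<le> t \<Longrightarrow> real_distribution (\<mu> t)"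
    "\<And>t. 0 \<le> t \<Longrightarrow> \<mu> t = distr (A t \<Otimes>\<^sub>M J t) borel (\<lambda>(x, w). x + w - kappa * t)"
    "\<And>s t. 0 \<le> s \<Longrightarrow> 0 \<le> t \<Longrightarrow> A (s + t) = (A s \<star> A t)"
    "\<And>s t. 0 \<le> s \<Longrightarrow> 0 \<le> t \<Longrightarrow> \<mu> (s + t) = (\<mu> s \<star> \<mu> t)"
    "\<And>t \<rho>. 0 \<le> t \<Longrightarrow> 0 \<le> \<rho> \<Longrightarrow> integrable (A t) (\<lambda>x. exp (\<rho> * x)) \<and> (\<integral>x. exp (\<rho> * x) \<partial>A t) = exp (t * neg_exponent \<nu> \<rho>)"
    "\<And>t. 0 \<le> t \<Longrightarrow> AE x in J t. 0 \<le> x"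
    "\<And>t. 0 \<le> t \<Longrightarrow> integrable (J t) exp"
    "\<And>t. 0 \<le> t \<Longrightarrow> (\<integral>x. exp x \<partial>J t) \<le> exp (t * kappa)"
    "\<And>t u. 0 \<le> t \<Longrightarrow> char (\<mu> t) u = exp (t * (\<integral>y. cis (u * y) - 1 - \<i> * complex_of_real u * complex_of_real (exp y - 1) \<partial>\<nu>))"
proof -
  define g where "g u y = iexp (u * y) - 1 - \<i> * complex_of_real u * complex_of_real (exp y - 1)" for u y :: real
  have gi: "integrable \<nu> (g u)" for u using int_char[of u] unfolding g_def[abs_def] cis_conv_exp by simp
  have gm[measurable]: "g u \<in> borel_measurable borel" for u unfolding g_def[abs_def] by simp
  define \<Psi> where "\<Psi> u = (\<integral>y. g u y \<partial>\<nu>)" for u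
  define \<Psi>n where "\<Psi>n u = (\<integral>y. indicator {..<0} y *\<^sub>R g u y \<partial>\<nu>)" for u
  define \<Psi>p where "\<Psi>p u = (\<integral>y. indicator {0<..} y *\<^sub>R (iexp (u * y) - 1) \<partial>\<nu>)" for u
  \<comment> \<open>The compensator of the positive jumps is integrable by itself, so it separates
    as the drift -kappa. The two half-lines miss the point 0, where the integrand is zero.\<close>
  have split: "\<Psi> u = \<Psi>n u + \<Psi>p u - \<i> * u * kappa" for u
  proof -
    have i1: "integrable \<nu> (\<lambda>y. indicator {..<0} y *\<^sub>R g u y)" "integrable \<nu> (\<lambda>y. indicator {0<..} y *\<^sub>R g u y)"
      by (intro integrable_mult_indicator gi; simp add: sets_nu)+
    have i2: "integrable \<nu> (\<lambda>y. complex_of_real (max 0 (exp y - 1)))"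
      using int_pos by (rule integrable_of_real)
    have e: "indicator {0<..} y *\<^sub>R (iexp (u * y) - 1) = indicator {0<..} y *\<^sub>R g u y + \<i> * u * complex_of_real (max 0 (exp y - 1))" for y
      by (cases "0 < y") (auto simp: g_def max_def)
    have "\<Psi>p u = (\<integral>y. indicator {0<..} y *\<^sub>R g u y \<partial>\<nu>) + \<i> * u * kappa"
      unfolding \<Psi>p_def e kappa_def integral_complex_of_real[symmetric] using i1 i2 by simp
    moreover have "g u y = indicator {..<0} y *\<^sub>R g u y + indicator {0<..} y *\<^sub>R g u y" for y
      by (cases "y = 0") (auto simp: g_def indicator_def)
    then have "\<Psi> u = \<Psi>n u + (\<integral>y. indicator {0<..} y *\<^sub>R g u y \<partial>\<nu>)"
      unfolding \<Psi>_def \<Psi>n_def by (subst Bochner_Integration.integral_add[symmetric]) (use i1 in auto)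
    ultimately show ?thesis by simp
  qed
  have "\<exists>A. real_distribution A \<and> (\<forall>u. char A u = exp (t * \<Psi>n u)) \<and>
     (\<forall>\<rho>\<ge>0. integrable A (\<lambda>x. exp (\<rho> * x)) \<and> (\<integral>x. exp (\<rho> * x) \<partial>A) = exp (t * neg_exponent \<nu> \<rho>))"
    if "0 \<le> t" for t :: real
    unfolding \<Psi>n_def g_def by (rule neg_law_exists[OF that]) blast
  then obtain A :: "real \<Rightarrow> real measure" where A: "\<And>t. 0 \<le> t \<Longrightarrow> real_distribution (A t)" and cA: "\<And>t u. 0 \<le> t \<Longrightarrow> char (A t) u = exp (t * \<Psi>n u)"
    and lA: "\<And>t \<rho>. 0 \<le> t \<Longrightarrow> 0 \<le> \<rho> \<Longrightarrow> integrable (A t) (\<lambda>x. exp (\<rho> * x)) \<and> (\<integral>x. exp (\<rho> * x) \<partial>A t) = exp (t * neg_exponent \<nu> \<rho>)"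
    by metis
  have "\<exists>J. real_distribution J \<and> (\<forall>u. char J u = exp (t * \<Psi>p u)) \<and> (AE x in J. 0 \<le> x) \<and> integrable J exp \<and>
      (\<integral>x. exp x \<partial>J) \<le> exp (t * kappa)"
    if "0 \<le> t" for t :: real
    unfolding \<Psi>p_def by (rule pos_law_exists[OF that]) blast
  then obtain J :: "real \<Rightarrow> real measure" where J: "\<And>t. 0 \<le> t \<Longrightarrow> real_distribution (J t)" and cJ: "\<And>t u. 0 \<le> t \<Longrightarrow> char (J t) u = exp (t * \<Psi>p u)"
    and pJ: "\<And>t. 0 \<le> t \<Longrightarrow> AE x in J t. 0 \<le> x"
    and iJ: "\<And>t. 0 \<le> t \<Longrightarrow> integrable (J t) exp"
    and lJ: "\<And>t. 0 \<le> t \<Longrightarrow> (\<integral>x. exp x \<partial>J t) \<le> exp (t * kappa)"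
    by metis
  define \<mu> where "\<mu> t = distr (A t \<Otimes>\<^sub>M J t) borel (\<lambda>(x, w). x + w - kappa * t)" for t
  have \<mu>: "real_distribution (\<mu> t)" if t: "0 \<le> t" for t
  proof -
    interpret A: real_distribution "A t" by (rule A[OF t])
    interpret J: real_distribution "J t" by (rule J[OF t])
    interpret P: pair_prob_space "A t" "J t" ..
    show ?thesis unfolding \<mu>_def by (rule P.real_distribution_distr) simp
  qed
  have c\<mu>: "char (\<mu> t) u = exp (t * \<Psi> u)" if t: "0 \<le> t" for t u
  proof -
    interpret A: real_distribution "A t" by (rule A[OF t])
    interpret J: real_distribution "J t" by (rule J[OF t])
    have "char (\<mu> t) u = (CLINT z|(A t \<Otimes>\<^sub>M J t). iexp (u * (fst z + snd z - kappa * t)))"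
      unfolding char_def \<mu>_def by (subst integral_distr) (auto simp: case_prod_beta)
    also have "\<dots> = (CLINT z|(A t \<Otimes>\<^sub>M J t). iexp (u * (fst z + snd z)) * iexp (- u * kappa * t))"
      by (intro Bochner_Integration.integral_cong refl) (simp add: exp_add[symmetric] algebra_simps)
    also have "\<dots> = (CLINT z|(A t \<Otimes>\<^sub>M J t). iexp (u * (fst z + snd z))) * iexp (- u * kappa * t)"
      by (rule integral_mult_left_zero)
    also have "(CLINT z|(A t \<Otimes>\<^sub>M J t). iexp (u * (fst z + snd z))) = char (A t \<star> J t) u"
      unfolding char_def convolution_def by (subst integral_distr) (auto simp: case_prod_beta)
    also have "\<dots> = exp (t * \<Psi>n u) * exp (t * \<Psi>p u)" by (simp add: char_convolution[OF A[OF t] J[OF t]] cA cJ t)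
    also have "\<dots> * iexp (- u * kappa * t) = exp (t * \<Psi> u)"
      unfolding split exp_add[symmetric] by (simp add: algebra_simps)
    finally show ?thesis .
  qed
  have cint: "(\<integral>y. cis (u * y) - 1 - \<i> * complex_of_real u * complex_of_real (exp y - 1) \<partial>\<nu>) = \<Psi> u" for u
    unfolding \<Psi>_def g_def cis_conv_exp ..
  show ?thesis
  proof (rule that[OF A J \<mu> _ _ _ lA pJ iJ lJ])
    show "\<mu> t = distr (A t \<Otimes>\<^sub>M J t) borel (\<lambda>(x, w). x + w - kappa * t)" for t by (rule \<mu>_def)
    show "A (s + t) = (A s \<star> A t)" if "0 \<le> s" "0 \<le> t" for s t
    proof (rule Levy_uniqueness)
      show "char (A (s + t)) = char (A s \<star> A t)"
        using that by (auto simp: fun_eq_iff char_convolution A cA exp_add[symmetric] algebra_simps)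
    qed (use that in \<open>auto intro: A prob_space_convolution\<close>)
    show "\<mu> (s + t) = (\<mu> s \<star> \<mu> t)" if "0 \<le> s" "0 \<le> t" for s t
    proof (rule Levy_uniqueness)
      show "char (\<mu> (s + t)) = char (\<mu> s \<star> \<mu> t)"
        using that by (auto simp: fun_eq_iff char_convolution \<mu> c\<mu> exp_add[symmetric] algebra_simps)
    qed (use that in \<open>auto intro: \<mu> prob_space_convolution\<close>)
    show "char (\<mu> t) u = exp (t * (\<integral>y. cis (u * y) - 1 - \<i> * complex_of_real u * complex_of_real (exp y - 1) \<partial>\<nu>))"
      if "0 \<le> t" for t u
      unfolding c\<mu>[OF that] cint ..
  qed
qed

end

section \<open>Asymptotics of the Laplace exponent\<close>

text \<open>Write exp (- z) - 1 + z as the integral of (z - w) exp (- w) over w in [0, z] and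
  exchange the integrals. The inner one in z is w^(1-\<alpha>) / (\<alpha> (\<alpha> - 1)), and
  integrating it against exp (- w) produces Gamma (2 - \<alpha>).\<close>

lemma nn_integral_stable_kernel:
  fixes \<alpha> :: real
  assumes \<alpha>: "1 < \<alpha>" "\<alpha> < 2"
  shows "(\<integral>\<^sup>+z. ennreal (indicator {0<..} z * ((exp (- z) - 1 + z) * z powr (- 1 - \<alpha>))) \<partial>lborel) = ennreal (Gamma (2 - \<alpha>) / (\<alpha> * (\<alpha> - 1)))"
proof -
  have q: "ennreal (exp (- z) - 1 + z) = (\<integral>\<^sup>+w. ennreal ((z - w) * exp (- w)) * indicator {0..z} w \<partial>lborel)" if "0 < z" for z :: real
  proof -
    have "(\<integral>\<^sup>+w. ennreal ((z - w) * exp (- w)) * indicator {0..z} w \<partial>lborel) = ennreal ((z - z + 1) * exp (- z) * 1 - 0 - (1 - z) * 1)"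
      using that
      by (subst nn_integral_FTC_Icc[where F="\<lambda>w. (w - z + 1) * exp (- w)"])
         (auto intro!: derivative_eq_intros simp: algebra_simps has_real_derivative_iff_has_vector_derivative[symmetric])
    then show ?thesis by (simp add: algebra_simps)
  qed
  have inner: "(\<integral>\<^sup>+z. ennreal ((z - w) * z powr (- 1 - \<alpha>)) * indicator {w..} z \<partial>lborel) = ennreal (w powr (1 - \<alpha>) / (\<alpha> * (\<alpha> - 1)))"
    if w: "0 < w" for w :: real
  proof -
    let ?F = "\<lambda>z::real. - (z powr (1 - \<alpha>) / (\<alpha> - 1)) + w * (z powr (- \<alpha>) / \<alpha>)"
    have "(\<integral>\<^sup>+z. ennreal ((z - w) * z powr (- 1 - \<alpha>)) * indicator {w..} z \<partial>lborel) = ennreal ((- (0 / (\<alpha> - 1)) + w * (0 / \<alpha>)) - ?F w)"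
    proof (rule nn_integral_FTC_atLeast[where F="?F"])
      fix z assume z: "w \<le> z"
      then have z0: "0 < z" using w by linarith
      have "- \<alpha> - 1 = - 1 - \<alpha>" by simp
      then have p2: "z powr (- \<alpha> - 1) = z powr (- 1 - \<alpha>)" by (rule arg_cong)
      have p1: "z powr (1 - \<alpha> - 1) = z * z powr (- 1 - \<alpha>)"
        using z0 powr_add[of z 1 "- 1 - \<alpha>"] by simp
      note p = p1 p2
      have "DERIV ?F z :> - ((1 - \<alpha>) * z powr (1 - \<alpha> - 1) / (\<alpha> - 1)) + w * (- \<alpha> * z powr (- \<alpha> - 1) / \<alpha>)"
        by (intro DERIV_add DERIV_minus DERIV_cdivide DERIV_cmult has_real_derivative_powr z0)
      also have "- ((1 - \<alpha>) * z powr (1 - \<alpha> - 1) / (\<alpha> - 1)) + w * (- \<alpha> * z powr (- \<alpha> - 1) / \<alpha>)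
          = (z - w) * z powr (- 1 - \<alpha>)"
        unfolding p using \<alpha> by (simp add: divide_simps) (simp add: algebra_simps)
      finally show "DERIV ?F z :> (z - w) * z powr (- 1 - \<alpha>)" .
      show "0 \<le> (z - w) * z powr (- 1 - \<alpha>)" using z by simp
    next
      show "(?F \<longlongrightarrow> (- (0 / (\<alpha> - 1)) + w * (0 / \<alpha>))) at_top"
        using \<alpha> by (intro tendsto_intros tendsto_neg_powr filterlim_ident) auto
    qed simp
    also have "w powr (1 - \<alpha>) = w * w powr (- \<alpha>)" using w powr_add[of w 1 "- \<alpha>"] by simp
    then have "(- (0 / (\<alpha> - 1)) + w * (0 / \<alpha>)) - ?F w = w powr (1 - \<alpha>) / (\<alpha> * (\<alpha> - 1))"
      using \<alpha> by (simp add: field_simps)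
    finally show ?thesis .
  qed
  have "(\<integral>\<^sup>+z. ennreal (indicator {0<..} z * ((exp (- z) - 1 + z) * z powr (- 1 - \<alpha>))) \<partial>lborel)
    = (\<integral>\<^sup>+z. (\<integral>\<^sup>+w. ennreal (indicator {0<..} w * exp (- w)) * (ennreal ((z - w) * z powr (- 1 - \<alpha>)) * indicator {w..} z) \<partial>lborel) \<partial>lborel)"
  proof (rule nn_integral_cong)
    fix z :: real
    show "ennreal (indicator {0<..} z * ((exp (- z) - 1 + z) * z powr (- 1 - \<alpha>)))
      = (\<integral>\<^sup>+w. ennreal (indicator {0<..} w * exp (- w)) * (ennreal ((z - w) * z powr (- 1 - \<alpha>)) * indicator {w..} z) \<partial>lborel)"
    proof (cases "0 < z")
      case False
      then have "(\<integral>\<^sup>+w. ennreal (indicator {0<..} w * exp (- w)) * (ennreal ((z - w) * z powr (- 1 - \<alpha>)) * indicator {w..} z) \<partial>lborel) = (\<integral>\<^sup>+w. 0 \<partial>(lborel :: real measure))"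
        by (intro nn_integral_cong) (auto split: split_indicator)
      with False show ?thesis by simp
    next
      case z: True
      have "ennreal (exp (- z) - 1 + z) * ennreal (z powr (- 1 - \<alpha>)) = (\<integral>\<^sup>+w. ennreal ((z - w) * exp (- w)) * indicator {0..z} w * ennreal (z powr (- 1 - \<alpha>)) \<partial>lborel)"
        unfolding q[OF z] by (rule nn_integral_multc[symmetric]) simp
      also have "\<dots> = (\<integral>\<^sup>+w. ennreal (indicator {0<..} w * exp (- w)) * (ennreal ((z - w) * z powr (- 1 - \<alpha>)) * indicator {w..} z) \<partial>lborel)"
      proof (rule nn_integral_cong_AE, use AE_lborel_singleton[of 0] in eventually_elim)
        fix w :: real assume "w \<noteq> 0"
        then show "ennreal ((z - w) * exp (- w)) * indicator {0..z} w * ennreal (z powr (- 1 - \<alpha>))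
           = ennreal (indicator {0<..} w * exp (- w)) * (ennreal ((z - w) * z powr (- 1 - \<alpha>)) * indicator {w..} z)"
          by (auto split: split_indicator simp: ennreal_mult' [symmetric] ennreal_mult''[symmetric] mult_ac)
      qed
      finally show ?thesis using z by (simp add: ennreal_mult'')
    qed
  qed
  also have "\<dots> = (\<integral>\<^sup>+w. (\<integral>\<^sup>+z. ennreal (indicator {0<..} w * exp (- w)) * (ennreal ((z - w) * z powr (- 1 - \<alpha>)) * indicator {w..} z) \<partial>lborel) \<partial>lborel)"
  proof -
    have m: "(\<lambda>(z, w). ennreal (indicator {0<..} w * exp (- w)) * (ennreal ((z - w) * z powr (- 1 - \<alpha>)) * indicator {w..} (z::real))) \<in> borel_measurable (lborel \<Otimes>\<^sub>M lborel)"
    proof -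
      have "indicator {w..} z = (if w \<le> z then 1 else 0 :: ennreal)" for w z :: real by (auto split: split_indicator)
      then show ?thesis by simp
    qed
    show ?thesis using lborel_pair.Fubini[OF m] by simp
  qed
  also have "\<dots> = (\<integral>\<^sup>+w. ennreal (indicator {0..} w * w powr ((2 - \<alpha>) - 1) / exp w) * ennreal (1 / (\<alpha> * (\<alpha> - 1))) \<partial>lborel)"
  proof (rule nn_integral_cong_AE, use AE_lborel_singleton[of 0] in eventually_elim)
    fix w :: real assume w: "w \<noteq> 0"
    show "(\<integral>\<^sup>+z. ennreal (indicator {0<..} w * exp (- w)) * (ennreal ((z - w) * z powr (- 1 - \<alpha>)) * indicator {w..} z) \<partial>lborel)
       = ennreal (indicator {0..} w * w powr ((2 - \<alpha>) - 1) / exp w) * ennreal (1 / (\<alpha> * (\<alpha> - 1)))"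
    proof (cases "0 < w")
      case True
      then show ?thesis using \<alpha>
        by (subst nn_integral_cmult, simp, subst inner[OF True])
           (simp add: ennreal_mult'[symmetric] ennreal_mult''[symmetric] exp_minus, simp add: divide_simps)
    next
      case False
      then show ?thesis using w by simp
    qed
  qed
  also have "\<dots> = ennreal (Gamma (2 - \<alpha>)) * ennreal (1 / (\<alpha> * (\<alpha> - 1)))"
    using \<alpha> by (subst nn_integral_multc) (auto simp: Gamma_conv_nn_integral_real)
  also have "\<dots> = ennreal (Gamma (2 - \<alpha>) / (\<alpha> * (\<alpha> - 1)))"
    using \<alpha> by (simp add: ennreal_mult'[symmetric] ennreal_mult''[symmetric])
  finally show ?thesis .
qed

locale stable_like_levy_measure = exp_levy_measure +
  fixes \<alpha> a\<^sub>0 \<eta>\<^sub>0 :: real and \<eta> :: "real \<Rightarrow> real"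
  assumes a0: "a\<^sub>0 < 0"
    and \<alpha>: "1 < \<alpha>" "\<alpha> < 2"
    and \<eta>_meas[measurable]: "\<eta> \<in> borel_measurable borel"
    and \<eta>_pos: "\<forall>y\<in>{a\<^sub>0..<0}. \<eta> y > 0"
    and \<eta>_bdd: "\<exists>C. \<forall>y\<in>{a\<^sub>0..<0}. \<eta> y \<le> C"
    and \<eta>_lim: "(\<eta> \<longlongrightarrow> \<eta>\<^sub>0) (at_left 0)" and \<eta>0: "\<eta>\<^sub>0 > 0"
    and dens: "\<forall>A\<in>sets borel. emeasure \<nu> (A \<inter> {a\<^sub>0<..<0}) =
                 (\<integral>\<^sup>+ y. ennreal (\<eta> y / \<bar>y\<bar> powr (1 + \<alpha>)) * indicator (A \<inter> {a\<^sub>0<..<0}) y \<partial>lborel)"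
begin

definition stable_const :: real where "stable_const = \<eta>\<^sub>0 * Gamma (2 - \<alpha>) / (\<alpha> * (\<alpha> - 1))"

text \<open>Turns the setwise hypothesis \<open>dens\<close> into an equality of measures, through
  which integrals of functions transfer.\<close>

lemma density_eq:
  "density \<nu> (indicator {a\<^sub>0<..<0}) = density lborel (\<lambda>y. ennreal (indicator {a\<^sub>0<..<0} y * (\<eta> y / \<bar>y\<bar> powr (1 + \<alpha>))))"
proof (rule measure_eqI)
  show "sets (density \<nu> (indicator {a\<^sub>0<..<0})) = sets (density lborel (\<lambda>y. ennreal (indicator {a\<^sub>0<..<0} y * (\<eta> y / \<bar>y\<bar> powr (1 + \<alpha>)))))"
    by (simp add: sets_nu)
  fix A assume "A \<in> sets (density \<nu> (indicator {a\<^sub>0<..<0}))"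
  then have A[measurable]: "A \<in> sets borel" by (simp add: sets_nu)
  have "emeasure (density \<nu> (indicator {a\<^sub>0<..<0})) A = (\<integral>\<^sup>+y. indicator (A \<inter> {a\<^sub>0<..<0}) y \<partial>\<nu>)"
    by (subst emeasure_density) (auto intro!: nn_integral_cong split: split_indicator simp del: nn_integral_indicator)
  also have "\<dots> = emeasure \<nu> (A \<inter> {a\<^sub>0<..<0})" by (rule nn_integral_indicator) simp
  also have "\<dots> = emeasure (density lborel (\<lambda>y. ennreal (indicator {a\<^sub>0<..<0} y * (\<eta> y / \<bar>y\<bar> powr (1 + \<alpha>))))) A"
    using dens A by (subst emeasure_density) (auto intro!: nn_integral_cong split: split_indicator)
  finally show "emeasure (density \<nu> (indicator {a\<^sub>0<..<0})) A = emeasure (density lborel (\<lambda>y. ennreal (indicator {a\<^sub>0<..<0} y * (\<eta> y / \<bar>y\<bar> powr (1 + \<alpha>))))) A" .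
qed

lemma integral_near_0:
  fixes f :: "real \<Rightarrow> real"
  assumes [measurable]: "f \<in> borel_measurable borel"
  shows "(\<integral>y. indicator {a\<^sub>0<..<0} y * f y \<partial>\<nu>) = (\<integral>y. indicator {a\<^sub>0<..<0} y * (\<eta> y / \<bar>y\<bar> powr (1 + \<alpha>)) * f y \<partial>lborel)"
proof -
  have "(\<integral>y. indicator {a\<^sub>0<..<0} y * f y \<partial>\<nu>) = (\<integral>y. f y \<partial>density \<nu> (\<lambda>y. ennreal (indicator {a\<^sub>0<..<0} y)))"
    by (subst integral_density) auto
  also have "density \<nu> (\<lambda>y. ennreal (indicator {a\<^sub>0<..<0} y)) = density \<nu> (indicator {a\<^sub>0<..<0})"
    by (intro density_cong) (auto split: split_indicator)
  also have "(\<integral>y. f y \<partial>\<dots>) = (\<integral>y. indicator {a\<^sub>0<..<0} y * (\<eta> y / \<bar>y\<bar> powr (1 + \<alpha>)) * f y \<partial>lborel)"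
    unfolding density_eq using \<eta>_pos
    by (subst integral_density) (auto split: split_indicator intro!: AE_I2 divide_nonneg_nonneg simp: less_imp_le)
  finally show ?thesis .
qed

lemma stable_kernel_integral:
  shows "integrable lborel (\<lambda>z. indicator {0<..} z * ((exp (- z) - 1 + z) * z powr (- 1 - \<alpha>)))"
    and "(\<integral>z. indicator {0<..} z * ((exp (- z) - 1 + z) * z powr (- 1 - \<alpha>)) \<partial>lborel) = Gamma (2 - \<alpha>) / (\<alpha> * (\<alpha> - 1))"
proof -
  have nn: "0 \<le> indicator {0<..} z * ((exp (- z) - 1 + z) * z powr (- 1 - \<alpha>))" for z :: real
    using exp_ge_add_one_self[of "- z"] by (auto intro!: mult_nonneg_nonneg split: split_indicator)
  show 1: "integrable lborel (\<lambda>z. indicator {0<..} z * ((exp (- z) - 1 + z) * z powr (- 1 - \<alpha>)))"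
    by (rule integrableI_nonneg) (use nn nn_integral_stable_kernel[OF \<alpha>] in auto)
  have "ennreal (\<integral>z. indicator {0<..} z * ((exp (- z) - 1 + z) * z powr (- 1 - \<alpha>)) \<partial>lborel) = ennreal (Gamma (2 - \<alpha>) / (\<alpha> * (\<alpha> - 1)))"
    unfolding nn_integral_stable_kernel[OF \<alpha>, symmetric] by (intro nn_integral_eq_integral[symmetric] 1 AE_I2 nn)
  then show "(\<integral>z. indicator {0<..} z * ((exp (- z) - 1 + z) * z powr (- 1 - \<alpha>)) \<partial>lborel) = Gamma (2 - \<alpha>) / (\<alpha> * (\<alpha> - 1))"
    using \<alpha> by (subst (asm) ennreal_inj) (auto intro!: integral_nonneg_AE AE_I2 nn divide_nonneg_nonneg mult_nonneg_nonneg Gamma_real_nonneg)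
qed

text \<open>The substitution y = - z / \<rho> removes \<rho> from the exponential; the Jacobian and
  the density together leave the power \<rho>^\<alpha>.\<close>

lemma scaled_integral:
  assumes \<rho>: "0 < \<rho>"
  shows "(\<integral>y. indicator {a\<^sub>0<..<0} y * (\<eta> y / \<bar>y\<bar> powr (1 + \<alpha>)) * (exp (\<rho> * y) - 1 - \<rho> * y) \<partial>lborel)
    = \<rho> powr \<alpha> * (\<integral>z. indicator {0<..<- a\<^sub>0 * \<rho>} z * \<eta> (- z / \<rho>) * ((exp (- z) - 1 + z) * z powr (- 1 - \<alpha>)) \<partial>lborel)"
proof -
  let ?f = "\<lambda>y. indicator {a\<^sub>0<..<0} y * (\<eta> y / \<bar>y\<bar> powr (1 + \<alpha>)) * (exp (\<rho> * y) - 1 - \<rho> * y)"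
  have "(\<integral>y. ?f y \<partial>lborel) = \<bar>- 1 / \<rho>\<bar> *\<^sub>R (\<integral>z. ?f (0 + (- 1 / \<rho>) * z) \<partial>lborel)"
    by (rule lborel_integral_real_affine) (use \<rho> in simp)
  also have "\<dots> = (1 / \<rho>) * (\<integral>z. \<rho> powr (1 + \<alpha>) * (indicator {0<..<- a\<^sub>0 * \<rho>} z * \<eta> (- z / \<rho>) * ((exp (- z) - 1 + z) * z powr (- 1 - \<alpha>))) \<partial>lborel)"
  proof -
    have "?f (0 + (- 1 / \<rho>) * z) = \<rho> powr (1 + \<alpha>) * (indicator {0<..<- a\<^sub>0 * \<rho>} z * \<eta> (- z / \<rho>) * ((exp (- z) - 1 + z) * z powr (- 1 - \<alpha>)))" for z
    proof (cases "z \<in> {0<..<- a\<^sub>0 * \<rho>}")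
      case True
      then have z: "0 < z" and i: "- 1 / \<rho> * z \<in> {a\<^sub>0<..<0}" using \<rho> by (auto simp: field_simps)
      have e: "- 1 - \<alpha> = - (1 + \<alpha>)" by simp
      have d: "\<bar>0 + - 1 / \<rho> * z\<bar> powr (1 + \<alpha>) = z powr (1 + \<alpha>) / \<rho> powr (1 + \<alpha>)"
        using z \<rho> by (simp add: abs_mult powr_divide)
      show ?thesis using True i z \<rho> unfolding d e powr_minus by (simp add: field_simps)
    next
      case False
      then have "- 1 / \<rho> * z \<notin> {a\<^sub>0<..<0}" using \<rho> by (auto simp: field_simps)
      with False show ?thesis by simp
    qed
    then show ?thesis using \<rho> by simp
  qed
  also have "\<dots> = (1 / \<rho> * \<rho> powr (1 + \<alpha>)) * (\<integral>z. indicator {0<..<- a\<^sub>0 * \<rho>} z * \<eta> (- z / \<rho>) * ((exp (- z) - 1 + z) * z powr (- 1 - \<alpha>)) \<partial>lborel)"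
    by (subst integral_mult_right_zero) (simp only: mult.assoc)
  also have "1 / \<rho> * \<rho> powr (1 + \<alpha>) = \<rho> powr \<alpha>" using \<rho> by (simp add: powr_add)
  finally show ?thesis .
qed

text \<open>For fixed z the argument - z / \<rho> tends to 0 from the left, so \<eta> tends to its
  limit there; boundedness of \<eta> gives the dominating function.\<close>

lemma scaled_integral_tendsto:
  "((\<lambda>\<rho>. (\<integral>z. indicator {0<..<- a\<^sub>0 * \<rho>} z * \<eta> (- z / \<rho>) * ((exp (- z) - 1 + z) * z powr (- 1 - \<alpha>)) \<partial>lborel)) \<longlongrightarrow> stable_const) at_top"
proof -
  obtain C where C: "\<And>y. y \<in> {a\<^sub>0..<0} \<Longrightarrow> \<eta> y \<le> C" using \<eta>_bdd by blast
  have C0: "0 \<le> C" using C[of a\<^sub>0] \<eta>_pos[rule_format, of a\<^sub>0] a0 by simp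
  let ?q = "\<lambda>z. (exp (- z) - 1 + z) * z powr (- 1 - \<alpha>)"
  have q0: "0 \<le> ?q z" for z using exp_ge_add_one_self[of "- z"] by (intro mult_nonneg_nonneg) auto
  have "((\<lambda>\<rho>. (\<integral>z. indicator {0<..<- a\<^sub>0 * \<rho>} z * \<eta> (- z / \<rho>) * ?q z \<partial>lborel)) \<longlongrightarrow> (\<integral>z. \<eta>\<^sub>0 * (indicator {0<..} z * ?q z) \<partial>lborel)) at_top"
  proof (rule integral_dominated_convergence_at_top[where w="\<lambda>z. C * (indicator {0<..} z * ?q z)"])
    show "integrable lborel (\<lambda>z. C * (indicator {0<..} z * ?q z))" using stable_kernel_integral(1) by simp
    show "AE z in lborel. ((\<lambda>\<rho>. indicator {0<..<- a\<^sub>0 * \<rho>} z * \<eta> (- z / \<rho>) * ?q z) \<longlongrightarrow> \<eta>\<^sub>0 * (indicator {0<..} z * ?q z)) at_top"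
    proof (rule AE_I2)
      fix z :: real
      show "((\<lambda>\<rho>. indicator {0<..<- a\<^sub>0 * \<rho>} z * \<eta> (- z / \<rho>) * ?q z) \<longlongrightarrow> \<eta>\<^sub>0 * (indicator {0<..} z * ?q z)) at_top"
      proof (cases "0 < z")
        case z: True
        have t0: "((\<lambda>\<rho>. - z / \<rho>) \<longlongrightarrow> 0) at_top"
          by (rule real_tendsto_divide_at_top[OF tendsto_const filterlim_ident])
        have "\<forall>\<^sub>F \<rho> in at_top. - z / \<rho> \<in> {..<0} \<and> - z / \<rho> \<noteq> 0"
          by (rule eventually_mono[OF eventually_gt_at_top[of 0]]) (use z in \<open>simp add: divide_neg_pos\<close>)
        then have "filterlim (\<lambda>\<rho>. - z / \<rho>) (at_left 0) at_top"
          unfolding filterlim_at using t0 by (rule conjI)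
        from filterlim_compose[OF \<eta>_lim this]
        have "((\<lambda>\<rho>. 1 * \<eta> (- z / \<rho>) * ?q z) \<longlongrightarrow> 1 * \<eta>\<^sub>0 * ?q z) at_top" by (intro tendsto_intros)
        then have "((\<lambda>\<rho>. indicator {0<..<- a\<^sub>0 * \<rho>} z * \<eta> (- z / \<rho>) * ?q z) \<longlongrightarrow> 1 * \<eta>\<^sub>0 * ?q z) at_top"
        proof (rule Lim_transform_eventually)
          have "z < - a\<^sub>0 * \<rho>" if "z / (- a\<^sub>0) < \<rho>" for \<rho> using that a0 by (simp add: field_simps)
          then show "\<forall>\<^sub>F \<rho> in at_top. 1 * \<eta> (- z / \<rho>) * ?q z = indicator {0<..<- a\<^sub>0 * \<rho>} z * \<eta> (- z / \<rho>) * ?q z"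
            by (intro eventually_mono[OF eventually_gt_at_top[of "z / (- a\<^sub>0)"]]) (use z in \<open>auto split: split_indicator\<close>)
        qed
        then show ?thesis using z by simp
      qed simp
    qed
    show "\<forall>\<^sub>F \<rho> in at_top. AE z in lborel. norm (indicator {0<..<- a\<^sub>0 * \<rho>} z * \<eta> (- z / \<rho>) * ?q z) \<le> C * (indicator {0<..} z * ?q z)"
    proof (rule eventually_mono[OF eventually_gt_at_top[of 0]], rule AE_I2)
      fix \<rho> z :: real assume \<rho>: "0 < \<rho>"
      show "norm (indicator {0<..<- a\<^sub>0 * \<rho>} z * \<eta> (- z / \<rho>) * ?q z) \<le> C * (indicator {0<..} z * ?q z)"
      proof (cases "z \<in> {0<..<- a\<^sub>0 * \<rho>}")
        case True
        then have "- z / \<rho> \<in> {a\<^sub>0..<0}" using \<rho> by (auto simp: field_simps)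
        then have "0 < \<eta> (- z / \<rho>)" "\<eta> (- z / \<rho>) \<le> C" using \<eta>_pos C by auto
        then have "\<bar>\<eta> (- z / \<rho>)\<bar> * \<bar>?q z\<bar> \<le> C * ?q z" using q0[of z] by (intro mult_mono) auto
        then show ?thesis using True by (simp add: abs_mult)
      next
        case False
        then show ?thesis using C0 q0[of z] by (simp add: mult_nonneg_nonneg)
      qed
    qed
  qed auto
  moreover have "(\<integral>z. \<eta>\<^sub>0 * (indicator {0<..} z * ?q z) \<partial>lborel) = stable_const"
    using stable_kernel_integral(2) by (simp add: stable_const_def)
  ultimately show ?thesis by simp
qed

text \<open>Beside the scaled integral there are two corrections: compensating with exp y - 1
  instead of y near 0, and the finitely many jumps below \<open>a\<^sub>0\<close>. Both grow at most
  linearly in \<rho>, which is negligible because \<alpha> > 1.\<close>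

lemma neg_exponent_asymp: "((\<lambda>\<rho>. neg_exponent \<nu> \<rho> / \<rho> powr \<alpha>) \<longlongrightarrow> stable_const) at_top"
proof -
  define I where "I \<rho> = (\<integral>z. indicator {0<..<- a\<^sub>0 * \<rho>} z * \<eta> (- z / \<rho>) * ((exp (- z) - 1 + z) * z powr (- 1 - \<alpha>)) \<partial>lborel)" for \<rho>
  define c1 where "c1 = (\<integral>y. indicator {a\<^sub>0<..<0} y * (exp y - 1 - y) \<partial>\<nu>)"
  define R where "R \<rho> = (\<integral>y. indicator {..a\<^sub>0} y * neg_kernel \<rho> y \<partial>\<nu>)" for \<rho>
  have fa: "emeasure \<nu> {..a\<^sub>0} < \<infinity>"
  proof -
    have "emeasure \<nu> {..a\<^sub>0} \<le> emeasure \<nu> {y. - a\<^sub>0 \<le> \<bar>y\<bar>}" by (rule emeasure_mono) auto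
    then show ?thesis using finite_away[of "- a\<^sub>0"] a0 by (auto simp: le_less_trans)
  qed
  define m where "m = measure \<nu> {..a\<^sub>0}"
  have iq: "integrable \<nu> (\<lambda>y. indicator {a\<^sub>0<..<0} y * (exp (\<rho> * y) - 1 - \<rho> * y))" if "0 \<le> \<rho>" for \<rho>
  proof (rule Bochner_Integration.integrable_bound)
    show "integrable \<nu> (\<lambda>y. (\<rho>\<^sup>2 * (1 + a\<^sub>0\<^sup>2)) * min 1 (y\<^sup>2))" using integrable_min by simp
    show "AE y in \<nu>. norm (indicator {a\<^sub>0<..<0} y * (exp (\<rho> * y) - 1 - \<rho> * y)) \<le> norm ((\<rho>\<^sup>2 * (1 + a\<^sub>0\<^sup>2)) * min 1 (y\<^sup>2))"
    proof (rule AE_I2)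
      fix y :: real
      show "norm (indicator {a\<^sub>0<..<0} y * (exp (\<rho> * y) - 1 - \<rho> * y)) \<le> norm ((\<rho>\<^sup>2 * (1 + a\<^sub>0\<^sup>2)) * min 1 (y\<^sup>2))"
      proof (cases "y \<in> {a\<^sub>0<..<0}")
        case True
        then have y: "a\<^sub>0 < y" "y < 0" by auto
        have "0 \<le> exp (\<rho> * y) - 1 - \<rho> * y" using exp_ge_add_one_self[of "\<rho> * y"] by linarith
        moreover have "exp (\<rho> * y) - 1 - \<rho> * y \<le> (\<rho> * y)\<^sup>2 / 2"
          by (rule exp_nonpos_le_quadratic) (use y that in \<open>simp add: mult_nonneg_nonpos\<close>)
        moreover have "(\<rho> * y)\<^sup>2 / 2 \<le> \<rho>\<^sup>2 * y\<^sup>2" by (simp add: power_mult_distrib)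
        moreover have "y\<^sup>2 \<le> (1 + a\<^sub>0\<^sup>2) * min 1 (y\<^sup>2)"
        proof -
          have "y\<^sup>2 \<le> a\<^sub>0\<^sup>2" using y power_mono[of "- y" "- a\<^sub>0" 2] by simp
          moreover have "1 * y\<^sup>2 \<le> (1 + a\<^sub>0\<^sup>2) * y\<^sup>2" by (rule mult_right_mono) auto
          ultimately show ?thesis unfolding min_def by auto
        qed
        from mult_left_mono[OF this, of "\<rho>\<^sup>2"] have "\<rho>\<^sup>2 * y\<^sup>2 \<le> \<rho>\<^sup>2 * (1 + a\<^sub>0\<^sup>2) * min 1 (y\<^sup>2)" by (simp add: mult.assoc)
        moreover have "0 \<le> \<rho>\<^sup>2 * (1 + a\<^sub>0\<^sup>2) * min 1 (y\<^sup>2)" by simp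
        ultimately show ?thesis using True by simp
      qed simp
    qed
  qed simp
  have dec: "neg_exponent \<nu> \<rho> = \<rho> powr \<alpha> * I \<rho> - \<rho> * c1 + R \<rho>" if \<rho>: "0 < \<rho>" for \<rho>
  proof -
    have e: "indicator {..<0} y * neg_kernel \<rho> y = indicator {a\<^sub>0<..<0} y * (exp (\<rho> * y) - 1 - \<rho> * y)
       - \<rho> * (indicator {a\<^sub>0<..<0} y * (exp y - 1 - y)) + indicator {..a\<^sub>0} y * neg_kernel \<rho> y" for y
      using a0 by (auto simp: neg_kernel_def algebra_simps split: split_indicator)
    have iR: "integrable \<nu> (\<lambda>y. indicator {..a\<^sub>0} y * neg_kernel \<rho> y)" by (rule integrable_neg_kernel) (use a0 \<rho> in auto)
    have i1: "integrable \<nu> (\<lambda>y. indicator {a\<^sub>0<..<0} y * (exp y - 1 - y))" using iq[of 1] by simp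
    have "neg_exponent \<nu> \<rho> = (\<integral>y. indicator {a\<^sub>0<..<0} y * (exp (\<rho> * y) - 1 - \<rho> * y) \<partial>\<nu>) - \<rho> * c1 + R \<rho>"
      unfolding neg_exponent_def e c1_def R_def using iq[of \<rho>] iR i1 \<rho> by simp
    also have "(\<integral>y. indicator {a\<^sub>0<..<0} y * (exp (\<rho> * y) - 1 - \<rho> * y) \<partial>\<nu>) = \<rho> powr \<alpha> * I \<rho>"
      unfolding I_def scaled_integral[OF \<rho>, symmetric] by (rule integral_near_0) simp
    finally show ?thesis .
  qed
  have Rb: "\<bar>R \<rho>\<bar> \<le> (1 + \<rho>) * m" if \<rho>: "0 < \<rho>" for \<rho>
  proof -
    have iR: "integrable \<nu> (\<lambda>y. indicator {..a\<^sub>0} y * neg_kernel \<rho> y)" by (rule integrable_neg_kernel) (use a0 \<rho> in auto)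
    have "\<bar>R \<rho>\<bar> \<le> (\<integral>y. \<bar>indicator {..a\<^sub>0} y * neg_kernel \<rho> y\<bar> \<partial>\<nu>)"
      unfolding R_def by (rule integral_abs_bound)
    also have "\<dots> \<le> (\<integral>y. (1 + \<rho>) * indicator {..a\<^sub>0} y \<partial>\<nu>)"
    proof (rule integral_mono)
      show "integrable \<nu> (\<lambda>y. \<bar>indicator {..a\<^sub>0} y * neg_kernel \<rho> y\<bar>)" using iR by (rule integrable_abs)
      show "integrable \<nu> (\<lambda>y. (1 + \<rho>) * indicator {..a\<^sub>0} y)" using fa by simp
      fix y :: real
      show "\<bar>indicator {..a\<^sub>0} y * neg_kernel \<rho> y\<bar> \<le> (1 + \<rho>) * indicator {..a\<^sub>0} y"
        using neg_kernel_abs_le_linear[of y \<rho>] a0 \<rho> by (auto split: split_indicator)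
    qed
    also have "\<dots> = (1 + \<rho>) * m" by (simp add: m_def)
    finally show ?thesis .
  qed
  have p0: "((\<lambda>\<rho>::real. \<rho> / \<rho> powr \<alpha>) \<longlongrightarrow> 0) at_top" "((\<lambda>\<rho>::real. (1 + \<rho>) / \<rho> powr \<alpha>) \<longlongrightarrow> 0) at_top"
    using \<alpha> by real_asymp+
  have R0: "((\<lambda>\<rho>. R \<rho> / \<rho> powr \<alpha>) \<longlongrightarrow> 0) at_top"
  proof (rule Lim_null_comparison)
    show "((\<lambda>\<rho>. (1 + \<rho>) / \<rho> powr \<alpha> * m) \<longlongrightarrow> 0) at_top" using tendsto_mult_left_zero[OF p0(2)] by simp
    show "\<forall>\<^sub>F \<rho> in at_top. norm (R \<rho> / \<rho> powr \<alpha>) \<le> (1 + \<rho>) / \<rho> powr \<alpha> * m"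
      by (rule eventually_mono[OF eventually_gt_at_top[of 0]]) (use Rb in \<open>auto simp: divide_simps\<close>)
  qed
  have "((\<lambda>\<rho>. I \<rho> - \<rho> / \<rho> powr \<alpha> * c1 + R \<rho> / \<rho> powr \<alpha>) \<longlongrightarrow> stable_const - 0 * c1 + 0) at_top"
    using scaled_integral_tendsto unfolding I_def by (intro tendsto_intros p0 R0)
  then have "((\<lambda>\<rho>. neg_exponent \<nu> \<rho> / \<rho> powr \<alpha>) \<longlongrightarrow> stable_const - 0 * c1 + 0) at_top"
  proof (rule Lim_transform_eventually)
    show "\<forall>\<^sub>F \<rho> in at_top. I \<rho> - \<rho> / \<rho> powr \<alpha> * c1 + R \<rho> / \<rho> powr \<alpha> = neg_exponent \<nu> \<rho> / \<rho> powr \<alpha>"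
      by (rule eventually_mono[OF eventually_gt_at_top[of 0]]) (auto simp: dec field_simps)
  qed
  then show ?thesis by simp
qed

lemma stable_const_pos: "0 < stable_const"
  using \<alpha> \<eta>0 by (simp add: stable_const_def Gamma_real_pos)

end

section \<open>The premium of Bermudan put options\<close>

text \<open>What the pricing argument knows of the process: laws, semigroups and exponential
  moments. \<open>\<psi>_1\<close> says that exp A_t has mean one, and for J only an upper bound on
  the exponential mean is kept.\<close>

locale put_laws =
  fixes A J \<mu> :: "real \<Rightarrow> real measure" and \<psi> :: "real \<Rightarrow> real" and \<kappa> r \<delta> :: real
  assumes distr_A: "\<And>t. 0 \<le> t \<Longrightarrow> real_distribution (A t)"
    and distr_J: "\<And>t. 0 \<le> t \<Longrightarrow> real_distribution (J t)"
    and distr_\<mu>: "\<And>t. 0 \<le> t \<Longrightarrow> real_distribution (\<mu> t)"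
    and \<mu>_eq: "\<And>t. 0 \<le> t \<Longrightarrow> \<mu> t = distr (A t \<Otimes>\<^sub>M J t) borel (\<lambda>(x, w). x + w - \<kappa> * t)"
    and A_add: "\<And>s t. 0 \<le> s \<Longrightarrow> 0 \<le> t \<Longrightarrow> A (s + t) = (A s \<star> A t)"
    and \<mu>_add: "\<And>s t. 0 \<le> s \<Longrightarrow> 0 \<le> t \<Longrightarrow> \<mu> (s + t) = (\<mu> s \<star> \<mu> t)"
    and A_exp: "\<And>t \<rho>. 0 \<le> t \<Longrightarrow> 0 \<le> \<rho> \<Longrightarrow> integrable (A t) (\<lambda>x. exp (\<rho> * x)) \<and> (\<integral>x. exp (\<rho> * x) \<partial>A t) = exp (t * \<psi> \<rho>)"
    and J_nonneg: "\<And>t. 0 \<le> t \<Longrightarrow> AE x in J t. 0 \<le> x"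
    and J_exp: "\<And>t. 0 \<le> t \<Longrightarrow> integrable (J t) exp"
    and J_exp_le: "\<And>t. 0 \<le> t \<Longrightarrow> (\<integral>x. exp x \<partial>J t) \<le> exp (t * \<kappa>)"
    and \<psi>_1: "\<psi> 1 = 0"
    and \<kappa>: "0 \<le> \<kappa>" "\<kappa> < r - \<delta>" and r: "0 < r" and \<delta>: "0 \<le> \<delta>"
begin

definition \<gamma> :: real where "\<gamma> = r - \<delta> - \<kappa>"

lemma \<gamma>_pos: "0 < \<gamma>" using \<kappa> by (simp add: \<gamma>_def)

lemma A_exp1: assumes "0 \<le> t" shows "integrable (A t) exp" "(\<integral>x. exp x \<partial>A t) = 1"
  using A_exp[OF assms, of 1] \<psi>_1 by auto

lemma J_exp_ge: assumes "0 \<le> t" shows "1 \<le> (\<integral>x. exp x \<partial>J t)"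
proof -
  interpret J: real_distribution "J t" by (rule distr_J[OF assms])
  have "(\<integral>x. 1 \<partial>J t) \<le> (\<integral>x. exp x \<partial>J t)"
    by (rule integral_mono_AE[OF _ J_exp[OF assms]]) (use J_nonneg[OF assms] in \<open>auto elim: eventually_mono\<close>)
  then show ?thesis using J.prob_space by simp
qed

lemma sets_law: assumes "0 \<le> t" shows "sets (A t) = sets borel" "sets (J t) = sets borel" "sets (\<mu> t) = sets borel"
  using distr_A[OF assms] distr_J[OF assms] distr_\<mu>[OF assms]
  by (auto simp: real_distribution_def real_distribution_axioms_def)

lemma nn_integral_\<mu>:
  assumes t: "0 \<le> t" and f[measurable]: "f \<in> borel_measurable borel"
  shows "(\<integral>\<^sup>+x. f x \<partial>\<mu> t) = (\<integral>\<^sup>+w. \<integral>\<^sup>+z. f (z + w - \<kappa> * t) \<partial>A t \<partial>J t)"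
proof -
  interpret A: real_distribution "A t" by (rule distr_A[OF t])
  interpret J: real_distribution "J t" by (rule distr_J[OF t])
  interpret P: pair_prob_space "A t" "J t" ..
  have [measurable_cong]: "sets (A t) = sets borel" "sets (J t) = sets borel" using sets_law[OF t] by auto
  have "(\<integral>\<^sup>+x. f x \<partial>\<mu> t) = (\<integral>\<^sup>+p. f (fst p + snd p - \<kappa> * t) \<partial>(A t \<Otimes>\<^sub>M J t))"
    unfolding \<mu>_eq[OF t] by (subst nn_integral_distr) (auto simp: case_prod_beta)
  also have "\<dots> = (\<integral>\<^sup>+w. \<integral>\<^sup>+z. f (z + w - \<kappa> * t) \<partial>A t \<partial>J t)"
    by (subst P.nn_integral_snd[symmetric]) auto
  finally show ?thesis .
qed

lemma \<mu>_exp: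
  assumes t: "0 \<le> t"
  shows "integrable (\<mu> t) exp" "(\<integral>x. exp x \<partial>\<mu> t) = exp (- \<kappa> * t) * (\<integral>x. exp x \<partial>J t)"
proof -
  interpret A: real_distribution "A t" by (rule distr_A[OF t])
  interpret J: real_distribution "J t" by (rule distr_J[OF t])
  interpret M: real_distribution "\<mu> t" by (rule distr_\<mu>[OF t])
  have a: "(\<integral>\<^sup>+z. ennreal (exp z) \<partial>A t) = 1" using nn_integral_eq_integral[OF A_exp1(1)[OF t]] A_exp1(2)[OF t] by simp
  have j: "(\<integral>\<^sup>+z. ennreal (exp z) \<partial>J t) = ennreal (\<integral>x. exp x \<partial>J t)" using nn_integral_eq_integral[OF J_exp[OF t]] by simp
  have e: "exp (z + w - \<kappa> * t) = exp z * (exp (- \<kappa> * t) * exp w)" for z w by (simp add: exp_add[symmetric])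
  have *: "(\<integral>\<^sup>+x. ennreal (exp x) \<partial>\<mu> t) = ennreal (exp (- \<kappa> * t) * (\<integral>x. exp x \<partial>J t))"
    unfolding nn_integral_\<mu>[OF t, of "\<lambda>x. ennreal (exp x)", simplified] e
    by (simp add: ennreal_mult nn_integral_multc nn_integral_cmult a j)
  show i: "integrable (\<mu> t) exp" by (rule integrableI_nonneg) (auto simp: *)
  have "ennreal (\<integral>x. exp x \<partial>\<mu> t) = ennreal (exp (- \<kappa> * t) * (\<integral>x. exp x \<partial>J t))"
    unfolding *[symmetric] by (rule nn_integral_eq_integral[symmetric, OF i]) simp
  then show "(\<integral>x. exp x \<partial>\<mu> t) = exp (- \<kappa> * t) * (\<integral>x. exp x \<partial>J t)"
    by (subst (asm) ennreal_inj) (auto intro!: mult_nonneg_nonneg integral_nonneg_AE)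
qed

text \<open>Up to the factor \<open>exp (- \<gamma> * s)\<close> this is the call with strike 1 on the stock without its positive jumps but with
  their compensator \<open>\<kappa>\<close> kept in the drift \<open>\<gamma>\<close>.\<close>

definition H :: "real \<Rightarrow> real \<Rightarrow> real" where
  "H s y = (\<integral>z. max 0 (exp (y + z) - exp (- \<gamma> * s)) \<partial>A s)"

lemma H_integrable:
  assumes s: "0 \<le> s" and "0 \<le> c"
  shows "integrable (A s) (\<lambda>z. max 0 (exp (y + z) - c))"
proof -
  interpret A: real_distribution "A s" by (rule distr_A[OF s])
  show ?thesis
  proof (rule Bochner_Integration.integrable_bound)
    show "integrable (A s) (\<lambda>z. exp y * exp z)" using A_exp1(1)[OF s] by simp
    show "AE z in A s. norm (max 0 (exp (y + z) - c)) \<le> norm (exp y * exp z)"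
      using assms by (intro AE_I2) (auto simp: exp_add max_def)
  qed simp
qed

lemma H_nonneg: "0 \<le> H s y" unfolding H_def by (rule integral_nonneg_AE) simp

lemma H_measurable[measurable]: assumes s: "0 \<le> s" shows "H s \<in> borel_measurable borel"
proof -
  interpret A: real_distribution "A s" by (rule distr_A[OF s])
  have [measurable_cong]: "sets (A s) = sets borel" using sets_law[OF s] by auto
  show ?thesis unfolding H_def by measurable
qed

lemma H_ge: assumes s: "0 \<le> s" shows "exp y - 1 \<le> H s y"
proof -
  interpret A: real_distribution "A s" by (rule distr_A[OF s])
  have i: "integrable (A s) (\<lambda>z. exp y * exp z - exp (- \<gamma> * s))" using A_exp1(1)[OF s] by simp
  have "exp y - exp (- \<gamma> * s) = (\<integral>z. exp y * exp z - exp (- \<gamma> * s) \<partial>A s)"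
    using A_exp1[OF s] A.prob_space by simp
  also have "\<dots> \<le> H s y" unfolding H_def
    by (rule integral_mono[OF i H_integrable[OF s]]) (auto simp: exp_add)
  finally have "exp y - exp (- \<gamma> * s) \<le> H s y" .
  moreover have "exp (- \<gamma> * s) \<le> 1" using \<gamma>_pos s by simp
  ultimately show ?thesis by linarith
qed

text \<open>The call payoff grows by at most the growth of the stock, whose mean factor under A_s is
  one. This bounds the effect of a positive jump w.\<close>

lemma H_lip: assumes s: "0 \<le> s" and w: "0 \<le> w" shows "H s (y + w) \<le> H s y + exp y * (exp w - 1)"
proof -
  interpret A: real_distribution "A s" by (rule distr_A[OF s])
  have i: "integrable (A s) (\<lambda>z. exp y * (exp w - 1) * exp z)" using A_exp1(1)[OF s] by simp
  have "H s (y + w) \<le> (\<integral>z. max 0 (exp (y + z) - exp (- \<gamma> * s)) + exp y * (exp w - 1) * exp z \<partial>A s)"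
    unfolding H_def
  proof (rule integral_mono[OF H_integrable[OF s] Bochner_Integration.integrable_add[OF H_integrable[OF s] i]])
    fix z
    have "exp (y + w + z) = exp (y + z) + exp y * (exp w - 1) * exp z" by (simp add: exp_add algebra_simps)
    moreover have "0 \<le> exp y * (exp w - 1) * exp z" using w by simp
    ultimately show "max 0 (exp (y + w + z) - exp (- \<gamma> * s)) \<le> max 0 (exp (y + z) - exp (- \<gamma> * s)) + exp y * (exp w - 1) * exp z"
      by (auto simp: max_def)
  qed auto
  also have "\<dots> = H s y + exp y * (exp w - 1)"
    unfolding H_def using H_integrable[OF s, of "exp (- \<gamma> * s)" y] i A_exp1[OF s] by simp
  finally show ?thesis .
qed

lemma H_nn: assumes s: "0 \<le> s" shows "ennreal (H s y) = (\<integral>\<^sup>+z. ennreal (max 0 (exp (y + z) - exp (- \<gamma> * s))) \<partial>A s)"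
  unfolding H_def by (rule nn_integral_eq_integral[symmetric, OF H_integrable[OF s]]) auto

text \<open>This identity is the reason for the strike exp (- \<gamma> s): a step of length t with
  drift \<gamma> only lengthens the maturity from s to s + t, up to the factor exp (\<gamma>
  t).\<close>

lemma H_step:
  assumes s: "0 \<le> s" and t: "0 \<le> t"
  shows "(\<integral>\<^sup>+z. ennreal (H s (y + \<gamma> * t + z)) \<partial>A t) = ennreal (exp (\<gamma> * t) * H (s + t) y)"
proof -
  interpret A: real_distribution "A s" by (rule distr_A[OF s])
  interpret At: real_distribution "A t" by (rule distr_A[OF t])
  have e: "max 0 (exp (y + \<gamma> * t + z + z') - exp (- \<gamma> * s)) = exp (\<gamma> * t) * max 0 (exp (y + (z + z')) - exp (- \<gamma> * (s + t)))" for z z'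
  proof -
    have "exp (y + \<gamma> * t + z + z') - exp (- \<gamma> * s) = exp (\<gamma> * t) * (exp (y + (z + z')) - exp (- \<gamma> * (s + t)))"
      by (simp add: right_diff_distrib exp_add[symmetric] algebra_simps)
    then show ?thesis by (simp add: max_mult_distrib_left)
  qed
  have "(\<integral>\<^sup>+z. ennreal (H s (y + \<gamma> * t + z)) \<partial>A t) = (\<integral>\<^sup>+z. \<integral>\<^sup>+z'. ennreal (exp (\<gamma> * t) * max 0 (exp (y + (z + z')) - exp (- \<gamma> * (s + t)))) \<partial>A s \<partial>A t)"
    unfolding H_nn[OF s] e ..
  also have "\<dots> = (\<integral>\<^sup>+x. ennreal (exp (\<gamma> * t) * max 0 (exp (y + x) - exp (- \<gamma> * (s + t)))) \<partial>(A t \<star> A s))"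
    by (rule nn_integral_convolution[symmetric]) (auto simp: A.finite_measure_axioms At.finite_measure_axioms)
  also have "A t \<star> A s = A (s + t)" using A_add[OF t s] by (simp add: add.commute)
  also have "(\<integral>\<^sup>+x. ennreal (exp (\<gamma> * t) * max 0 (exp (y + x) - exp (- \<gamma> * (s + t)))) \<partial>A (s + t)) = ennreal (exp (\<gamma> * t)) * ennreal (H (s + t) y)"
  proof -
    have st: "0 \<le> s + t" using s t by simp
    interpret Ast: real_distribution "A (s + t)" by (rule distr_A[OF st])
    show ?thesis unfolding H_nn[OF st] by (subst nn_integral_cmult[symmetric]) (auto simp: ennreal_mult)
  qed
  finally show ?thesis by (simp add: ennreal_mult H_nonneg)
qed

text \<open>Under \<mu>_t the drift r - \<delta> loses \<kappa> to the compensator, which leaves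
  exactly the \<gamma> of \<open>H_step\<close>. The positive jumps enter as an upward shift and are
  paid for by \<open>H_lip\<close>.\<close>

lemma H_law_nn:
  assumes s: "0 \<le> s" and t: "0 \<le> t"
  shows "(\<integral>\<^sup>+x. ennreal (H s (y + (r - \<delta>) * t + x)) \<partial>\<mu> t)
    \<le> ennreal (exp (\<gamma> * t) * (H (s + t) y + exp y * ((\<integral>x. exp x \<partial>J t) - 1)))"
proof -
  interpret J: real_distribution "J t" by (rule distr_J[OF t])
  have [measurable]: "H s \<in> borel_measurable borel" "H (s + t) \<in> borel_measurable borel" using s t by auto
  have st: "0 \<le> s + t" using s t by simp
  have iJ: "integrable (J t) (\<lambda>w. H (s + t) y + exp y * (exp w - 1))" using J_exp[OF t] by simp
  have "(\<integral>\<^sup>+x. ennreal (H s (y + (r - \<delta>) * t + x)) \<partial>\<mu> t) = (\<integral>\<^sup>+w. \<integral>\<^sup>+z. ennreal (H s ((y + w) + \<gamma> * t + z)) \<partial>A t \<partial>J t)"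
    by (subst nn_integral_\<mu>[OF t]) (auto simp: \<gamma>_def algebra_simps)
  also have "\<dots> = (\<integral>\<^sup>+w. ennreal (exp (\<gamma> * t) * H (s + t) (y + w)) \<partial>J t)"
    unfolding H_step[OF s t] ..
  also have "\<dots> \<le> (\<integral>\<^sup>+w. ennreal (exp (\<gamma> * t)) * ennreal (H (s + t) y + exp y * (exp w - 1)) \<partial>J t)"
  proof (rule nn_integral_mono_AE, use J_nonneg[OF t] in eventually_elim)
    fix w :: real assume "0 \<le> w"
    from mult_left_mono[OF H_lip[OF st this, of y], of "exp (\<gamma> * t)"]
    show "ennreal (exp (\<gamma> * t) * H (s + t) (y + w)) \<le> ennreal (exp (\<gamma> * t)) * ennreal (H (s + t) y + exp y * (exp w - 1))"
      by (subst ennreal_mult'[symmetric]) (auto intro!: ennreal_leI)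
  qed
  also have "\<dots> = ennreal (exp (\<gamma> * t)) * (\<integral>\<^sup>+w. ennreal (H (s + t) y + exp y * (exp w - 1)) \<partial>J t)"
    by (rule nn_integral_cmult) simp
  also have "(\<integral>\<^sup>+w. ennreal (H (s + t) y + exp y * (exp w - 1)) \<partial>J t) = ennreal (\<integral>w. H (s + t) y + exp y * (exp w - 1) \<partial>J t)"
    by (rule nn_integral_eq_integral[OF iJ], use J_nonneg[OF t] in eventually_elim) (auto simp: H_nonneg intro!: add_nonneg_nonneg)
  also have "(\<integral>w. H (s + t) y + exp y * (exp w - 1) \<partial>J t) = H (s + t) y + exp y * ((\<integral>x. exp x \<partial>J t) - 1)"
    using J_exp[OF t] J.prob_space by simp
  finally show ?thesis by (simp add: ennreal_mult')
qed

lemma H_law: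
  assumes s: "0 \<le> s" and t: "0 \<le> t"
  shows "integrable (\<mu> t) (\<lambda>x. H s (y + (r - \<delta>) * t + x))"
    and "(\<integral>x. H s (y + (r - \<delta>) * t + x) \<partial>\<mu> t) \<le> exp (\<gamma> * t) * (H (s + t) y + exp y * ((\<integral>x. exp x \<partial>J t) - 1))"
proof -
  interpret M: real_distribution "\<mu> t" by (rule distr_\<mu>[OF t])
  have [measurable]: "H s \<in> borel_measurable borel" using s by auto
  have nn: "0 \<le> exp (\<gamma> * t) * (H (s + t) y + exp y * ((\<integral>x. exp x \<partial>J t) - 1))"
    using J_exp_ge[OF t] by (auto intro!: mult_nonneg_nonneg add_nonneg_nonneg H_nonneg)
  show i: "integrable (\<mu> t) (\<lambda>x. H s (y + (r - \<delta>) * t + x))"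
    by (rule integrableI_nonneg) (use H_law_nn[OF s t, of y] in \<open>auto simp: H_nonneg le_less_trans\<close>)
  have "ennreal (\<integral>x. H s (y + (r - \<delta>) * t + x) \<partial>\<mu> t) = (\<integral>\<^sup>+x. ennreal (H s (y + (r - \<delta>) * t + x)) \<partial>\<mu> t)"
    by (rule nn_integral_eq_integral[symmetric, OF i]) (simp add: H_nonneg)
  also note H_law_nn[OF s t]
  finally show "(\<integral>x. H s (y + (r - \<delta>) * t + x) \<partial>\<mu> t) \<le> exp (\<gamma> * t) * (H (s + t) y + exp y * ((\<integral>x. exp x \<partial>J t) - 1))"
    using nn by (simp add: ennreal_le_iff)
qed

end

section \<open>Backward induction for Bermudan puts\<close>

context put_laws
begin

text \<open>The strike is normalized to 1 and \<open>y\<close> is the logarithm of the stock price over the strike.\<close>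

primrec bermudan :: "real \<Rightarrow> nat \<Rightarrow> real \<Rightarrow> real" where
  "bermudan \<Delta> 0 = (\<lambda>y. max 0 (1 - exp y))"
| "bermudan \<Delta> (Suc n) = (\<lambda>y. max (max 0 (1 - exp y)) (exp (- r * \<Delta>) * (\<integral>x. bermudan \<Delta> n (y + (r - \<delta>) * \<Delta> + x) \<partial>\<mu> \<Delta>)))"

context
  fixes \<Delta> :: real
  assumes \<Delta>: "0 < \<Delta>"
begin

lemma \<Delta>0: "0 \<le> \<Delta>" using \<Delta> by simp

interpretation M: real_distribution "\<mu> \<Delta>" by (rule distr_\<mu>[OF \<Delta>0])

lemma sets_\<mu>[measurable_cong]: "sets (\<mu> \<Delta>) = sets borel" by (rule sets_law[OF \<Delta>0])

lemma bermudan_bounds_measurable: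
  "bermudan \<Delta> n \<in> borel_measurable borel \<and> (\<forall>y. 0 \<le> bermudan \<Delta> n y \<and> bermudan \<Delta> n y \<le> 1)"
proof (induction n)
  case 0 show ?case by auto
next
  case (Suc n)
  then have [measurable]: "bermudan \<Delta> n \<in> borel_measurable borel" and b: "\<And>y. 0 \<le> bermudan \<Delta> n y" "\<And>y. bermudan \<Delta> n y \<le> 1"
    by auto
  have m: "bermudan \<Delta> (Suc n) \<in> borel_measurable borel" by simp
  have i: "(\<integral>x. bermudan \<Delta> n (y + (r - \<delta>) * \<Delta> + x) \<partial>\<mu> \<Delta>) \<le> 1" for y
    by (rule M.integral_le_const) (auto intro!: M.integrable_const_bound[where B=1] simp: b)
  have "exp (- r * \<Delta>) * (\<integral>x. bermudan \<Delta> n (y + (r - \<delta>) * \<Delta> + x) \<partial>\<mu> \<Delta>) \<le> 1" for y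
    by (rule mult_le_one[OF _ _ i]) (use r \<Delta> b in \<open>auto intro!: integral_nonneg_AE\<close>)
  with m show ?case by auto
qed

lemma bermudan_measurable[measurable]: "bermudan \<Delta> n \<in> borel_measurable borel"
  and bermudan_nonneg: "0 \<le> bermudan \<Delta> n y" and bermudan_le_1: "bermudan \<Delta> n y \<le> 1"
  using bermudan_bounds_measurable[of n] by auto

lemma bermudan_integrable: "integrable (\<mu> \<Delta>) (\<lambda>x. bermudan \<Delta> n (y + x))"
  by (rule M.integrable_const_bound[where B=1]) (auto simp: bermudan_nonneg bermudan_le_1)

lemma bermudan_ge_payoff: "max 0 (1 - exp y) \<le> bermudan \<Delta> n y"
  by (cases n) auto

lemma bermudan_mono: "bermudan \<Delta> n y \<le> bermudan \<Delta> (Suc n) y"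
proof (induction n arbitrary: y)
  case 0 show ?case by simp
next
  case (Suc n)
  have "(\<integral>x. bermudan \<Delta> n (y + (r - \<delta>) * \<Delta> + x) \<partial>\<mu> \<Delta>) \<le> (\<integral>x. bermudan \<Delta> (Suc n) (y + (r - \<delta>) * \<Delta> + x) \<partial>\<mu> \<Delta>)"
    by (rule integral_mono[OF bermudan_integrable bermudan_integrable Suc])
  then have "exp (- r * \<Delta>) * (\<integral>x. bermudan \<Delta> n (y + (r - \<delta>) * \<Delta> + x) \<partial>\<mu> \<Delta>)
    \<le> exp (- r * \<Delta>) * (\<integral>x. bermudan \<Delta> (Suc n) (y + (r - \<delta>) * \<Delta> + x) \<partial>\<mu> \<Delta>)"
    by (rule mult_left_mono) simp
  then show ?case unfolding bermudan.simps(2)[of \<Delta> n] bermudan.simps(2)[of \<Delta> "Suc n"] by (intro max.mono order_refl)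
qed

definition m\<^sub>J :: real where "m\<^sub>J = (\<integral>x. exp x \<partial>J \<Delta>)"
definition dk :: real where "dk = \<delta> + \<kappa>"
text \<open>Measured against 1 - exp y, not against its positive part. In this form the put becomes
  call-like: nonnegative, increasing in y and at least exp y - 1.\<close>

definition premium :: "nat \<Rightarrow> real \<Rightarrow> real" where "premium n y = bermudan \<Delta> n y - 1 + exp y"
definition EV :: "nat \<Rightarrow> real \<Rightarrow> real" where "EV n y = (\<integral>x. premium n (y + (r - \<delta>) * \<Delta> + x) \<partial>\<mu> \<Delta>)"

lemma dk_nonneg: "0 \<le> dk" and dk_less: "dk < r" and \<gamma>_eq: "\<gamma> = r - dk"
  using \<kappa> \<delta> by (auto simp: dk_def \<gamma>_def)

lemma mJ: "1 \<le> m\<^sub>J" "m\<^sub>J \<le> exp (\<kappa> * \<Delta>)"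
  using J_exp_ge[OF \<Delta>0] J_exp_le[OF \<Delta>0] by (auto simp: m\<^sub>J_def mult.commute)

lemma premium_measurable[measurable]: "premium n \<in> borel_measurable borel"
  unfolding premium_def by simp

lemma premium_ge: "max 0 (exp y - 1) \<le> premium n y"
  using bermudan_ge_payoff[of y n] unfolding premium_def by auto

lemma premium_nonneg: "0 \<le> premium n y" using premium_ge[of y n] by simp

lemma premium_integrable: "integrable (\<mu> \<Delta>) (\<lambda>x. premium n (y + x))"
  unfolding premium_def exp_add
  by (intro Bochner_Integration.integrable_add Bochner_Integration.integrable_diff bermudan_integrable M.integrable_const integrable_mult_right \<mu>_exp(1)[OF \<Delta>0])

lemma int_exp_\<mu>: "(\<integral>x. exp (y + (r - \<delta>) * \<Delta> + x) \<partial>\<mu> \<Delta>) = exp y * exp ((r - dk) * \<Delta>) * m\<^sub>J"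
proof -
  have "(\<integral>x. exp (y + (r - \<delta>) * \<Delta> + x) \<partial>\<mu> \<Delta>) = exp (y + (r - \<delta>) * \<Delta>) * (exp (- \<kappa> * \<Delta>) * m\<^sub>J)"
    unfolding exp_add[of "y + (r - \<delta>) * \<Delta>"] by (simp add: \<mu>_exp(2)[OF \<Delta>0] m\<^sub>J_def)
  also have "\<dots> = exp y * exp ((r - dk) * \<Delta>) * m\<^sub>J"
    by (simp add: dk_def exp_add[symmetric] exp_diff[symmetric] algebra_simps)
  finally show ?thesis .
qed

lemma EV_eq: "EV n y = (\<integral>x. bermudan \<Delta> n (y + (r - \<delta>) * \<Delta> + x) \<partial>\<mu> \<Delta>) - 1 + exp y * exp ((r - dk) * \<Delta>) * m\<^sub>J"
proof -
  have ie: "integrable (\<mu> \<Delta>) (\<lambda>x. exp (y + (r - \<delta>) * \<Delta> + x))"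
    unfolding exp_add[of "y + (r - \<delta>) * \<Delta>"] using \<mu>_exp(1)[OF \<Delta>0] by simp
  show ?thesis
    unfolding EV_def premium_def int_exp_\<mu>[symmetric]
    using ie bermudan_integrable[of n "y + (r - \<delta>) * \<Delta>"] M.prob_space by simp
qed

text \<open>The value of waiting minus 1 - exp y, written through the expected next premium:
  interest on the strike is lost, and a nonnegative multiple of exp y is gained.\<close>

definition cont_premium :: "nat \<Rightarrow> real \<Rightarrow> real" where
  "cont_premium n y = exp (- r * \<Delta>) * EV n y - (1 - exp (- r * \<Delta>)) + exp y * (1 - exp (- dk * \<Delta>) * m\<^sub>J)"

lemma exp_rd: "exp (- r * \<Delta>) * exp ((r - dk) * \<Delta>) = exp (- dk * \<Delta>)"
  unfolding exp_add[symmetric] by (rule arg_cong[where f=exp]) (simp add: algebra_simps)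

lemma premium_Suc: "premium (Suc n) y = max (max 0 (exp y - 1)) (cont_premium n y)"
proof -
  have "R * B - 1 + Y = R * (B - 1 + Y * G * m) - (1 - R) + Y * (1 - C * m)" if "R * G = C" for R B Y G m C :: real
    unfolding that[symmetric] by (simp add: algebra_simps)
  from this[OF exp_rd] have "exp (- r * \<Delta>) * (\<integral>x. bermudan \<Delta> n (y + (r - \<delta>) * \<Delta> + x) \<partial>\<mu> \<Delta>) - 1 + exp y = cont_premium n y"
    unfolding cont_premium_def EV_eq .
  then show ?thesis unfolding premium_def bermudan.simps by (auto simp: max_def)
qed

lemma coef_nonneg: "0 \<le> 1 - exp (- dk * \<Delta>) * m\<^sub>J"
proof -
  have "m\<^sub>J \<le> exp (dk * \<Delta>)"
    using mJ(2) \<delta> \<Delta> by (rule_tac order_trans[of _ "exp (\<kappa> * \<Delta>)"]) (auto simp: dk_def intro!: mult_right_mono)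
  then have "exp (- dk * \<Delta>) * m\<^sub>J \<le> exp (- dk * \<Delta>) * exp (dk * \<Delta>)" by (rule mult_left_mono) simp
  then show ?thesis by (simp add: exp_add[symmetric])
qed

text \<open>The put itself decreases in y, so this rests on the form of \<open>cont_premium\<close>:
  \<open>coef_nonneg\<close>, a consequence of m_J \<le> exp (\<kappa> \<Delta>), gives its explicit
  term in exp y the right sign.\<close>

lemma premium_mono_y: "y \<le> y' \<Longrightarrow> premium n y \<le> premium n y'"
proof (induction n arbitrary: y y')
  case 0
  then show ?case by (auto simp: premium_def max_def)
next
  case (Suc n)
  have "EV n y \<le> EV n y'" unfolding EV_def
    by (rule integral_mono[OF premium_integrable premium_integrable]) (rule Suc.IH, use Suc.prems in simp)
  then have "exp (- r * \<Delta>) * EV n y \<le> exp (- r * \<Delta>) * EV n y'" by (rule mult_left_mono) simp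
  moreover have "exp y * (1 - exp (- dk * \<Delta>) * m\<^sub>J) \<le> exp y' * (1 - exp (- dk * \<Delta>) * m\<^sub>J)"
    using Suc.prems by (intro mult_right_mono coef_nonneg) simp
  ultimately have "cont_premium n y \<le> cont_premium n y'" unfolding cont_premium_def by linarith
  then show ?case unfolding premium_Suc using Suc.prems by (intro max.mono) auto
qed

lemma premium_mono_n: "premium n y \<le> premium (n + k) y"
proof (induction k)
  case (Suc k)
  then show ?case using bermudan_mono[of "n + k" y] by (simp add: premium_def)
qed simp

abbreviation Hn :: "nat \<Rightarrow> real \<Rightarrow> real" where "Hn n \<equiv> H (real n * \<Delta>)"

lemma n\<Delta>: "0 \<le> real n * \<Delta>" using \<Delta> by simp

definition EH :: "nat \<Rightarrow> real \<Rightarrow> real" where "EH n y = (\<integral>x. Hn n (y + (r - \<delta>) * \<Delta> + x) \<partial>\<mu> \<Delta>)"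

lemma H_integrable_\<mu>: "integrable (\<mu> \<Delta>) (\<lambda>x. Hn n (y + (r - \<delta>) * \<Delta> + x))"
  by (rule H_law(1)[OF n\<Delta> \<Delta>0])

lemma EH_le: "exp (- r * \<Delta>) * EH n y \<le> exp (- dk * \<Delta>) * (Hn (Suc n) y + exp y * (m\<^sub>J - 1))"
proof -
  have "EH n y \<le> exp (\<gamma> * \<Delta>) * (Hn (Suc n) y + exp y * (m\<^sub>J - 1))"
    using H_law(2)[OF n\<Delta>[of n] \<Delta>0, of y] unfolding EH_def m\<^sub>J_def by (simp add: algebra_simps)
  then have "exp (- r * \<Delta>) * EH n y \<le> exp (- r * \<Delta>) * (exp (\<gamma> * \<Delta>) * (Hn (Suc n) y + exp y * (m\<^sub>J - 1)))"
    by (rule mult_left_mono) simp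
  also have "\<dots> = (exp (- r * \<Delta>) * exp (\<gamma> * \<Delta>)) * (Hn (Suc n) y + exp y * (m\<^sub>J - 1))" by (simp only: mult.assoc)
  also have "exp (- r * \<Delta>) * exp (\<gamma> * \<Delta>) = exp (- dk * \<Delta>)"
    unfolding exp_add[symmetric] by (rule arg_cong[where f=exp]) (simp add: \<gamma>_eq algebra_simps)
  finally show ?thesis .
qed

text \<open>To first order in \<Delta>, \<open>slack\<close> is \<gamma> \<Delta>, the gain of a
  step at which continuation is optimal, and \<open>loss\<close> is (\<gamma> + r) \<Delta>.\<close>

definition slack :: real where "slack = exp (- dk * \<Delta>) - exp (- r * \<Delta>)"
definition loss :: real where "loss = slack + 1 - exp (- r * \<Delta>)"

lemma exp_d: "0 < exp (- dk * \<Delta>)" "exp (- dk * \<Delta>) \<le> 1" "exp (- r * \<Delta>) \<le> exp (- dk * \<Delta>)" "exp (- r * \<Delta>) \<le> 1"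
  using dk_nonneg dk_less \<Delta> r by (auto intro: mult_right_mono)

lemma slack_nonneg: "0 \<le> slack" and loss_nonneg: "0 \<le> loss"
  using exp_d unfolding slack_def loss_def by linarith+

text \<open>The drift of the premium dominates the gain from the positive jumps: this is where the hypothesis
  on the positive part of the Levy measure enters.\<close>

lemma continuation_le: "exp (- r * \<Delta>) * (EH n y - EV n y) + slack \<le> Hn (Suc n) y - cont_premium n y"
proof -
  have h: "exp y \<le> 1 + Hn (Suc n) y" using H_ge[OF n\<Delta>[of "Suc n"], of y] by linarith
  have "exp (- r * \<Delta>) * (EH n y - EV n y) \<le> exp (- dk * \<Delta>) * (Hn (Suc n) y + exp y * (m\<^sub>J - 1)) - exp (- r * \<Delta>) * EV n y"
    using EH_le[of n y] by (simp add: right_diff_distrib)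
  \<comment> \<open>The factor m_J of the positive jumps cancels here. What is left in front of exp
    y is 1 - exp (- dk \<Delta>) \<ge> 0, so \<open>h\<close> can be inserted.\<close>
  also have "\<dots> = exp (- dk * \<Delta>) * Hn (Suc n) y - cont_premium n y + (1 - exp (- dk * \<Delta>)) * exp y - (1 - exp (- r * \<Delta>))"
    unfolding cont_premium_def by (simp add: algebra_simps)
  also have "\<dots> \<le> exp (- dk * \<Delta>) * Hn (Suc n) y - cont_premium n y + (1 - exp (- dk * \<Delta>)) * (1 + Hn (Suc n) y) - (1 - exp (- r * \<Delta>))"
    using mult_left_mono[OF h, of "1 - exp (- dk * \<Delta>)"] exp_d by simp
  also have "\<dots> = Hn (Suc n) y - cont_premium n y - slack" unfolding slack_def by (simp add: algebra_simps)
  finally show ?thesis by simp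
qed

text \<open>Backward induction with \<open>continuation_le\<close>. The term \<open>slack\<close> is
  discarded here; the sharper count that keeps it is \<open>defect_step\<close>.\<close>

lemma premium_le_H: "premium n y \<le> Hn n y"
proof (induction n arbitrary: y)
  case 0
  have "premium 0 y = max 0 (exp y - 1)" by (auto simp: premium_def max_def)
  then show ?case using H_ge[OF n\<Delta>[of 0], of y] H_nonneg[of "real 0 * \<Delta>" y] by simp
next
  case (Suc n)
  have "EV n y \<le> EH n y" unfolding EV_def EH_def
    by (rule integral_mono[OF premium_integrable H_integrable_\<mu> Suc])
  then have "0 \<le> exp (- r * \<Delta>) * (EH n y - EV n y)" by simp
  with continuation_le[of n y] slack_nonneg have "cont_premium n y \<le> Hn (Suc n) y" by linarith
  then show ?case unfolding premium_Suc using H_ge[OF n\<Delta>[of "Suc n"], of y] H_nonneg[of "real (Suc n) * \<Delta>" y] by simp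
qed

context
  fixes N :: nat and y0 :: real
  assumes cont: "0 < premium N y0"
begin

text \<open>While the process stays in the strip \<open>{y0..0}\<close>, continuation is optimal at every step, so the gap
  between the bound \<open>H\<close> and the premium grows by \<open>slack\<close> per step; \<open>loss\<close> pays for the steps outside.\<close>

definition defect :: "nat \<Rightarrow> real \<Rightarrow> real" where "defect k y = Hn (N + k) y - premium (N + k) y"

lemma defect_nonneg: "0 \<le> defect k y" using premium_le_H[of "N + k" y] by (simp add: defect_def)

lemma defect_measurable[measurable]: "defect k \<in> borel_measurable borel"
  unfolding defect_def[abs_def] by (rule borel_measurable_diff[OF H_measurable[OF n\<Delta>] premium_measurable])

lemma defect_integrable: "integrable (\<mu> \<Delta>) (\<lambda>x. defect k (y + (r - \<delta>) * \<Delta> + x))"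
  unfolding defect_def by (intro Bochner_Integration.integrable_diff H_integrable_\<mu> premium_integrable)

text \<open>Where continuation is optimal this is \<open>continuation_le\<close>. Where exercise is
  optimal, y must lie outside the strip, and \<open>loss\<close> is made just large enough to cover
  the deficit.\<close>

lemma defect_step:
  "exp (- r * \<Delta>) * (\<integral>x. defect k (y + (r - \<delta>) * \<Delta> + x) \<partial>\<mu> \<Delta>) + slack - loss * indicator (- {y0..0}) y \<le> defect (Suc k) y"
proof -
  let ?n = "N + k"
  have ED: "(\<integral>x. defect k (y + (r - \<delta>) * \<Delta> + x) \<partial>\<mu> \<Delta>) = EH ?n y - EV ?n y"
    unfolding defect_def EH_def EV_def by (rule Bochner_Integration.integral_diff[OF H_integrable_\<mu> premium_integrable])
  have Ds: "defect (Suc k) y = Hn (Suc ?n) y - max (max 0 (exp y - 1)) (cont_premium ?n y)"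
    unfolding defect_def premium_Suc[symmetric] by simp
  show ?thesis
  proof (cases "max 0 (exp y - 1) \<le> cont_premium ?n y")
    case True
    then have "defect (Suc k) y = Hn (Suc ?n) y - cont_premium ?n y" using Ds by simp
    then show ?thesis unfolding ED using continuation_le[of ?n y] loss_nonneg by (simp add: indicator_def)
  next
    case False
    then have D': "defect (Suc k) y = Hn (Suc ?n) y - max 0 (exp y - 1)" and V': "premium (Suc ?n) y = max 0 (exp y - 1)"
      using Ds premium_Suc[of ?n y] by auto
    \<comment> \<open>A positive premium at y0 with N dates stays positive at higher prices and with
      more dates, whereas exercising at y \<le> 0 would mean premium zero.\<close>
    have "y \<notin> {y0..0}"
    proof
      assume y: "y \<in> {y0..0}"
      have "premium N y0 \<le> premium (Suc ?n) y" using order_trans[OF premium_mono_y[of y0 y N] premium_mono_n[of N y "Suc k"]] y by simp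
      with cont V' y show False by simp
    qed
    \<comment> \<open>This suffices because \<open>slack\<close> - \<open>loss\<close> = - (1 - exp
      (- r \<Delta>)). Above the strike the next premium is bounded below by the forward exp - 1, at
      or below it by zero.\<close>
    moreover have "exp (- r * \<Delta>) * (EH ?n y - EV ?n y) - (1 - exp (- r * \<Delta>)) \<le> defect (Suc k) y"
    proof (cases "0 < y")
      case True
      have h: "0 \<le> Hn (Suc ?n) y - exp y + 1" using H_ge[OF n\<Delta>[of "Suc ?n"], of y] by linarith
      have "(\<integral>x. exp (y + (r - \<delta>) * \<Delta> + x) - 1 \<partial>\<mu> \<Delta>) \<le> EV ?n y"
        unfolding EV_def
      proof (rule integral_mono[OF _ premium_integrable])
        show "integrable (\<mu> \<Delta>) (\<lambda>x. exp (y + (r - \<delta>) * \<Delta> + x) - 1)"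
          unfolding exp_add[of "y + (r - \<delta>) * \<Delta>"] using \<mu>_exp(1)[OF \<Delta>0] by simp
        show "exp (y + (r - \<delta>) * \<Delta> + x) - 1 \<le> premium ?n (y + (r - \<delta>) * \<Delta> + x)" for x
          using premium_ge[of "y + (r - \<delta>) * \<Delta> + x" ?n] by simp
      qed
      moreover have "(\<integral>x. exp (y + (r - \<delta>) * \<Delta> + x) - 1 \<partial>\<mu> \<Delta>) = exp y * exp ((r - dk) * \<Delta>) * m\<^sub>J - 1"
      proof -
        have "integrable (\<mu> \<Delta>) (\<lambda>x. exp (y + (r - \<delta>) * \<Delta> + x))"
          unfolding exp_add[of "y + (r - \<delta>) * \<Delta>"] using \<mu>_exp(1)[OF \<Delta>0] by simp
        then show ?thesis using int_exp_\<mu>[of y] M.prob_space by simp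
      qed
      ultimately have "exp (- r * \<Delta>) * (exp y * exp ((r - dk) * \<Delta>) * m\<^sub>J - 1) \<le> exp (- r * \<Delta>) * EV ?n y"
        by (intro mult_left_mono) auto
      moreover have "Y * C * m - R \<le> R * E" if "R * G = C" "R * (Y * G * m - 1) \<le> R * E" for R E Y G m C :: real
        unfolding that(1)[symmetric] using that(2) by (simp add: algebra_simps)
      ultimately have "exp y * exp (- dk * \<Delta>) * m\<^sub>J - exp (- r * \<Delta>) \<le> exp (- r * \<Delta>) * EV ?n y"
        using exp_rd by blast
      then have "exp (- r * \<Delta>) * (EH ?n y - EV ?n y) \<le> exp (- dk * \<Delta>) * (Hn (Suc ?n) y + exp y * (m\<^sub>J - 1)) - (exp y * exp (- dk * \<Delta>) * m\<^sub>J - exp (- r * \<Delta>))"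
        using EH_le[of ?n y] unfolding right_diff_distrib[of "exp (- r * \<Delta>)" "EH ?n y"] by linarith
      also have "\<dots> = exp (- dk * \<Delta>) * (Hn (Suc ?n) y - exp y + 1) - (exp (- dk * \<Delta>) - exp (- r * \<Delta>))"
        by (simp add: algebra_simps)
      also have "\<dots> \<le> 1 * (Hn (Suc ?n) y - exp y + 1)"
        using mult_right_mono[OF exp_d(2) h] exp_d by linarith
      finally have "exp (- r * \<Delta>) * (EH ?n y - EV ?n y) \<le> 1 * (Hn (Suc ?n) y - exp y + 1)" .
      moreover have "defect (Suc k) y = Hn (Suc ?n) y - (exp y - 1)" using D' True by simp
      moreover have "a - (1 - R) \<le> D'" if "a \<le> 1 * (h - Y + 1)" "D' = h - (Y - 1)" "R \<le> 1" for a R D' h Y :: real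
        using that by argo
      ultimately show ?thesis using exp_d(4) by blast
    next
      case False
      then have D'': "defect (Suc k) y = Hn (Suc ?n) y" and e1: "exp y \<le> 1" using D' by auto
      have "0 \<le> EV ?n y" unfolding EV_def by (rule integral_nonneg_AE) (simp add: premium_nonneg)
      then have "0 \<le> exp (- r * \<Delta>) * EV ?n y" by (intro mult_nonneg_nonneg) auto
      then have "exp (- r * \<Delta>) * (EH ?n y - EV ?n y) \<le> exp (- dk * \<Delta>) * (Hn (Suc ?n) y + exp y * (m\<^sub>J - 1))"
        using EH_le[of ?n y] unfolding right_diff_distrib[of "exp (- r * \<Delta>)" "EH ?n y"] by linarith
      also have "\<dots> = exp (- dk * \<Delta>) * Hn (Suc ?n) y + exp y * (exp (- dk * \<Delta>) * m\<^sub>J - exp (- dk * \<Delta>))"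
        by (simp add: algebra_simps)
      also have "exp y * (exp (- dk * \<Delta>) * m\<^sub>J - exp (- dk * \<Delta>)) \<le> 1 * (1 - exp (- dk * \<Delta>))"
      proof (rule mult_mono[OF e1])
        show "exp (- dk * \<Delta>) * m\<^sub>J - exp (- dk * \<Delta>) \<le> 1 - exp (- dk * \<Delta>)" using coef_nonneg by simp
        have "exp (- dk * \<Delta>) * 1 \<le> exp (- dk * \<Delta>) * m\<^sub>J" using mJ by (intro mult_left_mono) auto
        then show "0 \<le> exp (- dk * \<Delta>) * m\<^sub>J - exp (- dk * \<Delta>)" by simp
      qed auto
      also have "exp (- dk * \<Delta>) * Hn (Suc ?n) y \<le> 1 * Hn (Suc ?n) y"
        by (rule mult_right_mono[OF exp_d(2) H_nonneg])
      finally have "exp (- r * \<Delta>) * (EH ?n y - EV ?n y) \<le> 1 * Hn (Suc ?n) y + 1 * (1 - exp (- dk * \<Delta>))" by simp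
      moreover have "a - (1 - R) \<le> D'" if "a \<le> 1 * h + 1 * (1 - C)" "D' = h" "R \<le> C" for a R D' h C :: real
        using that by argo
      ultimately show ?thesis using D'' exp_d(3) by blast
    qed
    ultimately show ?thesis unfolding ED loss_def by (simp add: algebra_simps)
  qed
qed

text \<open>The chance that the log price started at y is outside the strip after j steps. The case
  j = 0 is separate so that \<mu> 0 need not be identified with a point mass.\<close>

fun out_prob :: "nat \<Rightarrow> real \<Rightarrow> real" where
  "out_prob 0 y = indicator (- {y0..0}) y"
| "out_prob (Suc j) y = measure (\<mu> (real (Suc j) * \<Delta>)) {x. y + (r - \<delta>) * (real (Suc j) * \<Delta>) + x \<notin> {y0..0}}"

lemma out_prob_measurable[measurable]: "out_prob j \<in> borel_measurable borel"
proof (cases j)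
  case 0
  then have "out_prob j = indicator (- {y0..0})" by auto
  then show ?thesis by simp
next
  case (Suc i)
  define t where "t = real (Suc i) * \<Delta>"
  have t: "0 \<le> t" using \<Delta> by (simp add: t_def)
  interpret Mt: real_distribution "\<mu> t" by (rule distr_\<mu>[OF t])
  have [measurable_cong]: "sets (\<mu> t) = sets borel" by (rule sets_law[OF t])
  have e: "out_prob j y = (\<integral>x. indicat_real (- {y0..0}) (y + (r - \<delta>) * t + x) \<partial>\<mu> t)" for y
  proof -
    have "(\<integral>x. indicat_real (- {y0..0}) (y + (r - \<delta>) * t + x) \<partial>\<mu> t) = (\<integral>x. indicator {x. y + (r - \<delta>) * t + x \<notin> {y0..0}} x \<partial>\<mu> t)"
      by (intro Bochner_Integration.integral_cong) (auto split: split_indicator)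
    then show ?thesis unfolding Suc out_prob.simps t_def[symmetric] by simp
  qed
  show ?thesis unfolding e by measurable
qed

lemma out_prob_bounds: "0 \<le> out_prob j y" "out_prob j y \<le> 1"
proof -
  have "out_prob j y \<le> 1 \<and> 0 \<le> out_prob j y"
  proof (cases j)
    case (Suc i)
    interpret Mt: real_distribution "\<mu> (real (Suc i) * \<Delta>)" by (rule distr_\<mu>[OF n\<Delta>])
    show ?thesis unfolding Suc by (simp del: of_nat_Suc)
  qed simp
  then show "0 \<le> out_prob j y" "out_prob j y \<le> 1" by auto
qed

text \<open>The Chapman-Kolmogorov equation, from the semigroup property of \<mu>.\<close>

lemma out_prob_step: "(\<integral>x. out_prob j (y + (r - \<delta>) * \<Delta> + x) \<partial>\<mu> \<Delta>) = out_prob (Suc j) y"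
proof (cases j)
  case 0
  have "(\<integral>x. out_prob j (y + (r - \<delta>) * \<Delta> + x) \<partial>\<mu> \<Delta>) = (\<integral>x. indicator {x. y + (r - \<delta>) * \<Delta> + x \<notin> {y0..0}} x \<partial>\<mu> \<Delta>)"
    unfolding 0 by (intro Bochner_Integration.integral_cong) (auto split: split_indicator)
  then show ?thesis unfolding 0 by simp
next
  case (Suc i)
  define t where "t = real (Suc i) * \<Delta>"
  have t: "0 \<le> t" using \<Delta> by (simp add: t_def)
  have T: "real (Suc (Suc i)) * \<Delta> = \<Delta> + t" by (simp add: t_def algebra_simps)
  have tT: "0 \<le> \<Delta> + t" using t \<Delta> by simp
  interpret Mt: real_distribution "\<mu> t" by (rule distr_\<mu>[OF t])
  interpret MT: real_distribution "\<mu> (\<Delta> + t)" by (rule distr_\<mu>[OF tT])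
  have [measurable_cong]: "sets (\<mu> t) = sets borel" by (rule sets_law[OF t])
  let ?S = "\<lambda>a. {x. a + x \<notin> {y0..0}}"
  have S: "?S a \<in> sets borel" for a
  proof -
    have "?S a = (\<lambda>x. a + x) -` (- {y0..0}) \<inter> space borel" by auto
    also have "\<dots> \<in> sets borel" by (rule measurable_sets[of _ borel borel]) auto
    finally show ?thesis .
  qed
  have "ennreal (out_prob (Suc j) y) = emeasure (\<mu> \<Delta> \<star> \<mu> t) (?S (y + (r - \<delta>) * (\<Delta> + t)))"
    unfolding Suc out_prob.simps T \<mu>_add[OF \<Delta>0 t, symmetric] by (simp add: MT.emeasure_eq_measure)
  also have "\<dots> = (\<integral>\<^sup>+x. emeasure (\<mu> t) {a. a + x \<in> ?S (y + (r - \<delta>) * (\<Delta> + t))} \<partial>\<mu> \<Delta>)"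
    by (rule convolution_emeasure) (auto simp: S M.finite_measure_axioms Mt.finite_measure_axioms sets_law[OF t] sets_law[OF \<Delta>0])
  also have "\<dots> = (\<integral>\<^sup>+x. ennreal (out_prob j (y + (r - \<delta>) * \<Delta> + x)) \<partial>\<mu> \<Delta>)"
  proof (rule nn_integral_cong)
    fix x
    have "{a. a + x \<in> ?S (y + (r - \<delta>) * (\<Delta> + t))} = ?S (y + (r - \<delta>) * \<Delta> + x + (r - \<delta>) * t)"
      by (simp add: algebra_simps)
    then show "emeasure (\<mu> t) {a. a + x \<in> ?S (y + (r - \<delta>) * (\<Delta> + t))} = ennreal (out_prob j (y + (r - \<delta>) * \<Delta> + x))"
      unfolding Suc out_prob.simps t_def[symmetric] by (simp add: Mt.emeasure_eq_measure)
  qed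
  also have "\<dots> = ennreal (\<integral>x. out_prob j (y + (r - \<delta>) * \<Delta> + x) \<partial>\<mu> \<Delta>)"
    by (intro nn_integral_eq_integral M.integrable_const_bound[where B=1]) (auto simp: out_prob_bounds)
  finally show ?thesis
    by (subst (asm) ennreal_inj) (auto intro!: integral_nonneg_AE simp: out_prob_bounds simp del: out_prob.simps)
qed

text \<open>\<open>defect_step\<close> unrolled over k steps. The gains are all discounted by the
  largest amount and the losses not at all, which keeps the sum simple and costs nothing over short
  horizons.\<close>

lemma defect_sum: "exp (- r * (real k * \<Delta>)) * (real k * slack) - loss * (\<Sum>j<k. out_prob j y) \<le> defect k y"
proof (induction k arbitrary: y)
  case 0
  show ?case using defect_nonneg by simp
next
  case (Suc k)
  define a where "a = exp (- r * (real k * \<Delta>)) * (real k * slack)"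
  have a0: "0 \<le> a" using slack_nonneg by (simp add: a_def)
  let ?y = "\<lambda>x. y + (r - \<delta>) * \<Delta> + x"
  have io: "integrable (\<mu> \<Delta>) (\<lambda>x. out_prob j (?y x))" for j
    by (rule M.integrable_const_bound[where B=1]) (auto simp: out_prob_bounds)
  have int_sum: "integrable (\<mu> \<Delta>) (\<lambda>x. a - loss * (\<Sum>j<k. out_prob j (?y x)))"
    using io by simp
  have "a - loss * (\<Sum>j<k. out_prob (Suc j) y) = (\<integral>x. a - loss * (\<Sum>j<k. out_prob j (?y x)) \<partial>\<mu> \<Delta>)"
    using io by (simp add: M.prob_space[simplified] out_prob_step del: out_prob.simps)
  also have "\<dots> \<le> (\<integral>x. defect k (?y x) \<partial>\<mu> \<Delta>)"
    by (rule integral_mono[OF int_sum defect_integrable]) (use Suc in \<open>simp add: a_def\<close>)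
  finally have "exp (- r * \<Delta>) * (a - loss * (\<Sum>j<k. out_prob (Suc j) y)) \<le> exp (- r * \<Delta>) * (\<integral>x. defect k (?y x) \<partial>\<mu> \<Delta>)"
    by (rule mult_left_mono) simp
  moreover have "exp (- r * \<Delta>) * (loss * (\<Sum>j<k. out_prob (Suc j) y)) \<le> 1 * (loss * (\<Sum>j<k. out_prob (Suc j) y))"
    by (rule mult_right_mono[OF exp_d(4)]) (auto intro!: mult_nonneg_nonneg sum_nonneg loss_nonneg out_prob_bounds simp del: out_prob.simps)
  ultimately have 1: "exp (- r * \<Delta>) * a - loss * (\<Sum>j<k. out_prob (Suc j) y) + slack - loss * out_prob 0 y \<le> defect (Suc k) y"
    using defect_step[of k y] by (simp add: right_diff_distrib del: out_prob.simps(2))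
  have ea: "exp (- r * \<Delta>) * a = exp (- r * (real (Suc k) * \<Delta>)) * (real k * slack)"
    by (simp add: a_def exp_add[symmetric] algebra_simps)
  have "exp (- r * (real (Suc k) * \<Delta>)) * slack \<le> 1 * slack"
    by (rule mult_right_mono[OF _ slack_nonneg]) (use r \<Delta> in auto)
  moreover have "exp (- r * (real (Suc k) * \<Delta>)) * (real (Suc k) * slack)
      = exp (- r * (real (Suc k) * \<Delta>)) * (real k * slack) + exp (- r * (real (Suc k) * \<Delta>)) * slack"
    by (simp add: algebra_simps)
  moreover have "(\<Sum>j<Suc k. out_prob j y) = out_prob 0 y + (\<Sum>j<k. out_prob (Suc j) y)"
    by (rule sum.lessThan_Suc_shift)
  ultimately show ?case using 1 unfolding ea by (simp add: distrib_left del: out_prob.simps of_nat_Suc)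
qed

end

text \<open>The contradiction in usable form. A positive premium at y0 would make the defect at y1,
  which is at most H, exceed the accumulated gain minus the loss outside the strip. Only 0 < j < k
  need an estimate: at j = 0 the start y1 is in the strip.\<close>

lemma premium_eq_0I:
  fixes k N :: nat
  assumes y1: "y1 \<in> {y0..0}"
    and out: "\<And>j. 0 < j \<Longrightarrow> j < k \<Longrightarrow> measure (\<mu> (real j * \<Delta>)) {x. y1 + (r - \<delta>) * (real j * \<Delta>) + x \<notin> {y0..0}} \<le> p"
    and p: "0 \<le> p"
    and H: "Hn (N + k) y1 < exp (- r * (real k * \<Delta>)) * (real k * slack) - loss * (real k * p)"
  shows "premium N y0 = 0"
proof (rule ccontr)
  assume "premium N y0 \<noteq> 0"
  then have c: "0 < premium N y0" using premium_nonneg[of N y0] by simp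
  have "out_prob y0 j y1 \<le> p" if "j < k" for j
  proof (cases j)
    case 0 then show ?thesis using y1 p out_prob.simps(1)[OF c, of y1] by simp
  next
    case (Suc i)
    have "out_prob y0 j y1 = measure (\<mu> (real j * \<Delta>)) {x. y1 + (r - \<delta>) * (real j * \<Delta>) + x \<notin> {y0..0}}"
      unfolding Suc by (rule out_prob.simps(2)[OF c])
    then show ?thesis using out[of j] that Suc by (simp del: of_nat_Suc)
  qed
  then have "(\<Sum>j<k. out_prob y0 j y1) \<le> (\<Sum>j<k. p)" by (intro sum_mono) auto
  then have "loss * (\<Sum>j<k. out_prob y0 j y1) \<le> loss * (real k * p)" using loss_nonneg by (intro mult_left_mono) auto
  moreover have "defect N k y1 \<le> Hn (N + k) y1" using premium_nonneg[of "N + k" y1] defect_def[OF c, of k y1] by simp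
  ultimately show False using defect_sum[OF c, of k y1] H by linarith
qed

end
end

section \<open>Small-time estimates at the threshold\<close>

locale put_laws_asymp = put_laws +
  fixes \<alpha> C :: real
  assumes \<alpha>: "1 < \<alpha>" "\<alpha> < 2" and C: "0 < C"
    and \<psi>_nonneg: "\<And>\<rho>. 1 \<le> \<rho> \<Longrightarrow> 0 \<le> \<psi> \<rho>"
    and \<psi>_asymp: "((\<lambda>\<rho>. \<psi> \<rho> / \<rho> powr \<alpha>) \<longlongrightarrow> C) at_top"
begin

definition lam :: real where "lam = (\<alpha> * C) powr (1 / \<alpha>)"
definition h :: "real \<Rightarrow> real" where "h t = t powr (1 / \<alpha>) * (- ln t) powr (1 - 1 / \<alpha>)"
text \<open>The saddle point at level lam: \<alpha> C t \<rho>^(\<alpha>-1) = lam * h t holds at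
  \<rho> = \<open>rho\<close> t, so it minimizes - \<rho> lam h(t) + t C \<rho>^\<alpha>.\<close>

definition rho :: "real \<Rightarrow> real" where "rho t = ((- ln t) / t) powr (1 / \<alpha>) / lam"

lemma lam_pos: "0 < lam" and lam_powr: "lam powr \<alpha> = \<alpha> * C"
  using \<alpha> C by (auto simp: lam_def powr_powr)

lemma inv\<alpha>: "0 < 1 / \<alpha>" "1 / \<alpha> < 1"
  using \<alpha> by auto

lemma ell_at_top: "filterlim (\<lambda>t::real. - ln t) at_top (at_right 0)" by real_asymp
lemma rho_at_top: "filterlim rho at_top (at_right 0)"
  unfolding rho_def[abs_def] using inv\<alpha> lam_pos by real_asymp
lemma h_tendsto_0: "(h \<longlongrightarrow> 0) (at_right 0)"
  unfolding h_def[abs_def] using inv\<alpha> by real_asymp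
lemma t_over_h: "((\<lambda>t. t / h t) \<longlongrightarrow> 0) (at_right 0)"
  unfolding h_def using inv\<alpha> by real_asymp
lemma t_rho: "((\<lambda>t. t * rho t) \<longlongrightarrow> 0) (at_right 0)"
  unfolding rho_def using inv\<alpha> lam_pos by real_asymp

lemma small_pos: "\<forall>\<^sub>F t::real in at_right 0. 0 < t \<and> t < 1"
  using eventually_at_right_real[of 0 "1::real"] by (auto elim: eventually_mono)

lemma h_pos: assumes "0 < t" "t < 1" shows "0 < h t"
proof -
  have "0 < - ln t" using assms by simp
  then show ?thesis unfolding h_def using assms by (intro mult_pos_pos) (auto simp: powr_gt_zero)
qed

lemma rho_h: assumes "0 < t" "t < 1" shows "rho t * h t = - ln t / lam"
proof -
  have l: "0 < - ln t" using assms by simp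
  have "rho t * h t = ((- ln t) powr (1 / \<alpha>) / t powr (1 / \<alpha>)) * (t powr (1 / \<alpha>) * (- ln t) powr (1 - 1 / \<alpha>)) / lam"
    unfolding rho_def h_def using l assms by (subst powr_divide) auto
  also have "\<dots> = ((- ln t) powr (1 / \<alpha>) * (- ln t) powr (1 - 1 / \<alpha>)) / lam"
    using assms by simp
  also have "(- ln t) powr (1 / \<alpha>) * (- ln t) powr (1 - 1 / \<alpha>) = - ln t"
    using l by (subst powr_add[symmetric]) simp
  finally show ?thesis .
qed

text \<open>Measures the cost of the tilt q * \<open>rho\<close> t in units of |ln t|, so that every
  later exponential bound is a power of t.\<close>

lemma t_psi_rho:
  assumes q: "0 < q"
  shows "((\<lambda>t. t * \<psi> (q * rho t) / (- ln t)) \<longlongrightarrow> q powr \<alpha> / \<alpha>) (at_right 0)"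
proof -
  have "filterlim (\<lambda>t. q * rho t) at_top (at_right 0)"
    by (rule filterlim_tendsto_pos_mult_at_top[OF tendsto_const q rho_at_top])
  from filterlim_compose[OF \<psi>_asymp this]
  have "((\<lambda>t. \<psi> (q * rho t) / (q * rho t) powr \<alpha> * (q powr \<alpha> / lam powr \<alpha>)) \<longlongrightarrow> C * (q powr \<alpha> / lam powr \<alpha>)) (at_right 0)"
    by (intro tendsto_intros)
  moreover have "C * (q powr \<alpha> / lam powr \<alpha>) = q powr \<alpha> / \<alpha>"
    unfolding lam_powr using C by simp
  moreover have "\<forall>\<^sub>F t in at_right 0. \<psi> (q * rho t) / (q * rho t) powr \<alpha> * (q powr \<alpha> / lam powr \<alpha>) = t * \<psi> (q * rho t) / (- ln t)"
    using small_pos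
  proof eventually_elim
    case (elim t)
    then have l: "0 < - ln t" "0 < t" by auto
    have "(q * rho t) powr \<alpha> = q powr \<alpha> * ((- ln t / t) / lam powr \<alpha>)"
      unfolding rho_def using q l lam_pos \<alpha> by (simp add: powr_mult powr_divide powr_powr)
    moreover have "P / (Q * ((l / t) / L)) * (Q / L) = t * P / l" if "0 < Q" "0 < L" "0 < l" "0 < t" for P Q L l t :: real
      using that by (simp add: field_simps)
    ultimately show ?case using l q lam_pos by simp
  qed
  ultimately show ?thesis by (auto elim: Lim_transform_eventually)
qed

text \<open>By convexity exp u \<le> (1 - 1 / \<rho>) + exp (\<rho> u) / \<rho>. The gain of 1 /
  \<rho> over the plain exponential bound is essential: at \<rho> = \<open>rho\<close> t it supplies
  the power t^(1/\<alpha>).\<close>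

lemma H_exp_bound:
  assumes s: "0 \<le> s" and \<rho>: "1 \<le> \<rho>"
  shows "H s y \<le> exp (\<rho> * (y + \<gamma> * s) + s * \<psi> \<rho>) / \<rho>"
proof -
  have i: "integrable (A s) (\<lambda>x. exp (\<rho> * x))" "(\<integral>x. exp (\<rho> * x) \<partial>A s) = exp (s * \<psi> \<rho>)"
    using A_exp[OF s, of \<rho>] \<rho> by auto
  have "H s y \<le> (\<integral>z. exp (\<rho> * (y + \<gamma> * s)) / \<rho> * exp (\<rho> * z) \<partial>A s)"
    unfolding H_def
  proof (rule integral_mono[OF H_integrable[OF s]])
    show "integrable (A s) (\<lambda>z. exp (\<rho> * (y + \<gamma> * s)) / \<rho> * exp (\<rho> * z))" using i by simp
    fix z
    define u where "u = y + z + \<gamma> * s"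
    have "exp u \<le> (1 - 1 / \<rho>) + exp (\<rho> * u) / \<rho>"
      using convex_onD[OF exp_convex, of "1 / \<rho>" 0 "\<rho> * u"] \<rho> by simp
    moreover have "0 \<le> 1 / \<rho>" using \<rho> by simp
    ultimately have 1: "exp u - 1 \<le> exp (\<rho> * u) / \<rho>" by linarith
    have g: "exp (- \<gamma> * s) \<le> 1" using \<gamma>_pos s by simp
    have "exp (y + z) - exp (- \<gamma> * s) = exp (- \<gamma> * s) * (exp u - 1)"
      by (simp add: u_def right_diff_distrib exp_add[symmetric])
    also have "\<dots> \<le> exp (- \<gamma> * s) * (exp (\<rho> * u) / \<rho>)" by (rule mult_left_mono[OF 1]) simp
    also have "\<dots> \<le> 1 * (exp (\<rho> * u) / \<rho>)" by (rule mult_right_mono[OF g]) (use \<rho> in simp)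
    also have "exp (\<rho> * u) = exp (\<rho> * (y + \<gamma> * s)) * exp (\<rho> * z)"
      by (simp add: u_def exp_add[symmetric] algebra_simps)
    finally show "max 0 (exp (y + z) - exp (- \<gamma> * s)) \<le> exp (\<rho> * (y + \<gamma> * s)) / \<rho> * exp (\<rho> * z)"
      using \<rho> by simp
  qed auto
  also have "\<dots> = exp (\<rho> * (y + \<gamma> * s) + s * \<psi> \<rho>) / \<rho>" by (simp add: i exp_add)
  finally show ?thesis .
qed

lemma H_small:
  assumes lv: "lam < lv"
  obtains \<epsilon> where "0 < \<epsilon>" "\<epsilon> \<le> 1"
    "\<And>c. 0 < c \<Longrightarrow> \<forall>\<^sub>F t in at_right 0. \<forall>s. 0 \<le> s \<and> s \<le> (1 + \<epsilon>) * t \<longrightarrow> H s (- lv * h t) \<le> c * t"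
proof -
  define g where "g = lv / lam - 1"
  have g: "0 < g" using lv lam_pos by (simp add: g_def)
  \<comment> \<open>Half of the relative distance of lv above lam is spent on the longer maturities
    up to (1 + \<epsilon>) t; the rest keeps the exponent below -g / 4.\<close>
  define \<epsilon> where "\<epsilon> = min 1 (g / 2)"
  have \<epsilon>: "0 < \<epsilon>" "\<epsilon> \<le> 1" "\<epsilon> \<le> g / 2" using g by (auto simp: \<epsilon>_def)
  show ?thesis
  proof (rule that[OF \<epsilon>(1,2)])
    fix c :: real assume c: "0 < c"
    \<comment> \<open>The bound will read t * exp (|ln t| * \<open>?e\<close> t) up to a constant.
      The terms come from the distance lv * h, the Laplace exponent, the factor 1 /
      \<open>rho\<close> t and the factor t taken out; the limit is -g + \<epsilon> /
      \<alpha>.\<close>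
    let ?e = "\<lambda>t. - lv / lam + (1 + \<epsilon>) * (t * \<psi> (1 * rho t) / (- ln t)) - 1 / \<alpha> + 1"
    have "(?e \<longlongrightarrow> - lv / lam + (1 + \<epsilon>) * (1 powr \<alpha> / \<alpha>) - 1 / \<alpha> + 1) (at_right 0)"
      by (intro tendsto_intros t_psi_rho) simp
    moreover have "- lv / lam + (1 + \<epsilon>) * (1 powr \<alpha> / \<alpha>) - 1 / \<alpha> + 1 < - g / 4"
    proof -
      have "- lv / lam + (1 + \<epsilon>) * (1 powr \<alpha> / \<alpha>) - 1 / \<alpha> + 1 = - g + \<epsilon> / \<alpha>"
        using \<alpha> by (simp add: g_def field_simps)
      also have "\<epsilon> / \<alpha> \<le> \<epsilon>" using \<alpha> \<epsilon> by (simp add: field_simps)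
      finally show ?thesis using \<epsilon> g by linarith
    qed
    ultimately have e1: "\<forall>\<^sub>F t in at_right 0. ?e t < - g / 4" by (rule order_tendstoD(2))
    have e2: "\<forall>\<^sub>F t in at_right 0. 1 \<le> rho t"
      using rho_at_top by (simp add: filterlim_at_top)
    have e3: "\<forall>\<^sub>F t in at_right 0. t * rho t < 1 / (2 * \<gamma> + 1)"
      by (rule order_tendstoD(2)[OF t_rho]) (use \<gamma>_pos in simp)
    have e4: "\<forall>\<^sub>F t::real in at_right 0. 1 \<le> - ln t" by (rule ell_at_top[unfolded filterlim_at_top, rule_format])
    have e5: "\<forall>\<^sub>F t in at_right 0. exp 1 * lam * exp (- ln t * (- g / 4)) < c"
    proof -
      have "((\<lambda>t. exp 1 * lam * exp (- ln t * (- g / 4))) \<longlongrightarrow> 0) (at_right 0)" using g by real_asymp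
      then show ?thesis by (rule order_tendstoD(2)) (rule c)
    qed
    show "\<forall>\<^sub>F t in at_right 0. \<forall>s. 0 \<le> s \<and> s \<le> (1 + \<epsilon>) * t \<longrightarrow> H s (- lv * h t) \<le> c * t"
      using small_pos e1 e2 e3 e4 e5
    proof eventually_elim
      case (elim t)
      define l where "l = - ln t"
      have t: "0 < t" "t < 1" and l: "1 \<le> l" using elim by (auto simp: l_def)
      show ?case
      proof (intro allI impI)
        fix s assume s: "0 \<le> s \<and> s \<le> (1 + \<epsilon>) * t"
        have s2: "s \<le> 2 * t" using s \<epsilon> t mult_right_mono[of "1 + \<epsilon>" 2 t] by linarith
        have p0: "0 \<le> \<psi> (rho t)" using \<psi>_nonneg elim by auto
        have "rho t * (\<gamma> * s) \<le> rho t * (\<gamma> * (2 * t))"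
          using s2 \<gamma>_pos elim by (intro mult_left_mono) auto
        also have "\<dots> = (2 * \<gamma>) * (t * rho t)" by simp
        also have "\<dots> \<le> (2 * \<gamma>) * (1 / (2 * \<gamma> + 1))" using elim \<gamma>_pos by (intro mult_left_mono) auto
        also have "\<dots> \<le> 1" using \<gamma>_pos by simp
        finally have 1: "rho t * (\<gamma> * s) \<le> 1" .
        have "s * \<psi> (rho t) \<le> (1 + \<epsilon>) * t * \<psi> (rho t)" using s p0 by (intro mult_right_mono) auto
        also have "\<dots> = l * ((1 + \<epsilon>) * (t * \<psi> (1 * rho t) / (- ln t)))" using l by (simp add: l_def)
        finally have 2: "s * \<psi> (rho t) \<le> l * ((1 + \<epsilon>) * (t * \<psi> (1 * rho t) / (- ln t)))" .
        have 3: "rho t * (- lv * h t) = l * (- lv / lam)" using rho_h[OF t] by (simp add: l_def mult.left_commute[of "rho t"])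
        have 4: "1 / rho t \<le> lam * exp (l * (- 1 / \<alpha>))"
        proof -
          have "(l / t) powr (1 / \<alpha>) \<ge> (1 / t) powr (1 / \<alpha>)"
            using l t \<alpha> by (intro powr_mono2) (auto simp: divide_right_mono)
          moreover have "(1 / t) powr (1 / \<alpha>) = exp (l * (1 / \<alpha>))" using t by (simp add: powr_def l_def ln_div)
          ultimately have "exp (l * (1 / \<alpha>)) / lam \<le> rho t"
            using lam_pos unfolding rho_def l_def by (simp add: divide_right_mono)
          moreover have "0 < exp (l * (1 / \<alpha>)) / lam" using lam_pos by simp
          ultimately have "1 / rho t \<le> 1 / (exp (l * (1 / \<alpha>)) / lam)" by (intro frac_le order_refl) simp_all
          also have "\<dots> = lam * exp (l * (- 1 / \<alpha>))" by (simp add: exp_minus field_simps)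
          finally show ?thesis .
        qed
        have "H s (- lv * h t) \<le> exp (rho t * (- lv * h t + \<gamma> * s) + s * \<psi> (rho t)) / rho t"
          by (rule H_exp_bound) (use s elim in auto)
        also have "\<dots> \<le> exp (l * (- lv / lam) + 1 + l * ((1 + \<epsilon>) * (t * \<psi> (1 * rho t) / (- ln t)))) * (1 / rho t)"
        proof -
          have "rho t * (- lv * h t + \<gamma> * s) + s * \<psi> (rho t) \<le> l * (- lv / lam) + 1 + l * ((1 + \<epsilon>) * (t * \<psi> (1 * rho t) / (- ln t)))"
            using 1 2 3 unfolding distrib_left[of "rho t"] by linarith
          then show ?thesis using elim by (simp add: divide_right_mono)
        qed
        also have "\<dots> \<le> exp (l * (- lv / lam) + 1 + l * ((1 + \<epsilon>) * (t * \<psi> (1 * rho t) / (- ln t)))) * (lam * exp (l * (- 1 / \<alpha>)))"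
          by (rule mult_left_mono[OF 4]) simp
        also have "\<dots> = exp 1 * lam * exp (l * ?e t) * exp (- l)"
          by (simp add: exp_add[symmetric] algebra_simps)
        also have "\<dots> \<le> exp 1 * lam * exp (l * (- g / 4)) * exp (- l)"
        proof -
          have "l * ?e t \<le> l * (- g / 4)" using l by (intro mult_left_mono[OF less_imp_le[OF elim(2)]]) simp
          then have "exp (l * ?e t) \<le> exp (l * (- g / 4))" by (simp only: exp_le_cancel_iff)
          then show ?thesis using lam_pos by (intro mult_right_mono mult_left_mono) simp_all
        qed
        also have "\<dots> \<le> c * exp (- l)" using elim by (intro mult_right_mono) (auto simp: l_def)
        also have "exp (- l) = t" using t by (simp add: l_def)
        finally show "H s (- lv * h t) \<le> c * t" .
      qed
    qed
  qed
qed

text \<open>Tilt \<open>A t\<close> by \<open>exp (q * rho t * x)\<close>. The tilted mean is close to \<open>lam * q powr (\<alpha> - 1) * h t\<close>, which exceeds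
  \<open>lv * h t\<close> for \<open>q\<close> near 1. Undoing the tilt bounds the call from below by \<open>t powr (1 - \<zeta>)\<close> up to logarithms.\<close>

lemma call_lower:
  assumes lv: "0 < lv" "lv < lam" and c: "0 < c"
  shows "\<forall>\<^sub>F t in at_right 0. c * t \<le> (\<integral>z. max 0 (z - lv * h t) \<partial>A t)"
proof -
  \<comment> \<open>q is taken strictly below 1 but with the tilted centre still above lv. The room
    1 - q^\<alpha> pays for undoing the tilt.\<close>
  have lim1: "((\<lambda>q. lam * q powr (\<alpha> - 1)) \<longlongrightarrow> lam * 1 powr (\<alpha> - 1)) (at_left 1)"
    by (intro tendsto_intros) auto
  then have "\<forall>\<^sub>F q in at_left 1. lv < lam * q powr (\<alpha> - 1)"
    by (rule order_tendstoD(1)) (use lv in simp)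
  moreover have "\<forall>\<^sub>F q::real in at_left 1. q \<in> {0<..<1}"
    by (rule eventually_at_left_real) simp
  ultimately have "\<forall>\<^sub>F q in at_left 1. lv < lam * q powr (\<alpha> - 1) \<and> q \<in> {0<..<1}"
    by (rule eventually_conj)
  then obtain q where q: "lv < lam * q powr (\<alpha> - 1)" "0 < q" "q < 1"
    using eventually_happens[of _ "at_left (1::real)"] by (auto simp: trivial_limit_at_left_real)
  define Q where "Q = q powr \<alpha>"
  have Qq: "q * q powr (\<alpha> - 1) = Q" unfolding Q_def using q powr_add[of q 1 "\<alpha> - 1"] by simp
  have Q1: "0 < Q" "Q < 1" using q \<alpha> powr_less_mono2[of \<alpha> q 1] by (auto simp: Q_def)
  \<comment> \<open>Heuristic centre of the tilted law in units of h: t times the derivative of C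
    \<rho>^\<alpha> at q * \<open>rho\<close> t. Below, z1 lies between lv and zc, and z2 above
    zc.\<close>
  define zc where "zc = lam * q powr (\<alpha> - 1)"
  have qzc: "q * zc / lam = Q" using lam_pos Qq by (simp add: zc_def field_simps)
  define z1 where "z1 = (lv + zc) / 2"
  have z1: "lv < z1" "z1 < zc" using q by (auto simp: z1_def zc_def)
  \<comment> \<open>Half of the available exponent (1 - 1 / \<alpha>)(1 - Q). Placing z2 so that q *
    z2 / lam = Q + \<zeta> uses one half and leaves \<zeta> in \<open>fin\<close>.\<close>
  define \<zeta> where "\<zeta> = (1 - 1 / \<alpha>) * (1 - Q) / 2"
  have \<zeta>: "0 < \<zeta>" using Q1 \<alpha> by (auto simp: \<zeta>_def)
  define z2 where "z2 = zc + \<zeta> * lam / q"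
  have z2: "zc < z2" using \<zeta> lam_pos q by (simp add: z2_def)
  have qz2: "q * z2 / lam = Q + \<zeta>" using lam_pos q qzc by (simp add: z2_def field_simps)
  have fin: "Q / \<alpha> - q * z2 / lam + 1 - 1 / \<alpha> = \<zeta>"
    unfolding qz2 using \<alpha> by (simp add: \<zeta>_def field_simps)
  have qz1: "q * z1 / lam < Q" unfolding qzc[symmetric] using z1 q lam_pos by (simp add: divide_strict_right_mono)
  \<comment> \<open>Limiting exponents of the Chernoff bounds for the tilted law above z2 and below
    z1, with an additional tilt of relative size e. Both equal Q / \<alpha>, the exponent of the
    total tilted mass, at e = 0, and both have negative slope there, so a small e makes the tails
    negligible.\<close>
  let ?gp = "\<lambda>e. Q * (1 + e) powr \<alpha> / \<alpha> - e * (Q + \<zeta>)"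
  let ?gm = "\<lambda>e. Q * (1 - e) powr \<alpha> / \<alpha> + e * (q * z1 / lam)"
  have "DERIV ?gp 0 :> - \<zeta>" using \<alpha> by (auto intro!: derivative_eq_intros simp: powr_diff)
  from DERIV_neg_dec_right[OF this] \<zeta> obtain d1 where d1: "0 < d1" "\<And>e. 0 < e \<Longrightarrow> e < d1 \<Longrightarrow> ?gp (0 + e) < ?gp 0" by auto
  have "DERIV ?gm 0 :> q * z1 / lam - Q" using \<alpha> lam_pos by (auto intro!: derivative_eq_intros simp: powr_diff)
  from DERIV_neg_dec_right[OF this] qz1 obtain d2 where d2: "0 < d2" "\<And>e. 0 < e \<Longrightarrow> e < d2 \<Longrightarrow> ?gm (0 + e) < ?gm 0" by auto
  define e where "e = min (1/2) (min d1 d2 / 2)"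
  have e: "0 < e" "e < 1" using d1(1) d2(1) by (auto simp: e_def)
  have gp: "?gp e < Q / \<alpha>" using d1(2)[of e] d1(1) d2(1) e by (simp add: e_def min_def split: if_splits)
  have gm: "?gm e < Q / \<alpha>" using d2(2)[of e] d1(1) d2(1) e by (simp add: e_def min_def split: if_splits)
  define \<rho> where "\<rho> t = q * rho t" for t
  define a where "a t = t * \<psi> (\<rho> t) / (- ln t)" for t
  define ap where "ap t = t * \<psi> ((1 + e) * \<rho> t) / (- ln t)" for t
  define am where "am t = t * \<psi> ((1 - e) * \<rho> t) / (- ln t)" for t
  have la: "(a \<longlongrightarrow> Q / \<alpha>) (at_right 0)"
    unfolding a_def[abs_def] \<rho>_def Q_def by (rule t_psi_rho[OF q(2)])
  have lap: "(ap \<longlongrightarrow> Q * (1 + e) powr \<alpha> / \<alpha>) (at_right 0)"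
    using t_psi_rho[of "(1 + e) * q"] q e unfolding ap_def[abs_def] \<rho>_def Q_def by (simp add: powr_mult mult_ac)
  have lam': "(am \<longlongrightarrow> Q * (1 - e) powr \<alpha> / \<alpha>) (at_right 0)"
    using t_psi_rho[of "(1 - e) * q"] q e unfolding am_def[abs_def] \<rho>_def Q_def by (simp add: powr_mult mult_ac)
  \<comment> \<open>Half of the smaller gain, which leaves room for passing from limits to actual
    values: eventually each tail is at most t^gap times the tilted mass.\<close>
  define gap where "gap = min (Q / \<alpha> - ?gp e) (Q / \<alpha> - ?gm e) / 2"
  have gap: "0 < gap" using gp gm by (simp add: gap_def)
  have gap2: "gap < Q / \<alpha> - ?gp e" "gap < Q / \<alpha> - ?gm e" 
  proof -
    have "min x y / 2 < x \<and> min x y / 2 < y" if "0 < x" "0 < y" for x y :: real using that by (auto simp: min_def)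
    from this[of "Q / \<alpha> - ?gp e" "Q / \<alpha> - ?gm e"] gp gm
    show "gap < Q / \<alpha> - ?gp e" "gap < Q / \<alpha> - ?gm e" unfolding gap_def by (simp_all only: diff_gt_0_iff_gt)
  qed
  have "((\<lambda>t. ap t - e * (Q + \<zeta>) - a t) \<longlongrightarrow> Q * (1 + e) powr \<alpha> / \<alpha> - e * (Q + \<zeta>) - Q / \<alpha>) (at_right 0)"
    by (intro tendsto_intros lap la)
  then have e1: "\<forall>\<^sub>F t in at_right 0. ap t - e * (Q + \<zeta>) - a t < - gap"
    by (rule order_tendstoD(2)) (use gap2 in linarith)
  have "((\<lambda>t. am t + e * (q * z1 / lam) - a t) \<longlongrightarrow> Q * (1 - e) powr \<alpha> / \<alpha> + e * (q * z1 / lam) - Q / \<alpha>) (at_right 0)"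
    by (intro tendsto_intros lam' la)
  then have e2: "\<forall>\<^sub>F t in at_right 0. am t + e * (q * z1 / lam) - a t < - gap"
    by (rule order_tendstoD(2)) (use gap2 in linarith)
  have "((\<lambda>t. a t - (Q + \<zeta>) + 1 - 1 / \<alpha>) \<longlongrightarrow> Q / \<alpha> - (Q + \<zeta>) + 1 - 1 / \<alpha>) (at_right 0)"
    by (intro tendsto_intros la)
  then have e3: "\<forall>\<^sub>F t in at_right 0. \<zeta> / 2 < a t - (Q + \<zeta>) + 1 - 1 / \<alpha>"
    by (rule order_tendstoD(1)) (use fin \<zeta> qz2 in linarith)
  have e4: "\<forall>\<^sub>F t in at_right 0. exp (- ln t * - gap) < 1 / 4"
  proof -
    have "((\<lambda>t. exp (- ln t * - gap)) \<longlongrightarrow> 0) (at_right 0)" using gap by real_asymp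
    then show ?thesis by (rule order_tendstoD(2)) simp
  qed
  have e5: "\<forall>\<^sub>F t in at_right 0. c < (z1 - lv) / 2 * exp (- ln t * (\<zeta> / 2))"
  proof -
    have "filterlim (\<lambda>t. (z1 - lv) / 2 * exp (- ln t * (\<zeta> / 2))) at_top (at_right 0)" using \<zeta> z1 by real_asymp
    then show ?thesis by (auto simp: filterlim_at_top_dense)
  qed
  have e6: "\<forall>\<^sub>F t::real in at_right 0. 1 \<le> - ln t" by (rule ell_at_top[unfolded filterlim_at_top, rule_format])
  have e7: "\<forall>\<^sub>F t in at_right 0. 0 < rho t" using rho_at_top by (auto simp: filterlim_at_top_dense)
  show ?thesis using small_pos e1 e2 e3 e4 e5 e6 e7
  proof eventually_elim
    case (elim t)
    define l where "l = - ln t"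
    have t: "0 < t" "t < 1" and l: "1 \<le> l" using elim by (auto simp: l_def)
    have t0: "0 \<le> t" using t by simp
    interpret At: real_distribution "A t" by (rule distr_A[OF t0])
    have \<rho>: "0 < \<rho> t" using elim q by (simp add: \<rho>_def)
    have hp: "0 < h t" by (rule h_pos[OF t])
    have \<rho>h: "\<rho> t * h t = q * l / lam" unfolding \<rho>_def mult.assoc rho_h[OF t] by (simp add: l_def)
    define Z1 where "Z1 = z1 * h t"
    define Z2 where "Z2 = z2 * h t"
    have rz1: "\<rho> t * Z1 = l * (q * z1 / lam)"
      using \<rho>h by (simp add: Z1_def mult.left_commute[of "\<rho> t"] mult_ac)
    have rz2: "\<rho> t * Z2 = l * (Q + \<zeta>)"
      unfolding qz2[symmetric] using \<rho>h by (simp add: Z2_def mult.left_commute[of "\<rho> t"] mult_ac)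
    have ea: "t * \<psi> (\<rho> t) = l * a t" "t * \<psi> ((1 + e) * \<rho> t) = l * ap t" "t * \<psi> ((1 - e) * \<rho> t) = l * am t"
      using l by (simp_all add: a_def ap_def am_def l_def)
    let ?w = "(z1 - lv) * h t"
    have w0: "0 \<le> ?w" using z1 hp by simp
    \<comment> \<open>A pointwise minorant of the call made only of exponentials. Between Z1 and Z2
      the call is at least \<open>?w\<close> and exp (\<rho> x) \<le> exp (\<rho> Z2); elsewhere one
      of the subtracted terms exceeds exp (\<rho> x). The tilted measure thus never has to be
      formed.\<close>
    have pw: "?w * (exp (\<rho> t * x) - exp (- e * \<rho> t * Z2) * exp ((1 + e) * \<rho> t * x) - exp (e * \<rho> t * Z1) * exp ((1 - e) * \<rho> t * x))
        \<le> max 0 (x - lv * h t) * exp (\<rho> t * Z2)" for x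
    proof -
      let ?b = "exp (\<rho> t * x) - exp (- e * \<rho> t * Z2) * exp ((1 + e) * \<rho> t * x) - exp (e * \<rho> t * Z1) * exp ((1 - e) * \<rho> t * x)"
      have c2: "exp (- e * \<rho> t * Z2) * exp ((1 + e) * \<rho> t * x) = exp (\<rho> t * x + e * \<rho> t * (x - Z2))"
        by (simp add: exp_add[symmetric] algebra_simps)
      have c1: "exp (e * \<rho> t * Z1) * exp ((1 - e) * \<rho> t * x) = exp (\<rho> t * x + e * \<rho> t * (Z1 - x))"
        by (simp add: exp_add[symmetric] algebra_simps)
      consider "x < Z1" | "Z2 < x" | "Z1 \<le> x" "x \<le> Z2" by linarith
      then show ?thesis
      proof cases
        case 1
        then have "exp (\<rho> t * x) \<le> exp (\<rho> t * x + e * \<rho> t * (Z1 - x))" using e \<rho> by simp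
        then have "?b \<le> 0" unfolding c1 c2 using exp_gt_zero[of "\<rho> t * x + e * \<rho> t * (x - Z2)"] by linarith
        then have "?w * ?b \<le> 0" using w0 by (rule mult_nonneg_nonpos[rotated])
        also have "0 \<le> max 0 (x - lv * h t) * exp (\<rho> t * Z2)" by simp
        finally show ?thesis .
      next
        case 2
        then have "exp (\<rho> t * x) \<le> exp (\<rho> t * x + e * \<rho> t * (x - Z2))" using e \<rho> by simp
        then have "?b \<le> 0" unfolding c1 c2 using exp_gt_zero[of "\<rho> t * x + e * \<rho> t * (Z1 - x)"] by linarith
        then have "?w * ?b \<le> 0" using w0 by (rule mult_nonneg_nonpos[rotated])
        also have "0 \<le> max 0 (x - lv * h t) * exp (\<rho> t * Z2)" by simp
        finally show ?thesis .
      next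
        case 3
        have "?b \<le> exp (\<rho> t * x)" unfolding c1 c2
          using exp_gt_zero[of "\<rho> t * x + e * \<rho> t * (Z1 - x)"] exp_gt_zero[of "\<rho> t * x + e * \<rho> t * (x - Z2)"] by linarith
        also have "\<dots> \<le> exp (\<rho> t * Z2)" using 3 \<rho> by simp
        finally have b: "?b \<le> exp (\<rho> t * Z2)" .
        have "?w \<le> x - lv * h t" using 3 by (simp add: Z1_def algebra_simps)
        then have w: "?w \<le> max 0 (x - lv * h t)" by simp
        have "?w * ?b \<le> ?w * exp (\<rho> t * Z2)" by (rule mult_left_mono[OF b w0])
        also have "\<dots> \<le> max 0 (x - lv * h t) * exp (\<rho> t * Z2)" by (rule mult_right_mono[OF w]) simp
        finally show ?thesis .
      qed
    qed
    have i: "integrable (A t) (\<lambda>x. exp (p * x))" "(\<integral>x. exp (p * x) \<partial>A t) = exp (t * \<psi> p)" if "0 \<le> p" for p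
      using A_exp[OF t0 that] by auto
    have ps: "0 \<le> \<rho> t" "0 \<le> (1 + e) * \<rho> t" "0 \<le> (1 - e) * \<rho> t" using \<rho> e by auto
    have imax: "integrable (A t) (\<lambda>x. max 0 (x - lv * h t))"
    proof (rule Bochner_Integration.integrable_bound[OF i(1)[of 1]])
      show "AE x in A t. norm (max 0 (x - lv * h t)) \<le> norm (exp (1 * x))"
      proof (rule AE_I2)
        fix x
        have "x - lv * h t \<le> exp x" using exp_ge_add_one_self[of x] lv hp mult_pos_pos[of lv "h t"] by linarith
        then show "norm (max 0 (x - lv * h t)) \<le> norm (exp (1 * x))" by simp
      qed
    qed auto
    \<comment> \<open>Each tail removes at most a quarter of the tilted mass, since t^gap <
      1/4.\<close>
    have bracket: "exp (l * a t) / 2 \<le> exp (l * a t) - exp (- e * \<rho> t * Z2) * exp (l * ap t) - exp (e * \<rho> t * Z1) * exp (l * am t)"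
    proof -
      have k: "exp (l * (a t - gap)) \<le> exp (l * a t) / 4"
      proof -
        have "exp (l * (a t - gap)) = exp (l * a t) * exp (- ln t * - gap)" by (simp add: l_def exp_add[symmetric] algebra_simps)
        also have "\<dots> \<le> exp (l * a t) * (1 / 4)" using elim by (intro mult_left_mono) auto
        finally show ?thesis by simp
      qed
      have "exp (- e * \<rho> t * Z2) * exp (l * ap t) = exp (l * (ap t - e * (Q + \<zeta>)))"
      proof -
        have "- e * \<rho> t * Z2 = - (e * (\<rho> t * Z2))" by simp
        then have "- e * \<rho> t * Z2 + l * ap t = l * (ap t - e * (Q + \<zeta>))" unfolding rz2 by (simp add: algebra_simps)
        then show ?thesis unfolding exp_add[symmetric] by (rule arg_cong)
      qed
      also have "\<dots> \<le> exp (l * (a t - gap))" using elim l by simp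
      finally have 1: "exp (- e * \<rho> t * Z2) * exp (l * ap t) \<le> exp (l * a t) / 4" using k by linarith
      have "exp (e * \<rho> t * Z1) * exp (l * am t) = exp (l * (am t + e * (q * z1 / lam)))"
      proof -
        have "e * \<rho> t * Z1 = e * (\<rho> t * Z1)" by simp
        then have "e * \<rho> t * Z1 + l * am t = l * (am t + e * (q * z1 / lam))" unfolding rz1 by (simp add: algebra_simps)
        then show ?thesis unfolding exp_add[symmetric] by (rule arg_cong)
      qed
      also have "\<dots> \<le> exp (l * (a t - gap))" using elim l by simp
      finally have 2: "exp (e * \<rho> t * Z1) * exp (l * am t) \<le> exp (l * a t) / 4" using k by linarith
      from 1 2 show ?thesis by linarith
    qed
    have "?w * (exp (l * a t) / 2) \<le> ?w * (exp (l * a t) - exp (- e * \<rho> t * Z2) * exp (l * ap t) - exp (e * \<rho> t * Z1) * exp (l * am t))"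
      by (rule mult_left_mono[OF bracket w0])
    also have "\<dots> = (\<integral>x. ?w * (exp (\<rho> t * x) - exp (- e * \<rho> t * Z2) * exp ((1 + e) * \<rho> t * x) - exp (e * \<rho> t * Z1) * exp ((1 - e) * \<rho> t * x)) \<partial>A t)"
      using i[OF ps(1)] i[OF ps(2)] i[OF ps(3)] by (simp add: ea)
    also have "\<dots> \<le> (\<integral>x. max 0 (x - lv * h t) * exp (\<rho> t * Z2) \<partial>A t)"
      by (rule integral_mono) (use i[OF ps(1)] i[OF ps(2)] i[OF ps(3)] imax pw in auto)
    also have "\<dots> = (\<integral>x. max 0 (x - lv * h t) \<partial>A t) * exp (\<rho> t * Z2)" by simp
    finally have L: "?w * (exp (l * a t) / 2) * exp (- (\<rho> t * Z2)) \<le> (\<integral>x. max 0 (x - lv * h t) \<partial>A t)"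
      by (simp add: exp_minus divide_simps)
    have hl: "exp (- l / \<alpha>) \<le> h t"
    proof -
      have "t powr (1 / \<alpha>) = exp (- l / \<alpha>)" using t by (simp add: powr_def l_def)
      moreover have "1 \<le> l powr (1 - 1 / \<alpha>)" using l \<alpha> by (intro ge_one_powr_ge_zero) auto
      then have "exp (- l / \<alpha>) * 1 \<le> exp (- l / \<alpha>) * l powr (1 - 1 / \<alpha>)" by (rule mult_left_mono) simp
      ultimately show ?thesis by (simp add: h_def l_def)
    qed
    have "c * t \<le> (z1 - lv) / 2 * exp (l * (\<zeta> / 2)) * exp (- l)"
    proof -
      have "exp (- l) = t" using t by (simp add: l_def)
      then show ?thesis using elim t by (auto simp: l_def intro!: mult_right_mono)
    qed
    also have "\<dots> \<le> (z1 - lv) / 2 * exp (l * (a t - (Q + \<zeta>) + 1 - 1 / \<alpha>)) * exp (- l)"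
      using elim l z1 by (intro mult_right_mono mult_left_mono) auto
    also have "\<dots> = (z1 - lv) * exp (- l / \<alpha>) * (exp (l * a t) / 2) * exp (- (\<rho> t * Z2))"
    proof -
      have "exp (l * (a t - (Q + \<zeta>) + 1 - 1 / \<alpha>)) * exp (- l) = exp (- l / \<alpha>) * exp (l * a t) * exp (- (l * (Q + \<zeta>)))"
        unfolding exp_add[symmetric] by (rule arg_cong[where f=exp]) (simp add: algebra_simps)
      then show ?thesis unfolding rz2 by (simp only: mult.assoc)
    qed
    also have "\<dots> \<le> ?w * (exp (l * a t) / 2) * exp (- (\<rho> t * Z2))"
      using hl z1 by (intro mult_right_mono mult_left_mono) auto
    also note L
    finally show ?case .
  qed
qed

end

section \<open>Concentration at scale h and both sides of the threshold\<close>

context put_laws_asymp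
begin

lemma inv_h_at_top: assumes "0 < c" shows "filterlim (\<lambda>t. c / h t) at_top (at_right 0)"
  unfolding h_def using inv\<alpha> assms by real_asymp

lemma h_powr: assumes "0 < t" "t < 1" shows "h t powr \<alpha> = t * (- ln t) powr (\<alpha> - 1)"
proof -
  have l: "0 < - ln t" using assms by simp
  have "(1 - 1 / \<alpha>) * \<alpha> = \<alpha> - 1" using \<alpha> by (simp add: field_simps)
  then show ?thesis unfolding h_def using assms l \<alpha> by (simp add: powr_mult powr_powr)
qed

text \<open>h exceeds the natural scale t^(1/\<alpha>) of the process by a power of |ln t|, so a
  tilt of order 1 / h costs only |ln t|^(1-\<alpha>), which vanishes.\<close>

lemma t_psi_inv_h:
  assumes c: "0 < c" shows "((\<lambda>t. t * \<psi> (c / h t)) \<longlongrightarrow> 0) (at_right 0)"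
proof -
  have "((\<lambda>t. (- ln t) powr (- (\<alpha> - 1))) \<longlongrightarrow> 0) (at_right 0)" using \<alpha> by real_asymp
  then have "((\<lambda>t. \<psi> (c / h t) / (c / h t) powr \<alpha> * (c powr \<alpha> * (- ln t) powr (- (\<alpha> - 1)))) \<longlongrightarrow> C * (c powr \<alpha> * 0)) (at_right 0)"
    by (intro tendsto_intros filterlim_compose[OF \<psi>_asymp inv_h_at_top[OF c]])
  moreover have "\<forall>\<^sub>F t in at_right 0. \<psi> (c / h t) / (c / h t) powr \<alpha> * (c powr \<alpha> * (- ln t) powr (- (\<alpha> - 1))) = t * \<psi> (c / h t)"
    using small_pos
  proof eventually_elim
    case (elim t)
    then have t: "0 < t" "t < 1" and l: "0 < - ln t" by auto
    have "(c / h t) powr \<alpha> = c powr \<alpha> / (t * (- ln t) powr (\<alpha> - 1))"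
      using c h_pos[OF t] by (subst powr_divide) (auto simp: h_powr[OF t])
    moreover have "(- ln t) powr (- (\<alpha> - 1)) = 1 / (- ln t) powr (\<alpha> - 1)" by (rule powr_minus_divide)
    moreover have "0 < (- ln t) powr (\<alpha> - 1)" using l by simp
    moreover have "P / (Q / (t * L)) * (Q * (1 / L)) = t * P" if "0 < Q" "0 < L" for P Q L :: real
      using that t by simp
    ultimately show ?case using c by simp
  qed
  ultimately show ?thesis by (simp add: Lim_transform_eventually)
qed

text \<open>\<open>exp_Markov_inequality\<close> with \<rho> = 2 / (e h): on the event |\<rho> x|
  \<ge> 2, more than required. As \<psi> \<ge> 0 from 1 on, the first moment is at least 1 and the
  bound is governed by \<psi> at 2 \<rho> = (4 / e) / h.\<close>

lemma A_concentration:
  assumes e: "0 < e" and p: "0 < p"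
  shows "\<forall>\<^sub>F t in at_right 0. \<forall>s. 0 \<le> s \<and> s \<le> 2 * t \<longrightarrow> measure (A s) {x. e * h t \<le> \<bar>x\<bar>} \<le> p"
proof -
  have "((\<lambda>t. 4 * (exp (2 * (t * \<psi> ((4 / e) / h t))) - 1)) \<longlongrightarrow> 4 * (exp (2 * 0) - 1)) (at_right 0)"
    by (intro tendsto_intros t_psi_inv_h) (use e in simp)
  then have e1: "\<forall>\<^sub>F t in at_right 0. 4 * (exp (2 * (t * \<psi> ((4 / e) / h t))) - 1) < p"
    by (rule order_tendstoD(2)) (use p in simp)
  have e2: "\<forall>\<^sub>F t in at_right 0. 1 \<le> (2 / e) / h t"
    by (rule inv_h_at_top[unfolded filterlim_at_top, rule_format]) (use e in simp)
  show ?thesis using small_pos e1 e2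
  proof eventually_elim
    case (elim t)
    then have t: "0 < t" "t < 1" by auto
    have hp: "0 < h t" by (rule h_pos[OF t])
    define \<rho> where "\<rho> = (2 / e) / h t"
    have \<rho>: "1 \<le> \<rho>" using elim by (simp add: \<rho>_def)
    have \<rho>2: "2 * \<rho> = (4 / e) / h t" by (simp add: \<rho>_def)
    have p2: "0 \<le> \<psi> (2 * \<rho>)" "0 \<le> \<psi> \<rho>" using \<psi>_nonneg \<rho> by auto
    show ?case
    proof (intro allI impI)
      fix s assume s: "0 \<le> s \<and> s \<le> 2 * t"
      then have s0: "0 \<le> s" by simp
      interpret As: real_distribution "A s" by (rule distr_A[OF s0])
      have i1: "integrable (A s) (\<lambda>x. exp (\<rho> * x))" "(\<integral>x. exp (\<rho> * x) \<partial>A s) = exp (s * \<psi> \<rho>)"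
        using A_exp[OF s0, of \<rho>] \<rho> by auto
      have i2: "integrable (A s) (\<lambda>x. exp (2 * \<rho> * x))" "(\<integral>x. exp (2 * \<rho> * x) \<partial>A s) = exp (s * \<psi> (2 * \<rho>))"
        using A_exp[OF s0, of "2 * \<rho>"] \<rho> by auto
      have "1 \<le> \<bar>\<rho> * x\<bar>" if x: "e * h t \<le> \<bar>x\<bar>" for x
      proof -
        have "\<rho> * (e * h t) \<le> \<rho> * \<bar>x\<bar>" using x \<rho> by (intro mult_left_mono) auto
        moreover have "\<rho> * (e * h t) = 2" using e hp by (simp add: \<rho>_def)
        ultimately show ?thesis using \<rho> by (simp add: abs_mult)
      qed
      then have "measure (A s) {x. e * h t \<le> \<bar>x\<bar>} \<le> measure (A s) {x. 1 \<le> \<bar>\<rho> * x\<bar>}"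
        by (intro As.finite_measure_mono) auto
      also have "\<dots> \<le> 4 * (exp (s * \<psi> (2 * \<rho>)) - 2 * exp (s * \<psi> \<rho>) + 1)"
        using exp_Markov_inequality[OF distr_A[OF s0] i1(1) i2(1)] unfolding i1 i2 .
      also have "\<dots> \<le> 4 * (exp (2 * (t * \<psi> ((4 / e) / h t))) - 1)"
      proof -
        have "s * \<psi> (2 * \<rho>) \<le> 2 * t * \<psi> (2 * \<rho>)" using s p2 by (intro mult_right_mono) auto
        then have "exp (s * \<psi> (2 * \<rho>)) \<le> exp (2 * (t * \<psi> ((4 / e) / h t)))" unfolding \<rho>2 by simp
        moreover have "1 \<le> exp (s * \<psi> \<rho>)" using s0 p2 by simp
        ultimately show ?thesis by argo
      qed
      also have "\<dots> \<le> p" using elim by simp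
      finally show "measure (A s) {x. e * h t \<le> \<bar>x\<bar>} \<le> p" .
    qed
  qed
qed

text \<open>Markov's inequality for exp x - 1, whose mean up to time 2 t is at most 4 \<kappa> t and
  hence o(h).\<close>

lemma J_concentration:
  assumes e: "0 < e" and p: "0 < p"
  shows "\<forall>\<^sub>F t in at_right 0. \<forall>s. 0 \<le> s \<and> s \<le> 2 * t \<longrightarrow> measure (J s) {x. e * h t \<le> x} \<le> p"
proof -
  have "((\<lambda>t. (4 * \<kappa> / e) * (t / h t)) \<longlongrightarrow> (4 * \<kappa> / e) * 0) (at_right 0)"
    by (intro tendsto_intros t_over_h)
  then have e1: "\<forall>\<^sub>F t in at_right 0. (4 * \<kappa> / e) * (t / h t) < p"
    by (rule order_tendstoD(2)) (use p in simp)
  have "((\<lambda>t. 2 * t * \<kappa>) \<longlongrightarrow> 2 * 0 * \<kappa>) (at_right 0)" by (intro tendsto_intros)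
  then have e2: "\<forall>\<^sub>F t in at_right 0. 2 * t * \<kappa> < 1" by (rule order_tendstoD(2)) simp
  show ?thesis using small_pos e1 e2
  proof eventually_elim
    case (elim t)
    then have t: "0 < t" "t < 1" by auto
    have hp: "0 < h t" by (rule h_pos[OF t])
    have eh: "0 < e * h t" using e hp by simp
    show ?case
    proof (intro allI impI)
      fix s assume s: "0 \<le> s \<and> s \<le> 2 * t"
      then have s0: "0 \<le> s" by simp
      interpret Js: real_distribution "J s" by (rule distr_J[OF s0])
      have i: "integrable (J s) (\<lambda>x. exp x - 1)" using J_exp[OF s0] by simp
      have "measure (J s) {x. e * h t \<le> x} \<le> measure (J s) {x \<in> space (J s). e * h t \<le> exp x - 1}"
      proof (rule Js.finite_measure_mono)
        have "x \<le> exp x - 1" for x :: real using exp_ge_add_one_self[of x] by linarith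
        then show "{x. e * h t \<le> x} \<subseteq> {x \<in> space (J s). e * h t \<le> exp x - 1}" by (auto intro: order_trans)
      qed simp
      also have "\<dots> \<le> (\<integral>x. exp x - 1 \<partial>J s) / (e * h t)"
        by (rule integral_Markov_inequality_measure[OF i, of "{}"]) (use J_nonneg[OF s0] eh in \<open>auto elim: eventually_mono\<close>)
      also have "(\<integral>x. exp x - 1 \<partial>J s) = (\<integral>x. exp x \<partial>J s) - 1" using J_exp[OF s0] Js.prob_space by simp
      also have "((\<integral>x. exp x \<partial>J s) - 1) / (e * h t) \<le> (4 * \<kappa> * t) / (e * h t)"
      proof (rule divide_right_mono)
        have sk: "s * \<kappa> \<le> 2 * t * \<kappa>" using s \<kappa> by (intro mult_right_mono) auto
        have "(\<integral>x. exp x \<partial>J s) \<le> exp (2 * t * \<kappa>)" using J_exp_le[OF s0] sk order_trans by fastforce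
        also have "\<dots> \<le> 1 + 2 * t * \<kappa> + (2 * t * \<kappa>)\<^sup>2" by (rule exp_bound) (use elim \<kappa> t in auto)
        also have "(2 * t * \<kappa>)\<^sup>2 \<le> 1 * (2 * t * \<kappa>)" unfolding power2_eq_square
          by (rule mult_right_mono) (use elim \<kappa> t in auto)
        finally show "(\<integral>x. exp x \<partial>J s) - 1 \<le> 4 * \<kappa> * t" by (simp add: algebra_simps)
      qed (use eh in simp)
      also have "\<dots> = (4 * \<kappa> / e) * (t / h t)" by simp
      also have "\<dots> \<le> p" using elim by simp
      finally show "measure (J s) {x. e * h t \<le> x} \<le> p" .
    qed
  qed
qed

lemma strip_concentration:
  assumes l: "0 < l3" "l3 < l2" and p: "0 < p"
  shows "\<forall>\<^sub>F t in at_right 0. \<forall>s. 0 \<le> s \<and> s \<le> 2 * t \<longrightarrow>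
    measure (\<mu> s) {x. - l3 * h t + (r - \<delta>) * s + x \<notin> {- l2 * h t..0}} \<le> p"
proof -
  \<comment> \<open>The start -l3 h lies at least 4 e h from both edges of the strip, while the
    drift, the part from A and the part from J move it by at most e h each.\<close>
  define e where "e = min l3 (l2 - l3) / 4"
  have e: "0 < e" "4 * e \<le> l3" "4 * e \<le> l2 - l3" using l by (auto simp: e_def)
  have "((\<lambda>t. (2 * \<gamma>) * (t / h t)) \<longlongrightarrow> (2 * \<gamma>) * 0) (at_right 0)" by (intro tendsto_intros t_over_h)
  then have e3: "\<forall>\<^sub>F t in at_right 0. (2 * \<gamma>) * (t / h t) < e" by (rule order_tendstoD(2)) (use e in simp)
  have p2: "0 < p / 2" using p by simp
  show ?thesis using small_pos e3 A_concentration[OF e(1) p2] J_concentration[OF e(1) p2]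
  proof eventually_elim
    case (elim t)
    then have t: "0 < t" "t < 1" by auto
    have hp: "0 < h t" by (rule h_pos[OF t])
    have gt: "2 * \<gamma> * t < e * h t" using elim hp by (simp add: field_simps)
    show ?case
    proof (intro allI impI)
      fix s assume s: "0 \<le> s \<and> s \<le> 2 * t"
      then have s0: "0 \<le> s" by simp
      have gs: "\<gamma> * s \<le> e * h t" "0 \<le> \<gamma> * s"
      proof -
        have "\<gamma> * s \<le> \<gamma> * (2 * t)" using s \<gamma>_pos by (intro mult_left_mono) auto
        also have "\<dots> = 2 * \<gamma> * t" by simp
        finally show "\<gamma> * s \<le> e * h t" using gt by linarith
        show "0 \<le> \<gamma> * s" using \<gamma>_pos s0 by simp
      qed
      interpret As: real_distribution "A s" by (rule distr_A[OF s0])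
      interpret Js: real_distribution "J s" by (rule distr_J[OF s0])
      interpret Ms: real_distribution "\<mu> s" by (rule distr_\<mu>[OF s0])
      define S where "S = {x. - l3 * h t + (r - \<delta>) * s + x \<notin> {- l2 * h t..0}}"
      have [measurable]: "S \<in> sets borel"
      proof -
        have "S = (\<lambda>x. - l3 * h t + (r - \<delta>) * s + x) -` (- {- l2 * h t..0}) \<inter> space borel" by (auto simp: S_def)
        also have "\<dots> \<in> sets borel" by (rule measurable_sets[of _ borel borel]) auto
        finally show ?thesis .
      qed
      let ?a = "{x. e * h t \<le> \<bar>x\<bar>}" and ?j = "{x. e * h t \<le> x}"
      have "ennreal (measure (\<mu> s) S) = (\<integral>\<^sup>+x. indicator S x \<partial>\<mu> s)"
        by (simp add: Ms.emeasure_eq_measure)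
      also have "\<dots> = (\<integral>\<^sup>+w. \<integral>\<^sup>+z. indicator S (z + w - \<kappa> * s) \<partial>A s \<partial>J s)"
        by (rule nn_integral_\<mu>[OF s0]) simp
      also have "\<dots> \<le> (\<integral>\<^sup>+w. \<integral>\<^sup>+z. indicator ?a z + indicator ?j w \<partial>A s \<partial>J s)"
      proof (rule nn_integral_mono_AE, use J_nonneg[OF s0] in eventually_elim)
        fix w :: real assume w: "0 \<le> w"
        show "(\<integral>\<^sup>+z. indicator S (z + w - \<kappa> * s) \<partial>A s) \<le> (\<integral>\<^sup>+z. indicator ?a z + indicator ?j w \<partial>A s)"
        proof (rule nn_integral_mono)
          fix z
          have "z + w - \<kappa> * s \<notin> S" if a: "\<bar>z\<bar> < e * h t" "w < e * h t"
          proof -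
            have eq: "- l3 * h t + (r - \<delta>) * s + (z + w - \<kappa> * s) = - l3 * h t + \<gamma> * s + z + w"
              by (simp add: \<gamma>_def algebra_simps)
            have "4 * e * h t \<le> l3 * h t" "4 * e * h t \<le> (l2 - l3) * h t" using e hp by (auto intro: mult_right_mono)
            then have "4 * (e * h t) \<le> l3 * h t" "4 * (e * h t) \<le> l2 * h t - l3 * h t" by (simp_all add: algebra_simps)
            then have "- l3 * h t + \<gamma> * s + z + w \<le> 0" "- l2 * h t \<le> - l3 * h t + \<gamma> * s + z + w"
              using gs a w mult_pos_pos[OF e(1) hp] by (auto simp: abs_if split: if_splits)
            then show ?thesis unfolding S_def mem_Collect_eq eq by simp
          qed
          then show "indicator S (z + w - \<kappa> * s) \<le> (indicator ?a z + indicator ?j w :: ennreal)"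
            by (auto split: split_indicator simp: not_le)
        qed
      qed
      also have "\<dots> = emeasure (A s) ?a + emeasure (J s) ?j"
        using As.emeasure_space_1 Js.emeasure_space_1
        by (simp add: nn_integral_add)
      also have "\<dots> = ennreal (measure (A s) ?a + measure (J s) ?j)"
        by (simp add: As.emeasure_eq_measure Js.emeasure_eq_measure)
      finally have "measure (\<mu> s) S \<le> measure (A s) ?a + measure (J s) ?j" by (subst (asm) ennreal_le_iff) auto
      also have "\<dots> \<le> p / 2 + p / 2" using elim s by (intro add_mono) auto
      finally show "measure (\<mu> s) {x. - l3 * h t + (r - \<delta>) * s + x \<notin> {- l2 * h t..0}} \<le> p" unfolding S_def by simp
    qed
  qed
qed

text \<open>The number of dates is n + 1 for mesh t / n because a stopping time up to t, when
  rounded strictly upwards, can land one step after t.\<close>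

lemma premium_eventually_0:
  assumes l2: "lam < l2"
  shows "\<forall>\<^sub>F t in at_right 0. \<exists>n0. \<forall>n\<ge>n0. 0 < n \<longrightarrow> premium (t / real n) (Suc n) (- l2 * h t) = 0"
proof -
  define l3 where "l3 = (lam + l2) / 2"
  have l3: "lam < l3" "l3 < l2" "0 < l3" using l2 lam_pos by (auto simp: l3_def)
  obtain \<epsilon> where \<epsilon>: "0 < \<epsilon>" "\<epsilon> \<le> 1"
    and Hs: "\<And>c. 0 < c \<Longrightarrow> \<forall>\<^sub>F t in at_right 0. \<forall>s. 0 \<le> s \<and> s \<le> (1 + \<epsilon>) * t \<longrightarrow> H s (- l3 * h t) \<le> c * t"
    by (rule H_small[OF l3(1)]) (rule that)
  \<comment> \<open>The constants are balanced over k steps in units of k \<Delta> \<gamma>: the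
    discounted gain is at least 1/2, the loss outside the strip at most 1/8 since
    \<open>loss\<close> \<le> 2 r \<Delta>, and H at most c t \<le> 1/4.\<close>
  define c where "c = \<epsilon> * \<gamma> / 16"
  have c: "0 < c" using \<epsilon> \<gamma>_pos by (simp add: c_def)
  define p where "p = \<gamma> / (16 * r)"
  have p: "0 < p" using \<gamma>_pos r by (simp add: p_def)
  have "((\<lambda>t. r * t) \<longlongrightarrow> r * 0) (at_right 0)" by (intro tendsto_intros)
  then have e1: "\<forall>\<^sub>F t in at_right 0. r * t < 1 / 2" by (rule order_tendstoD(2)) simp
  show ?thesis using small_pos e1 Hs[OF c] strip_concentration[OF l3(3,2) p]
  proof eventually_elim
    case (elim t)
    then have t: "0 < t" "t < 1" by auto
    have hp: "0 < h t" by (rule h_pos[OF t])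
    show ?case
    proof (intro exI allI impI)
      \<comment> \<open>n \<ge> 4 / \<epsilon> keeps the rounding harmless: k = floor (\<epsilon> n
        / 2) is still at least \<epsilon> n / 4, and \<Delta> \<le> \<epsilon> t / 4, so n + 1 + k
        steps end before (1 + \<epsilon>) t.\<close>
      fix n :: nat assume n: "nat \<lceil>4 / \<epsilon>\<rceil> \<le> n" and n0: "0 < n"
      have n4: "4 / \<epsilon> \<le> real n" using n by linarith
      then have ne: "4 \<le> \<epsilon> * real n" using \<epsilon> by (simp add: field_simps)
      define \<Delta> where "\<Delta> = t / real n"
      have \<Delta>: "0 < \<Delta>" using t n0 by (simp add: \<Delta>_def)
      have n\<Delta>: "real n * \<Delta> = t" using n0 by (simp add: \<Delta>_def)
      define k where "k = nat \<lfloor>\<epsilon> * real n / 2\<rfloor>"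
      have k: "real k \<le> \<epsilon> * real n / 2" "\<epsilon> * real n / 2 - 1 \<le> real k"
      proof -
        have "real k = of_int \<lfloor>\<epsilon> * real n / 2\<rfloor>" using \<epsilon> by (simp add: k_def)
        then show "real k \<le> \<epsilon> * real n / 2" "\<epsilon> * real n / 2 - 1 \<le> real k"
          using floor_correct[of "\<epsilon> * real n / 2"] by linarith+
      qed
      have k4: "\<epsilon> * real n / 4 \<le> real k" using k ne by linarith
      have \<epsilon>t: "0 < \<epsilon> * t" "\<epsilon> * t \<le> t" using \<epsilon> t by auto
      have kl: "\<epsilon> * t / 4 \<le> real k * \<Delta>"
      proof -
        have "\<epsilon> * real n / 4 * \<Delta> \<le> real k * \<Delta>" using k4 \<Delta> by (intro mult_right_mono) auto
        then show ?thesis unfolding n\<Delta>[symmetric] by (simp add: mult_ac)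
      qed
      have ku: "real k * \<Delta> \<le> \<epsilon> * t / 2"
      proof -
        have "real k * \<Delta> \<le> \<epsilon> * real n / 2 * \<Delta>" using k \<Delta> by (intro mult_right_mono) auto
        then show ?thesis unfolding n\<Delta>[symmetric] by (simp add: mult_ac)
      qed
      have \<Delta>u: "\<Delta> \<le> \<epsilon> * t / 4"
      proof -
        have "4 * \<Delta> \<le> \<epsilon> * real n * \<Delta>" using ne \<Delta> by (intro mult_right_mono) auto
        then show ?thesis unfolding n\<Delta>[symmetric] by (simp add: mult_ac)
      qed
      show "premium (t / real n) (Suc n) (- l2 * h t) = 0"
        unfolding \<Delta>_def[symmetric]
      proof (rule premium_eq_0I[OF \<Delta>])
        show "- l3 * h t \<in> {- l2 * h t..0}" using l3 hp by simp
        show "measure (\<mu> (real j * \<Delta>)) {x. - l3 * h t + (r - \<delta>) * (real j * \<Delta>) + x \<notin> {- l2 * h t..0}} \<le> p"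
          if "0 < j" "j < k" for j
        proof -
          have "real j * \<Delta> \<le> real k * \<Delta>" using that \<Delta> by (intro mult_right_mono) auto
          then have "real j * \<Delta> \<le> 2 * t" using ku \<epsilon>t t by linarith
          then show ?thesis using elim \<Delta> by simp
        qed
        show "0 \<le> p" using p by simp
        have s1: "real (Suc n + k) * \<Delta> \<le> (1 + \<epsilon>) * t"
        proof -
          have "real (Suc n + k) * \<Delta> = t + \<Delta> + real k * \<Delta>" using n\<Delta> by (simp add: distrib_right)
          then show ?thesis using \<Delta>u ku \<epsilon>t unfolding distrib_right by linarith
        qed
        then have H1: "H (real (Suc n + k) * \<Delta>) (- l3 * h t) \<le> c * t" using elim \<Delta> by simp
        have sl: "exp (- r * \<Delta>) * (\<gamma> * \<Delta>) \<le> slack \<Delta>"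
        proof -
          have "exp (- dk * \<Delta>) = exp (- r * \<Delta>) * exp (\<gamma> * \<Delta>)"
            unfolding exp_add[symmetric] by (rule arg_cong[where f=exp]) (simp add: dk_def[OF \<Delta>] \<gamma>_def algebra_simps)
          then have "slack \<Delta> = exp (- r * \<Delta>) * (exp (\<gamma> * \<Delta>) - 1)"
            unfolding slack_def[OF \<Delta>] by (simp add: algebra_simps)
          moreover have "\<gamma> * \<Delta> \<le> exp (\<gamma> * \<Delta>) - 1" using exp_ge_add_one_self[of "\<gamma> * \<Delta>"] by linarith
          ultimately show ?thesis by simp
        qed
        have lo: "loss \<Delta> \<le> 2 * r * \<Delta>"
        proof -
          have "1 + - r * \<Delta> \<le> exp (- r * \<Delta>)" by (rule exp_ge_add_one_self)
          moreover have "exp (- dk * \<Delta>) \<le> 1" using \<kappa> \<delta> \<Delta> by (simp add: dk_def[OF \<Delta>] mult_nonpos_nonneg)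
          ultimately show ?thesis unfolding loss_def[OF \<Delta>] slack_def[OF \<Delta>] by linarith
        qed
        have "1 / 2 \<le> exp (- r * (real k * \<Delta>)) * exp (- r * \<Delta>)"
        proof -
          have "r * (real k * \<Delta> + \<Delta>) \<le> r * t" using r ku \<Delta>u \<epsilon>t by (intro mult_left_mono) auto
          then have "1 / 2 \<le> 1 + - r * (real k * \<Delta> + \<Delta>)" using elim by simp
          also have "\<dots> \<le> exp (- r * (real k * \<Delta> + \<Delta>))" by (rule exp_ge_add_one_self)
          also have "\<dots> = exp (- r * (real k * \<Delta>)) * exp (- r * \<Delta>)" by (simp add: exp_add[symmetric] algebra_simps)
          finally show ?thesis .
        qed
        then have "1 / 2 * (real k * \<Delta> * \<gamma>) \<le> exp (- r * (real k * \<Delta>)) * exp (- r * \<Delta>) * (real k * \<Delta> * \<gamma>)"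
          using \<Delta> \<gamma>_pos by (intro mult_right_mono) auto
        also have "\<dots> = exp (- r * (real k * \<Delta>)) * (real k * (exp (- r * \<Delta>) * (\<gamma> * \<Delta>)))" by (simp add: mult_ac)
        also have "\<dots> \<le> exp (- r * (real k * \<Delta>)) * (real k * slack \<Delta>)"
          using sl by (intro mult_left_mono) auto
        finally have 1: "1 / 2 * (real k * \<Delta> * \<gamma>) \<le> exp (- r * (real k * \<Delta>)) * (real k * slack \<Delta>)" .
        have "loss \<Delta> * (real k * p) \<le> 2 * r * \<Delta> * (real k * p)" using lo p by (intro mult_right_mono) auto
        also have "\<dots> = 1 / 8 * (real k * \<Delta> * \<gamma>)" using r by (simp add: p_def)
        finally have 2: "loss \<Delta> * (real k * p) \<le> 1 / 8 * (real k * \<Delta> * \<gamma>)" .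
        have "\<epsilon> * t / 4 * \<gamma> \<le> real k * \<Delta> * \<gamma>" using kl \<gamma>_pos by (intro mult_right_mono) auto
        then have 3: "4 * (c * t) \<le> real k * \<Delta> * \<gamma>" by (simp add: c_def mult_ac)
        have 4: "0 < c * t" using c t by simp
        show "H (real (Suc n + k) * \<Delta>) (- l3 * h t) < exp (- r * (real k * \<Delta>)) * (real k * slack \<Delta>) - loss \<Delta> * (real k * p)"
          using H1 1 2 3 4 by argo
      qed
    qed
  qed
qed

lemma bermudan_eventually_payoff:
  assumes l2: "lam < l2"
  shows "\<forall>\<^sub>F t in at_right 0. \<exists>n0. \<forall>n\<ge>n0. 0 < n \<longrightarrow> (\<forall>y\<le>- l2 * h t. bermudan (t / real n) (Suc n) y \<le> 1 - exp y)"
  using small_pos premium_eventually_0[OF l2]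
proof eventually_elim
  case (elim t)
  then obtain n0 where n0: "\<And>n. n0 \<le> n \<Longrightarrow> 0 < n \<Longrightarrow> premium (t / real n) (Suc n) (- l2 * h t) = 0" by blast
  show ?case
  proof (intro exI[of _ n0] allI impI)
    fix n y assume n: "n0 \<le> n" "0 < n" and y: "y \<le> - l2 * h t"
    have \<Delta>: "0 < t / real n" using n elim by simp
    have "premium (t / real n) (Suc n) y \<le> 0" using premium_mono_y[OF \<Delta> y, of "Suc n"] n0[OF n] by simp
    then show "bermudan (t / real n) (Suc n) y \<le> 1 - exp y" unfolding premium_def[OF \<Delta>] by linarith
  qed
qed

text \<open>Put-call parity. Waiting until maturity costs interest of at most r t, and the call
  gained in return dominates any multiple of t by \<open>call_lower\<close>.\<close>

lemma european_gt_payoff: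
  assumes l1: "0 < l1" "l1 < lam"
  shows "\<forall>\<^sub>F t in at_right 0. 1 - exp (- l1 * h t) <
    exp (- r * t) * (\<integral>x. max 0 (1 - exp (- l1 * h t + (r - \<delta>) * t + x)) \<partial>\<mu> t)"
proof -
  have "((\<lambda>t. r * t) \<longlongrightarrow> r * 0) (at_right 0)" by (intro tendsto_intros)
  then have e1: "\<forall>\<^sub>F t in at_right 0. r * t < 1 / 2" by (rule order_tendstoD(2)) simp
  \<comment> \<open>With the factor 4 the discounted call is still at least 2 r t, twice the
    interest.\<close>
  have "0 < 4 * r" using r by simp
  from call_lower[OF l1 this] small_pos e1 show ?thesis
  proof eventually_elim
    case (elim t)
    then have t: "0 < t" "t < 1" by auto
    have t0: "0 \<le> t" using t by simp
    define y where "y = - l1 * h t"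
    define L where "L = (\<integral>z. max 0 (z - l1 * h t) \<partial>A t)"
    have L: "4 * r * t \<le> L" using elim by (simp add: L_def)
    interpret At: real_distribution "A t" by (rule distr_A[OF t0])
    interpret Jt: real_distribution "J t" by (rule distr_J[OF t0])
    interpret Mt: real_distribution "\<mu> t" by (rule distr_\<mu>[OF t0])
    let ?E = "\<lambda>x. exp (y + (r - \<delta>) * t + x)"
    have iE: "integrable (\<mu> t) ?E" unfolding exp_add[of "y + (r - \<delta>) * t"] using \<mu>_exp(1)[OF t0] by simp
    have iM: "integrable (\<mu> t) (\<lambda>x. max 0 (?E x - 1))"
      by (rule Bochner_Integration.integrable_bound[OF iE]) (auto simp: max_def)
    have "(\<integral>x. ?E x \<partial>\<mu> t) = exp y * exp ((r - \<delta>) * t) * (exp (- \<kappa> * t) * (\<integral>x. exp x \<partial>J t))"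
      unfolding exp_add[of "y + (r - \<delta>) * t"] using \<mu>_exp(2)[OF t0] by (simp add: exp_add)
    also have "\<dots> \<le> exp y * exp ((r - \<delta>) * t) * (exp (- \<kappa> * t) * exp (t * \<kappa>))"
      using J_exp_le[OF t0] by (intro mult_left_mono) auto
    also have "exp (- \<kappa> * t) * exp (t * \<kappa>) = 1" by (simp add: exp_add[symmetric])
    finally have E1: "(\<integral>x. ?E x \<partial>\<mu> t) \<le> exp y * exp ((r - \<delta>) * t)" by simp
    have "ennreal L \<le> (\<integral>\<^sup>+z. ennreal (max 0 (z - l1 * h t)) \<partial>A t)"
    proof (cases "integrable (A t) (\<lambda>z. max 0 (z - l1 * h t))")
      case True
      then show ?thesis unfolding L_def by (subst nn_integral_eq_integral) auto
    qed (simp add: L_def not_integrable_integral_eq)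
    also have "\<dots> = (\<integral>\<^sup>+w. \<integral>\<^sup>+z. ennreal (max 0 (z - l1 * h t)) \<partial>A t \<partial>J t)"
      using Jt.emeasure_space_1 by simp
    also have "\<dots> \<le> (\<integral>\<^sup>+w. \<integral>\<^sup>+z. ennreal (max 0 (?E (z + w - \<kappa> * t) - 1)) \<partial>A t \<partial>J t)"
    proof (rule nn_integral_mono_AE, use J_nonneg[OF t0] in eventually_elim)
      fix w :: real assume w: "0 \<le> w"
      \<comment> \<open>From exp u - 1 \<ge> u after dropping the nonnegative terms \<gamma> t and
        w; the exponential call is thus minorized by the linear one of
        \<open>call_lower\<close>.\<close>
      have "z - l1 * h t \<le> ?E (z + w - \<kappa> * t) - 1" for z
      proof -
        have "z - l1 * h t \<le> y + (r - \<delta>) * t + (z + w - \<kappa> * t)"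
          using w mult_nonneg_nonneg[of \<gamma> t] \<gamma>_pos t0 by (simp add: y_def \<gamma>_def algebra_simps)
        then show ?thesis using exp_ge_add_one_self[of "y + (r - \<delta>) * t + (z + w - \<kappa> * t)"] by linarith
      qed
      then show "(\<integral>\<^sup>+z. ennreal (max 0 (z - l1 * h t)) \<partial>A t) \<le> (\<integral>\<^sup>+z. ennreal (max 0 (?E (z + w - \<kappa> * t) - 1)) \<partial>A t)"
        by (intro nn_integral_mono ennreal_leI max.mono order_refl)
    qed
    also have "\<dots> = (\<integral>\<^sup>+x. ennreal (max 0 (?E x - 1)) \<partial>\<mu> t)" by (rule nn_integral_\<mu>[OF t0, symmetric]) simp
    also have "\<dots> = ennreal (\<integral>x. max 0 (?E x - 1) \<partial>\<mu> t)" by (rule nn_integral_eq_integral[OF iM]) simp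
    finally have E2: "L \<le> (\<integral>x. max 0 (?E x - 1) \<partial>\<mu> t)"
      by (subst (asm) ennreal_le_iff) (auto intro!: integral_nonneg_AE)
    have "(\<integral>x. max 0 (1 - ?E x) \<partial>\<mu> t) = (\<integral>x. 1 - ?E x + max 0 (?E x - 1) \<partial>\<mu> t)"
      by (intro Bochner_Integration.integral_cong) auto
    also have "\<dots> = 1 - (\<integral>x. ?E x \<partial>\<mu> t) + (\<integral>x. max 0 (?E x - 1) \<partial>\<mu> t)"
      using iE iM Mt.prob_space by simp
    also have "\<dots> \<ge> 1 - exp y * exp ((r - \<delta>) * t) + 4 * r * t" using E1 E2 L by linarith
    finally have "exp (- r * t) * (1 - exp y * exp ((r - \<delta>) * t) + 4 * r * t) \<le> exp (- r * t) * (\<integral>x. max 0 (1 - ?E x) \<partial>\<mu> t)"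
      by (intro mult_left_mono) auto
    moreover have "1 - exp y < exp (- r * t) * (1 - exp y * exp ((r - \<delta>) * t) + 4 * r * t)"
    proof -
      have a: "1 + - r * t \<le> exp (- r * t)" by (rule exp_ge_add_one_self)
      then have h: "1 / 2 \<le> exp (- r * t)" using elim by simp
      have b: "exp (- r * t) * (exp y * exp ((r - \<delta>) * t)) = exp y * exp (- \<delta> * t)"
        by (simp add: exp_add[symmetric] algebra_simps)
      have c: "exp y * exp (- \<delta> * t) \<le> exp y * 1" using \<delta> t by (intro mult_left_mono) auto
      have d: "1 / 2 * (4 * r * t) \<le> exp (- r * t) * (4 * r * t)" using h r t by (intro mult_right_mono) auto
      have rt: "0 < r * t" using r t by simp
      have "exp (- r * t) * (1 - exp y * exp ((r - \<delta>) * t) + 4 * r * t) = exp (- r * t) - exp y * exp (- \<delta> * t) + exp (- r * t) * (4 * r * t)"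
        unfolding b[symmetric] by (simp add: algebra_simps)
      then show ?thesis using a c d rt by argo
    qed
    ultimately show ?case unfolding y_def by linarith
  qed
qed

end

section \<open>Stopping times\<close>

locale indep_increments = prob_space M for M :: "'a measure" +
  fixes X :: "real \<Rightarrow> 'a \<Rightarrow> real"
  assumes X_meas[measurable]: "\<And>t. X t \<in> borel_measurable M"
    and X_0: "\<And>\<omega>. \<omega> \<in> space M \<Longrightarrow> X 0 \<omega> = 0"
    and X_right: "\<And>\<omega> t. \<omega> \<in> space M \<Longrightarrow> 0 \<le> t \<Longrightarrow> continuous (at_right t) (\<lambda>s. X s \<omega>)"
    and X_indep: "\<And>(n::nat) (ts::nat \<Rightarrow> real). 0 \<le> ts 0 \<Longrightarrow> (\<And>i. i < n \<Longrightarrow> ts i < ts (Suc i)) \<Longrightarrow>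
        indep_vars (\<lambda>_. borel) (\<lambda>i \<omega>. X (ts (Suc i)) \<omega> - X (ts i) \<omega>) {..<n}"
begin

lemma X_meas_compl[measurable]: "X t \<in> borel_measurable (completion M)"
  by (rule measurable_completion) simp

interpretation Mc: prob_space "completion M" by (rule prob_space_completion)

text \<open>A generator of the past before the right limit is taken, with the null sets of the
  completion. Through it \<open>aug_filtration\<close> is the intersection of the generated
  sigma-algebras over later times.\<close>

definition past_sets :: "real \<Rightarrow> 'a set set" where
  "past_sets s = {X u -` B \<inter> space M | u B. 0 \<le> u \<and> u \<le> s \<and> B \<in> sets borel} \<union> null_sets (completion M)"

definition cylinder :: "real set \<Rightarrow> (real \<Rightarrow> real set) \<Rightarrow> 'a set" where
  "cylinder U B = {\<omega> \<in> space M. \<forall>u\<in>U. X u \<omega> \<in> B u}"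

lemma cylinder_sets: assumes "finite U" "\<And>u. B u \<in> sets borel" shows "cylinder U B \<in> sets M"
proof -
  have [measurable]: "B u \<in> sets borel" for u by (rule assms)
  show ?thesis unfolding cylinder_def using assms(1) by measurable
qed

text \<open>Adjoin 0 and s to the times in U, sort them, and append s + h. As X starts at 0, its
  values on the grid are partial sums of increments, so the cylinder depends on increments 0 to n -
  1 only and increment n is the one from s to s + h.\<close>

lemma cylinder_indep:
  assumes U: "finite U" "U \<subseteq> {0..s}" and B: "\<And>u. B u \<in> sets borel" and s: "0 \<le> s" and h: "0 < h" and D: "D \<in> sets borel"
  shows "prob (cylinder U B \<inter> ((\<lambda>\<omega>. X (s + h) \<omega> - X s \<omega>) -` D \<inter> space M))
    = prob (cylinder U B) * prob ((\<lambda>\<omega>. X (s + h) \<omega> - X s \<omega>) -` D \<inter> space M)"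
proof -
  define U' where "U' = insert 0 (insert s U)"
  have U': "finite U'" "U' \<subseteq> {0..s}" "0 \<in> U'" "s \<in> U'" using U s by (auto simp: U'_def)
  define L where "L = sorted_list_of_set U'"
  have L: "sorted_wrt (<) L" "set L = U'" "L \<noteq> []" using U' by (auto simp: L_def strict_sorted_list_of_set)
  define n where "n = length L - 1"
  have len: "length L = Suc n" using L(3) by (simp add: n_def)
  have mono: "L ! i < L ! j" if "i < j" "j \<le> n" for i j using sorted_wrt_nth_less[OF L(1)] that len by simp
  have L0: "L ! 0 = 0"
  proof -
    obtain i where i: "i < length L" "L ! i = 0" using U'(3) L(2) by (metis in_set_conv_nth)
    have "L ! 0 \<in> {0..s}" using U' L(2) len by (metis nth_mem subsetD zero_less_Suc)
    then show ?thesis using mono[of 0 i] i len by (cases "i = 0") auto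
  qed
  have Ln: "L ! n = s"
  proof -
    obtain i where i: "i < length L" "L ! i = s" using U'(4) L(2) by (metis in_set_conv_nth)
    have "L ! n \<in> {0..s}" using U' L(2) len by (metis nth_mem subsetD lessI)
    then show ?thesis using mono[of i n] i len by (cases "i = n") auto
  qed
  define ts where "ts i = (if i \<le> n then L ! i else s + h)" for i
  define inc where "inc i \<omega> = X (ts (Suc i)) \<omega> - X (ts i) \<omega>" for i \<omega>
  have ind: "indep_vars (\<lambda>_. borel) inc {..<Suc n}"
    unfolding inc_def
  proof (rule X_indep)
    show "0 \<le> ts 0" using L0 by (simp add: ts_def)
    show "ts i < ts (Suc i)" if "i < Suc n" for i using that mono[of i "Suc i"] Ln h by (cases "i = n") (auto simp: ts_def)
  qed
  have inc_n: "inc n \<omega> = X (s + h) \<omega> - X s \<omega>" for \<omega> by (simp add: inc_def ts_def Ln)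
  have X_sum: "X (L ! j) \<omega> = (\<Sum>i<j. inc i \<omega>)" if "j \<le> n" "\<omega> \<in> space M" for j \<omega>
    using that(1)
  proof (induction j)
    case 0 then show ?case using X_0 that(2) L0 by simp
  next
    case (Suc j)
    then have "X (L ! j) \<omega> = (\<Sum>i<j. inc i \<omega>)" by simp
    then show ?case using Suc.prems by (simp add: inc_def ts_def)
  qed
  have iv: "indep_var (PiM {..<n} (\<lambda>_. borel)) (\<lambda>\<omega>. restrict (\<lambda>i. inc i \<omega>) {..<n}) (PiM {n} (\<lambda>_. borel)) (\<lambda>\<omega>. restrict (\<lambda>i. inc i \<omega>) {n})"
    by (rule indep_var_restrict[OF ind]) auto
  define S where "S = {f \<in> space (PiM {..<n} (\<lambda>_. borel :: real measure)). \<forall>j\<in>{..n}. L ! j \<in> U \<longrightarrow> (\<Sum>i<j. f i) \<in> B (L ! j)}"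
  have [measurable]: "B u \<in> sets borel" for u by (rule B)
  have S: "S \<in> sets (PiM {..<n} (\<lambda>_. borel))"
  proof -
    have m: "(\<lambda>f. \<Sum>i<j. f i) \<in> borel_measurable (PiM {..<n} (\<lambda>_. borel :: real measure))" if "j \<in> {..n}" for j
      by (intro borel_measurable_sum measurable_component_singleton) (use that in auto)
    have "{f \<in> space (PiM {..<n} (\<lambda>_. borel :: real measure)). L ! j \<in> U \<longrightarrow> (\<Sum>i<j. f i) \<in> B (L ! j)} \<in> sets (PiM {..<n} (\<lambda>_. borel))"
      if "j \<in> {..n}" for j
      using m[OF that] by measurable
    then show ?thesis unfolding S_def by (intro sets.sets_Collect_finite_All) auto
  qed
  define S' where "S' = {f \<in> space (PiM {n} (\<lambda>_. borel :: real measure)). f n \<in> D}"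
  have S': "S' \<in> sets (PiM {n} (\<lambda>_. borel))" unfolding S'_def using D by measurable
  have cyl: "(\<lambda>\<omega>. restrict (\<lambda>i. inc i \<omega>) {..<n}) -` S \<inter> space M = cylinder U B"
  proof (rule set_eqI)
    fix \<omega>
    have "U \<subseteq> (!) L ` {..n}"
    proof
      fix u assume "u \<in> U"
      then have "u \<in> set L" using L(2) by (simp add: U'_def)
      then show "u \<in> (!) L ` {..n}" by (auto simp: in_set_conv_nth len less_Suc_eq_le)
    qed
    then have U_eq: "(\<forall>u\<in>U. P u) \<longleftrightarrow> (\<forall>j\<in>{..n}. L ! j \<in> U \<longrightarrow> P (L ! j))" for P by blast
    have "(\<Sum>i<j. restrict (\<lambda>i. inc i \<omega>) {..<n} i) = (\<Sum>i<j. inc i \<omega>)" if "j \<in> {..n}" for j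
      by (rule sum.cong) (use that in auto)
    then show "\<omega> \<in> (\<lambda>\<omega>. restrict (\<lambda>i. inc i \<omega>) {..<n}) -` S \<inter> space M \<longleftrightarrow> \<omega> \<in> cylinder U B"
      using X_sum[of _ \<omega>] unfolding S_def cylinder_def U_eq by (auto simp: space_PiM)
  qed
  have last: "(\<lambda>\<omega>. restrict (\<lambda>i. inc i \<omega>) {n}) -` S' \<inter> space M = (\<lambda>\<omega>. X (s + h) \<omega> - X s \<omega>) -` D \<inter> space M"
    unfolding S'_def by (auto simp: space_PiM inc_n)
  have "(\<lambda>x. (restrict (\<lambda>i. inc i x) {..<n}, restrict (\<lambda>i. inc i x) {n})) -` (S \<times> S') \<inter> space M
     = cylinder U B \<inter> ((\<lambda>\<omega>. X (s + h) \<omega> - X s \<omega>) -` D \<inter> space M)"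
    using cyl last by auto
  then show ?thesis using indep_varD[OF iv S S'] by (simp add: cyl last)
qed

lemma past_subset: "past_sets s \<subseteq> Mc.events"
proof
  fix a assume "a \<in> past_sets s"
  then consider u B where "B \<in> sets borel" "a = X u -` B \<inter> space M" | "a \<in> null_sets (completion M)"
    unfolding past_sets_def by blast
  then show "a \<in> Mc.events"
  proof cases
    case 1
    then show ?thesis by (auto intro!: sets_completionI_sets measurable_sets[OF X_meas])
  next
    case 2
    then show ?thesis by (rule null_setsD2)
  qed
qed

text \<open>A pi-lambda argument. The stable generator \<open>E\<close> consists of cylinders
  intersected with the whole space or with a null set; the latter are independent of
  everything.\<close>

lemma past_indep:
  assumes s: "0 \<le> s" and h: "0 < h"
  shows "Mc.indep_set (sigma_sets (space M) (past_sets s)) (sigma_sets (space M) {(\<lambda>\<omega>. X (s + h) \<omega> - X s \<omega>) -` D \<inter> space M | D. D \<in> sets borel})"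
proof -
  define E where "E = {cylinder U B \<inter> N | U B N. finite U \<and> U \<subseteq> {0..s} \<and> (\<forall>u. B u \<in> sets borel) \<and> N \<in> insert (space M) (null_sets (completion M))}"
  define I where "I = {(\<lambda>\<omega>. X (s + h) \<omega> - X s \<omega>) -` D \<inter> space M | D. D \<in> sets borel}"
  have I_sets: "b \<in> sets M" if "b \<in> I" for b using that unfolding I_def by auto
  have "Mc.indep_set E I"
  proof (rule Mc.indep_setI)
    show "E \<subseteq> Mc.events"
    proof
      fix a assume "a \<in> E"
      then obtain U B N where a: "a = cylinder U B \<inter> N" "finite U" "\<forall>u. B u \<in> sets borel" "N \<in> insert (space M) (null_sets (completion M))"
        unfolding E_def by blast
      have "cylinder U B \<in> Mc.events" by (rule sets_completionI_sets, rule cylinder_sets) (use a in auto)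
      moreover have "N \<in> Mc.events" using a(4) sets.top[of "completion M"] by (auto dest: null_setsD2)
      ultimately show "a \<in> Mc.events" unfolding a(1) by (rule sets.Int)
    qed
    show "I \<subseteq> Mc.events" using I_sets by (auto intro: sets_completionI_sets)
    fix a b assume "a \<in> E" "b \<in> I"
    then obtain U B N D where U: "finite U" "U \<subseteq> {0..s}" "\<And>u. B u \<in> sets borel" and N: "N = space M \<or> N \<in> null_sets (completion M)"
      and a: "a = cylinder U B \<inter> N" and D: "D \<in> sets borel" and b: "b = (\<lambda>\<omega>. X (s + h) \<omega> - X s \<omega>) -` D \<inter> space M"
      unfolding E_def I_def by auto
    have bM: "b \<in> sets M" by (rule I_sets) fact
    have cM: "cylinder U B \<in> sets M" by (rule cylinder_sets) (use U in auto)
    from N show "Mc.prob (a \<inter> b) = Mc.prob a * Mc.prob b"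
    proof
      assume "N = space M"
      then have "a = cylinder U B" using a by (auto simp: cylinder_def)
      then show ?thesis using cylinder_indep[OF U s h D] cM bM by (simp add: b sets.Int)
    next
      assume N: "N \<in> null_sets (completion M)"
      have "a \<in> null_sets (completion M)" "a \<inter> b \<in> null_sets (completion M)"
        by (rule null_sets_completion_subset[OF _ N]; auto simp: a)+
      then show ?thesis by (simp add: measure_eq_0_null_sets)
    qed
  qed
  moreover have "Int_stable E"
  proof (rule Int_stableI)
    fix a b assume ab: "a \<in> E" "b \<in> E"
    from ab(1) obtain U B N where a: "a = cylinder U B \<inter> N" and U: "finite U" "U \<subseteq> {0..s}" "\<forall>u. B u \<in> sets borel"
      and N: "N \<in> insert (space M) (null_sets (completion M))"
      unfolding E_def by blast
    from ab(2) obtain U' B' N' where b: "b = cylinder U' B' \<inter> N'" and U': "finite U'" "U' \<subseteq> {0..s}" "\<forall>u. B' u \<in> sets borel"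
      and N': "N' \<in> insert (space M) (null_sets (completion M))"
      unfolding E_def by blast
    define B'' where "B'' u = (if u \<in> U then B u else UNIV) \<inter> (if u \<in> U' then B' u else UNIV)" for u
    have eq: "a \<inter> b = cylinder (U \<union> U') B'' \<inter> (N \<inter> N')" unfolding a b cylinder_def B''_def by auto
    have NN: "N \<inter> N' \<in> insert (space M) (null_sets (completion M))"
    proof (cases "N = space M \<and> N' = space M")
      case False
      then have "N \<in> null_sets (completion M) \<or> N' \<in> null_sets (completion M)" using N N' by auto
      then have "N \<inter> N' \<in> null_sets (completion M)"
        by (auto intro: null_sets_completion_subset[of "N \<inter> N'" N] null_sets_completion_subset[of "N \<inter> N'" N'])
      then show ?thesis by simp
    qed simp
    have "B'' u \<in> sets borel" for u using U(3) U'(3) by (auto simp: B''_def)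
    then show "a \<inter> b \<in> E" unfolding E_def using U U' NN
      by (intro CollectI exI[of _ "U \<union> U'"] exI[of _ B''] exI[of _ "N \<inter> N'"] conjI eq) auto
  qed
  moreover have "Int_stable I"
  proof (rule Int_stableI)
    fix a b assume ab: "a \<in> I" "b \<in> I"
    from ab(1) obtain D where D: "D \<in> sets borel" "a = (\<lambda>\<omega>. X (s + h) \<omega> - X s \<omega>) -` D \<inter> space M"
      unfolding I_def by blast
    from ab(2) obtain D' where D': "D' \<in> sets borel" "b = (\<lambda>\<omega>. X (s + h) \<omega> - X s \<omega>) -` D' \<inter> space M"
      unfolding I_def by blast
    have "a \<inter> b = (\<lambda>\<omega>. X (s + h) \<omega> - X s \<omega>) -` (D \<inter> D') \<inter> space M" unfolding D(2) D'(2) by blast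
    then show "a \<inter> b \<in> I" unfolding I_def using sets.Int[OF D(1) D'(1)] by blast
  qed
  ultimately have "Mc.indep_set (sigma_sets (space M) E) (sigma_sets (space M) I)"
    using Mc.indep_set_sigma_sets[of E I] by simp
  moreover have "sigma_sets (space M) (past_sets s) \<subseteq> sigma_sets (space M) E"
  proof (rule sigma_sets_mono)
    show "past_sets s \<subseteq> sigma_sets (space M) E"
    proof
      fix a assume "a \<in> past_sets s"
      then have "a \<in> E"
        unfolding past_sets_def
      proof
        assume "a \<in> {X u -` B \<inter> space M | u B. 0 \<le> u \<and> u \<le> s \<and> B \<in> sets borel}"
        then obtain u B where "0 \<le> u" "u \<le> s" "B \<in> sets borel" "a = X u -` B \<inter> space M" by auto
        then show "a \<in> E" unfolding E_def
          by (intro CollectI exI[of _ "{u}"] exI[of _ "\<lambda>_. B"] exI[of _ "space M"]) (auto simp: cylinder_def)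
      next
        assume a: "a \<in> null_sets (completion M)"
        then have "a \<subseteq> space M" using sets.sets_into_space[of a "completion M"] by auto
        then show "a \<in> E" unfolding E_def using a
          by (intro CollectI exI[of _ "{}"] exI[of _ "\<lambda>_. UNIV"] exI[of _ a]) (auto simp: cylinder_def)
      qed
      then show "a \<in> sigma_sets (space M) E" by (rule sigma_sets.Basic)
    qed
  qed
  ultimately show ?thesis unfolding I_def Mc.indep_sets2_eq by blast
qed

text \<open>The Markov property tested against an event F of the past: the pair (indicator F, X s)
  is independent of the increment, and Fubini is applied to the product of their laws.\<close>

lemma past_markov:
  fixes f :: "real \<Rightarrow> real"
  assumes s: "0 \<le> s" and h: "0 < h" and F: "F \<in> sigma_sets (space M) (past_sets s)"
    and f[measurable]: "f \<in> borel_measurable borel" and b: "\<And>x. \<bar>f x\<bar> \<le> 1"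
    and d: "distr M borel (\<lambda>\<omega>. X (s + h) \<omega> - X s \<omega>) = \<mu>"
  shows "(\<integral>\<omega>. indicator F \<omega> * f (X (s + h) \<omega>) \<partial>completion M) = (\<integral>\<omega>. indicator F \<omega> * (\<integral>z. f (X s \<omega> + z) \<partial>\<mu>) \<partial>completion M)"
proof -
  let ?G = "sigma (space M) (past_sets s)"
  have pow: "past_sets s \<subseteq> Pow (space M)" using past_subset[of s] sets.sets_into_space[of _ "completion M"] by auto
  have sG: "sets ?G = sigma_sets (space M) (past_sets s)" and spG: "space ?G = space M" using pow by auto
  have sub: "sets ?G \<subseteq> Mc.events" unfolding sG using past_subset[of s] sets.sigma_sets_subset[of "past_sets s" "completion M"] by simp
  have Fe[measurable]: "F \<in> Mc.events" using F sub sG by auto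
  define Y where "Y \<omega> = (indicat_real F \<omega>, X s \<omega>)" for \<omega>
  define Zi where "Zi \<omega> = X (s + h) \<omega> - X s \<omega>" for \<omega>
  have XG: "X s \<in> borel_measurable ?G"
  proof (rule measurableI)
    fix B :: "real set" assume "B \<in> sets borel"
    then have "X s -` B \<inter> space M \<in> past_sets s" unfolding past_sets_def using s by blast
    then show "X s -` B \<inter> space ?G \<in> sets ?G" unfolding sG spG by (rule sigma_sets.Basic)
  qed simp
  have FG: "indicat_real F \<in> borel_measurable ?G" using F sG by (intro borel_measurable_indicator) auto
  have YG: "Y \<in> ?G \<rightarrow>\<^sub>M borel \<Otimes>\<^sub>M borel" unfolding Y_def using FG XG by simp
  have Ym[measurable]: "Y \<in> completion M \<rightarrow>\<^sub>M borel \<Otimes>\<^sub>M borel" unfolding Y_def by simp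
  have Zm[measurable]: "Zi \<in> completion M \<rightarrow>\<^sub>M borel" unfolding Zi_def by simp
  \<comment> \<open>Padding the increment with a constant gives both variables the same type, as
    \<open>indep_var\<close> demands.\<close>
  define W where "W \<omega> = (Zi \<omega>, 0 :: real)" for \<omega>
  have Wm[measurable]: "W \<in> completion M \<rightarrow>\<^sub>M borel \<Otimes>\<^sub>M borel" unfolding W_def by simp
  have iv: "Mc.indep_var (borel \<Otimes>\<^sub>M borel) Y (borel \<Otimes>\<^sub>M borel) W"
  proof -
    have "sigma_sets (space M) {Y -` B \<inter> space M |B. B \<in> sets (borel \<Otimes>\<^sub>M borel)} \<subseteq> sigma_sets (space M) (past_sets s)"
    proof (rule sigma_sets_mono)
      show "{Y -` B \<inter> space M |B. B \<in> sets (borel \<Otimes>\<^sub>M borel)} \<subseteq> sigma_sets (space M) (past_sets s)"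
        using measurable_sets[OF YG] unfolding sG spG by blast
    qed
    moreover have "sigma_sets (space M) {W -` B \<inter> space M |B. B \<in> sets (borel \<Otimes>\<^sub>M borel)} \<subseteq> sigma_sets (space M) {Zi -` D \<inter> space M |D. D \<in> sets borel}"
    proof (rule sigma_sets_subseteq, rule subsetI)
      fix a assume "a \<in> {W -` B \<inter> space M |B. B \<in> sets (borel \<Otimes>\<^sub>M borel)}"
      then obtain B where B: "B \<in> sets (borel \<Otimes>\<^sub>M borel)" "a = W -` B \<inter> space M" by blast
      have "(\<lambda>z::real. (z, 0::real)) -` B \<inter> space borel \<in> sets borel" by (rule measurable_sets[OF _ B(1)]) simp
      moreover have "a = Zi -` ((\<lambda>z::real. (z, 0::real)) -` B \<inter> space borel) \<inter> space M" unfolding B(2) W_def by auto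
      ultimately show "a \<in> {Zi -` D \<inter> space M |D. D \<in> sets borel}" by blast
    qed
    ultimately have "Mc.indep_set (sigma_sets (space M) {Y -` B \<inter> space M |B. B \<in> sets (borel \<Otimes>\<^sub>M borel)}) (sigma_sets (space M) {W -` B \<inter> space M |B. B \<in> sets (borel \<Otimes>\<^sub>M borel)})"
      using past_indep[OF s h] unfolding Mc.indep_sets2_eq Zi_def by blast
    then show ?thesis unfolding Mc.indep_var_eq space_completion using Ym Wm by blast
  qed
  let ?P = "distr (completion M) (borel \<Otimes>\<^sub>M borel) Y" and ?Q = "distr (completion M) (borel \<Otimes>\<^sub>M borel) W"
  have "distr (completion M) borel Zi = distr M borel Zi"
  proof (rule measure_eqI)
    fix B assume "B \<in> sets (distr (completion M) borel Zi)"
    then have B: "B \<in> sets borel" by simp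
    have ZM: "Zi \<in> borel_measurable M" unfolding Zi_def by simp
    have "Zi -` B \<inter> space M \<in> sets M" by (rule measurable_sets[OF ZM B])
    then show "emeasure (distr (completion M) borel Zi) B = emeasure (distr M borel Zi) B"
      by (simp add: emeasure_distr[OF Zm B] emeasure_distr[OF ZM B])
  qed simp
  then have Q: "distr (completion M) borel Zi = \<mu>" using d by (simp add: Zi_def[abs_def])
  interpret P: prob_space ?P by (rule Mc.prob_space_distr) simp
  interpret Q: prob_space ?Q by (rule Mc.prob_space_distr) simp
  interpret PQ: pair_prob_space ?P ?Q ..
  have joint: "?P \<Otimes>\<^sub>M ?Q = distr (completion M) ((borel \<Otimes>\<^sub>M borel) \<Otimes>\<^sub>M (borel \<Otimes>\<^sub>M borel)) (\<lambda>\<omega>. (Y \<omega>, W \<omega>))"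
    using iv unfolding Mc.indep_var_distribution_eq by blast
  \<comment> \<open>Clamping the first coordinate leaves an indicator unchanged and makes the
    integrand bounded on the whole product space.\<close>
  let ?g = "\<lambda>p. max 0 (min 1 (fst (fst p))) * f (snd (fst p) + fst (snd p))"
  have gm: "?g \<in> borel_measurable ((borel \<Otimes>\<^sub>M borel) \<Otimes>\<^sub>M (borel \<Otimes>\<^sub>M borel))" by measurable
  have gb: "\<bar>max 0 (min 1 a) * f x\<bar> \<le> 1" for a x :: real
    using mult_mono[of "\<bar>max 0 (min 1 a)\<bar>" 1 "\<bar>f x\<bar>" 1] b[of x] by (auto simp: abs_mult)
  have "(\<integral>\<omega>. indicator F \<omega> * f (X (s + h) \<omega>) \<partial>completion M) = (\<integral>\<omega>. ?g (Y \<omega>, W \<omega>) \<partial>completion M)"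
    by (intro Bochner_Integration.integral_cong) (auto simp: Y_def Zi_def W_def split: split_indicator)
  also have "\<dots> = (\<integral>p. ?g p \<partial>(?P \<Otimes>\<^sub>M ?Q))"
    unfolding joint by (rule integral_distr[symmetric]) (use gm in auto)
  also have "\<dots> = (\<integral>y. \<integral>z. ?g (y, z) \<partial>?Q \<partial>?P)"
  proof (rule PQ.integral_fst'[symmetric])
    show "integrable (?P \<Otimes>\<^sub>M ?Q) ?g"
      by (rule PQ.integrable_const_bound[where B=1]) (use gb in auto)
  qed
  also have "\<dots> = (\<integral>\<omega>. \<integral>z. ?g (Y \<omega>, z) \<partial>?Q \<partial>completion M)"
  proof (rule integral_distr[OF Ym])
    have "?g \<in> borel_measurable ((borel \<Otimes>\<^sub>M borel) \<Otimes>\<^sub>M ?Q)" by measurable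
    then have "(\<lambda>(y, z). ?g (y, z)) \<in> borel_measurable ((borel \<Otimes>\<^sub>M borel) \<Otimes>\<^sub>M ?Q)" by simp
    then show "(\<lambda>y. \<integral>z. ?g (y, z) \<partial>?Q) \<in> borel_measurable (borel \<Otimes>\<^sub>M borel)"
      by (rule Q.borel_measurable_lebesgue_integral)
  qed
  also have "\<dots> = (\<integral>\<omega>. indicator F \<omega> * (\<integral>z. f (X s \<omega> + z) \<partial>\<mu>) \<partial>completion M)"
  proof (intro Bochner_Integration.integral_cong refl)
    fix \<omega>
    have "(\<integral>z. ?g (Y \<omega>, z) \<partial>?Q) = (\<integral>\<omega>'. ?g (Y \<omega>, W \<omega>') \<partial>completion M)"
      by (rule integral_distr[OF Wm]) simp
    also have "\<dots> = (\<integral>\<omega>'. indicator F \<omega> * f (X s \<omega> + Zi \<omega>') \<partial>completion M)"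
      by (simp add: Y_def W_def split: split_indicator)
    also have "\<dots> = (\<integral>z. indicator F \<omega> * f (X s \<omega> + z) \<partial>\<mu>)"
      unfolding Q[symmetric] by (rule integral_distr[symmetric, OF Zm]) simp
    finally show "(\<integral>z. ?g (Y \<omega>, z) \<partial>?Q) = indicator F \<omega> * (\<integral>z. f (X s \<omega> + z) \<partial>\<mu>)" by simp
  qed
  finally show ?thesis .
qed

end

section \<open>Bermudan values dominate stopped payoffs\<close>

locale put_model = put_laws A J \<mu> \<psi> \<kappa> r \<delta> + indep_increments M X
  for A J \<mu> :: "real \<Rightarrow> real measure" and \<psi> :: "real \<Rightarrow> real" and \<kappa> r \<delta> :: real
    and M :: "'a measure" and X :: "real \<Rightarrow> 'a \<Rightarrow> real" +
  assumes X_distr: "\<And>s t. 0 \<le> s \<Longrightarrow> 0 < t \<Longrightarrow> distr M borel (\<lambda>\<omega>. X (s + t) \<omega> - X s \<omega>) = \<mu> t"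
begin

interpretation Mc: prob_space "completion M" by (rule prob_space_completion)

definition payoff :: "real \<Rightarrow> real \<Rightarrow> 'a \<Rightarrow> real" where
  "payoff y t \<omega> = exp (- r * t) * max 0 (1 - exp (y + (r - \<delta>) * t + X t \<omega>))"

lemma payoff_bounds: "0 \<le> t \<Longrightarrow> 0 \<le> payoff y t \<omega>" "0 \<le> t \<Longrightarrow> payoff y t \<omega> \<le> 1"
  unfolding payoff_def using r by (auto intro!: mult_le_one)

text \<open>The supermartingale property in integrated form, over events F of the past, which avoids
  conditional expectations. It is the recursion read as: value with n + 1 dates left is at least the
  discounted expected value with n.\<close>

lemma bermudan_supermartingale:
  assumes \<Delta>: "0 < \<Delta>" and F: "F \<in> sigma_sets (space M) (past_sets (real k * \<Delta>))"
  shows "(\<integral>\<omega>. indicator F \<omega> * (exp (- r * (real (Suc k) * \<Delta>)) * bermudan \<Delta> n (y + (r - \<delta>) * (real (Suc k) * \<Delta>) + X (real (Suc k) * \<Delta>) \<omega>)) \<partial>completion M)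
    \<le> (\<integral>\<omega>. indicator F \<omega> * (exp (- r * (real k * \<Delta>)) * bermudan \<Delta> (Suc n) (y + (r - \<delta>) * (real k * \<Delta>) + X (real k * \<Delta>) \<omega>)) \<partial>completion M)"
proof -
  define s where "s = real k * \<Delta>"
  have s: "0 \<le> s" using \<Delta> by (simp add: s_def)
  have Ss: "real (Suc k) * \<Delta> = s + \<Delta>" by (simp add: s_def algebra_simps)
  note [measurable] = bermudan_measurable[OF \<Delta>]
  have pow: "past_sets s \<subseteq> Mc.events" by (rule past_subset)
  have Fe[measurable]: "F \<in> Mc.events" using F sets.sigma_sets_subset[OF pow] unfolding s_def by auto
  interpret \<mu>\<Delta>: real_distribution "\<mu> \<Delta>" by (rule distr_\<mu>) (use \<Delta> in simp)
  define f where "f x = bermudan \<Delta> n (y + (r - \<delta>) * (s + \<Delta>) + x)" for x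
  have fm[measurable]: "f \<in> borel_measurable borel" unfolding f_def by measurable
  have fb: "0 \<le> f x" "f x \<le> 1" for x unfolding f_def by (auto simp: bermudan_nonneg[OF \<Delta>] bermudan_le_1[OF \<Delta>])
  define g where "g x = (\<integral>z. f (x + z) \<partial>\<mu> \<Delta>)" for x
  have g_le: "exp (- r * \<Delta>) * g x \<le> bermudan \<Delta> (Suc n) (y + (r - \<delta>) * s + x)" for x
  proof -
    have "g x = (\<integral>z. bermudan \<Delta> n (y + (r - \<delta>) * s + x + (r - \<delta>) * \<Delta> + z) \<partial>\<mu> \<Delta>)"
      unfolding g_def f_def by (intro Bochner_Integration.integral_cong refl arg_cong[where f="bermudan \<Delta> n"]) (simp add: algebra_simps)
    then show ?thesis by simp
  qed
  have gb: "0 \<le> g x" "g x \<le> 1" for x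
    unfolding g_def by (auto intro!: integral_nonneg_AE \<mu>\<Delta>.integral_le_const \<mu>\<Delta>.integrable_const_bound[where B=1] simp: fb)
  have gm[measurable]: "g \<in> borel_measurable borel"
    unfolding g_def by (rule \<mu>\<Delta>.borel_measurable_lebesgue_integral) simp
  have "(\<integral>\<omega>. indicator F \<omega> * (exp (- r * (s + \<Delta>)) * f (X (s + \<Delta>) \<omega>)) \<partial>completion M)
     = exp (- r * (s + \<Delta>)) * (\<integral>\<omega>. indicator F \<omega> * f (X (s + \<Delta>) \<omega>) \<partial>completion M)"
    by (subst integral_mult_right_zero[symmetric]) (simp add: mult_ac)
  also have "(\<integral>\<omega>. indicator F \<omega> * f (X (s + \<Delta>) \<omega>) \<partial>completion M) = (\<integral>\<omega>. indicator F \<omega> * g (X s \<omega>) \<partial>completion M)"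
    unfolding g_def by (rule past_markov[OF s \<Delta> _ fm _ X_distr[OF s \<Delta>]]) (use F fb in \<open>auto simp: s_def\<close>)
  also have "exp (- r * (s + \<Delta>)) * \<dots> = (\<integral>\<omega>. indicator F \<omega> * (exp (- r * s) * (exp (- r * \<Delta>) * g (X s \<omega>))) \<partial>completion M)"
  proof -
    have "exp (- r * (s + \<Delta>)) = exp (- r * s) * exp (- r * \<Delta>)" by (simp add: exp_add[symmetric] algebra_simps)
    then show ?thesis by (subst integral_mult_right_zero[symmetric]) (simp add: mult_ac)
  qed
  also have "\<dots> \<le> (\<integral>\<omega>. indicator F \<omega> * (exp (- r * s) * bermudan \<Delta> (Suc n) (y + (r - \<delta>) * s + X s \<omega>)) \<partial>completion M)"
  proof (rule integral_mono)
    have e1: "exp (- r * s) \<le> 1" "exp (- r * \<Delta>) \<le> 1" using r s \<Delta> by auto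
    show "integrable (completion M) (\<lambda>\<omega>. indicator F \<omega> * (exp (- r * s) * (exp (- r * \<Delta>) * g (X s \<omega>))))"
      by (rule Mc.integrable_const_bound[where B=1]) (use e1 gb in \<open>auto intro!: mult_le_one simp: abs_mult split: split_indicator\<close>)
    show "integrable (completion M) (\<lambda>\<omega>. indicator F \<omega> * (exp (- r * s) * bermudan \<Delta> (Suc n) (y + (r - \<delta>) * s + X s \<omega>)))"
      by (rule Mc.integrable_const_bound[where B=1])
         (use e1 bermudan_nonneg[OF \<Delta>] bermudan_le_1[OF \<Delta>] in \<open>auto intro!: mult_le_one simp: abs_mult split: split_indicator simp del: bermudan.simps\<close>)
    show "indicator F \<omega> * (exp (- r * s) * (exp (- r * \<Delta>) * g (X s \<omega>))) \<le> indicator F \<omega> * (exp (- r * s) * bermudan \<Delta> (Suc n) (y + (r - \<delta>) * s + X s \<omega>))" for \<omega>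
      by (intro mult_left_mono g_le) auto
  qed
  finally show ?thesis unfolding Ss s_def[symmetric] f_def .
qed

text \<open>Optional stopping by hand. \<open>W\<close> k is the discounted value process stopped at
  min (K \<omega>) k; its increments live on the events k < K, which belong to the past of step
  k.\<close>

lemma bermudan_dominates_grid:
  fixes K :: "'a \<Rightarrow> nat"
  assumes \<Delta>: "0 < \<Delta>" and K: "\<And>\<omega>. \<omega> \<in> space M \<Longrightarrow> K \<omega> \<le> N"
    and past: "\<And>k. k < N \<Longrightarrow> {\<omega> \<in> space M. k < K \<omega>} \<in> sigma_sets (space M) (past_sets (real k * \<Delta>))"
  shows "(\<integral>\<omega>. payoff y (real (K \<omega>) * \<Delta>) \<omega> \<partial>completion M) \<le> bermudan \<Delta> N y"
proof -
  note [measurable] = bermudan_measurable[OF \<Delta>]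
  define Z where "Z k \<omega> = exp (- r * (real k * \<Delta>)) * bermudan \<Delta> (N - k) (y + (r - \<delta>) * (real k * \<Delta>) + X (real k * \<Delta>) \<omega>)" for k \<omega>
  have Zm[measurable]: "Z k \<in> borel_measurable (completion M)" for k unfolding Z_def by measurable
  have Zb: "0 \<le> Z k \<omega>" "Z k \<omega> \<le> 1" for k \<omega>
    unfolding Z_def using r \<Delta> by (auto intro!: mult_le_one bermudan_nonneg[OF \<Delta>] bermudan_le_1[OF \<Delta>] mult_nonneg_nonneg)
  have Zi: "integrable (completion M) (Z k)" for k
    by (rule Mc.integrable_const_bound[where B=1]) (auto simp: Zb)
  define F where "F k = {\<omega> \<in> space M. k < K \<omega>}" for k
  have Fe: "F k \<in> Mc.events" if "k < N" for k
    using past[OF that] sets.sigma_sets_subset[OF past_subset[of "real k * \<Delta>"]] unfolding F_def by auto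
  define W where "W = rec_nat (Z 0) (\<lambda>k W \<omega>. W \<omega> + indicator (F k) \<omega> * (Z (Suc k) \<omega> - Z k \<omega>))"
  have W_0: "W 0 = Z 0" and W_Suc: "W (Suc k) = (\<lambda>\<omega>. W k \<omega> + indicator (F k) \<omega> * (Z (Suc k) \<omega> - Z k \<omega>))" for k
    by (auto simp: W_def)
  have W_eq: "W k \<omega> = Z (min (K \<omega>) k) \<omega>" if "\<omega> \<in> space M" for k \<omega>
  proof (induction k)
    case 0 then show ?case by (simp add: W_0)
  next
    case (Suc k)
    show ?case
    proof (cases "k < K \<omega>")
      case True
      then have "min (K \<omega>) k = k" "min (K \<omega>) (Suc k) = Suc k" by auto
      with Suc True that show ?thesis by (simp add: W_Suc F_def)
    next
      case False
      then have "min (K \<omega>) k = K \<omega>" "min (K \<omega>) (Suc k) = K \<omega>" by auto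
      with Suc False that show ?thesis by (simp add: W_Suc F_def)
    qed
  qed
  have W_le: "k \<le> N \<Longrightarrow> integrable (completion M) (W k) \<and> (\<integral>\<omega>. W k \<omega> \<partial>completion M) \<le> (\<integral>\<omega>. Z 0 \<omega> \<partial>completion M)" for k
  proof (induction k)
    case 0 then show ?case by (simp add: W_0 Zi)
  next
    case (Suc k)
    then have k: "k < N" and IH: "integrable (completion M) (W k)" "(\<integral>\<omega>. W k \<omega> \<partial>completion M) \<le> (\<integral>\<omega>. Z 0 \<omega> \<partial>completion M)" by auto
    have i: "integrable (completion M) (\<lambda>\<omega>. indicator (F k) \<omega> * Z j \<omega>)" for j
      using integrable_mult_indicator[OF Fe[OF k] Zi[of j]] by simp
    have e: "W (Suc k) = (\<lambda>\<omega>. W k \<omega> + (indicator (F k) \<omega> * Z (Suc k) \<omega> - indicator (F k) \<omega> * Z k \<omega>))"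
      unfolding W_Suc by (simp add: right_diff_distrib)
    obtain n where n: "N - k = Suc n" "N - Suc k = n" using k by (metis Suc_diff_Suc)
    have "(\<integral>\<omega>. indicator (F k) \<omega> * Z (Suc k) \<omega> \<partial>completion M) \<le> (\<integral>\<omega>. indicator (F k) \<omega> * Z k \<omega> \<partial>completion M)"
      unfolding Z_def n by (rule bermudan_supermartingale[OF \<Delta>]) (use past[OF k] in \<open>simp add: F_def\<close>)
    then show ?case unfolding e using IH i by simp
  qed
  have "(\<integral>\<omega>. payoff y (real (K \<omega>) * \<Delta>) \<omega> \<partial>completion M) \<le> (\<integral>\<omega>. W N \<omega> \<partial>completion M)"
  proof (cases "integrable (completion M) (\<lambda>\<omega>. payoff y (real (K \<omega>) * \<Delta>) \<omega>)")
    case True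
    show ?thesis
    proof (rule integral_mono[OF True])
      show "integrable (completion M) (W N)" using W_le[of N] by simp
      fix \<omega> assume "\<omega> \<in> space (completion M)"
      then have \<omega>: "\<omega> \<in> space M" by simp
      have "W N \<omega> = Z (K \<omega>) \<omega>" using W_eq[OF \<omega>] K[OF \<omega>] by (simp add: min_def)
      also have "payoff y (real (K \<omega>) * \<Delta>) \<omega> \<le> Z (K \<omega>) \<omega>"
        unfolding payoff_def Z_def by (intro mult_left_mono bermudan_ge_payoff[OF \<Delta>]) simp
      finally show "payoff y (real (K \<omega>) * \<Delta>) \<omega> \<le> W N \<omega>" by simp
    qed
  next
    case False
    \<comment> \<open>The Bochner integral of a non-integrable function is 0 by convention, which is
      below the nonnegative right-hand side.\<close>
    then have "(\<integral>\<omega>. payoff y (real (K \<omega>) * \<Delta>) \<omega> \<partial>completion M) = 0" by (rule not_integrable_integral_eq)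
    also have "0 \<le> (\<integral>\<omega>. W N \<omega> \<partial>completion M)"
      by (rule integral_nonneg_AE) (auto intro!: AE_I2 simp: W_eq Zb)
    finally show ?thesis .
  qed
  also have "\<dots> \<le> (\<integral>\<omega>. Z 0 \<omega> \<partial>completion M)" using W_le[of N] by simp
  also have "\<dots> = (\<integral>\<omega>. bermudan \<Delta> N y \<partial>completion M)"
    by (intro Bochner_Integration.integral_cong) (auto simp: Z_def X_0)
  also have "\<dots> = bermudan \<Delta> N y" using Mc.prob_space by simp
  finally show ?thesis .
qed

text \<open>Right-continuity of the augmentation costs an arbitrarily small delay: an event known at
  time u belongs to the plain past of every later s.\<close>

lemma stopping_event_past:
  assumes \<tau>: "stopping_time (aug_filtration M X) \<tau>" and u: "u < s"
  shows "{\<omega> \<in> space M. \<tau> \<omega> \<le> u} \<in> sigma_sets (space M) (past_sets s)"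
proof -
  have p: "past_sets v \<subseteq> Pow (space M)" for v
    using past_subset[of v] sets.sets_into_space[of _ "completion M"] by auto
  define Q where "Q = (\<Inter>v\<in>{u<..}. sigma_sets (space M) (past_sets v))"
  have aug: "aug_filtration M X u = sigma (space M) Q"
    unfolding aug_filtration_def Q_def past_sets_def by simp
  have QP: "Q \<subseteq> sigma_sets (space M) (past_sets s)" unfolding Q_def using u by auto
  then have "Q \<subseteq> Pow (space M)" using sigma_sets_into_sp[OF p[of s]] by auto
  then have s1: "sets (aug_filtration M X u) = sigma_sets (space M) Q" and s2: "space (aug_filtration M X u) = space M"
    unfolding aug by auto
  have "{\<omega> \<in> space M. \<tau> \<omega> \<le> u} \<in> sigma_sets (space M) Q"
    using stopping_timeD[OF \<tau>, of u] unfolding pred_def s1 s2 .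
  then show ?thesis using sigma_sets_mono[OF QP] by auto
qed

lemma stopping_time_measurable:
  assumes \<tau>: "stopping_time (aug_filtration M X) \<tau>"
  shows "\<tau> \<in> borel_measurable (completion M)"
proof (rule borel_measurableI_le)
  fix u
  have "{\<omega> \<in> space M. \<tau> \<omega> \<le> u} \<in> sigma_sets (space M) (past_sets (u + 1))"
    by (rule stopping_event_past[OF \<tau>]) simp
  then show "{\<omega> \<in> space (completion M). \<tau> \<omega> \<le> u} \<in> Mc.events"
    using sets.sigma_sets_subset[OF past_subset[of "u + 1"]] by auto
qed

text \<open>The complement is a countable union of events \<tau> \<le> s - 1/(m+1), each decided
  strictly before s, so the delay in \<open>stopping_event_past\<close> is absorbed.\<close>

lemma stopping_event_strict_past:
  assumes \<tau>: "stopping_time (aug_filtration M X) \<tau>"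
  shows "{\<omega> \<in> space M. s \<le> \<tau> \<omega>} \<in> sigma_sets (space M) (past_sets s)"
proof -
  have p: "past_sets s \<subseteq> Pow (space M)"
    using past_subset[of s] sets.sets_into_space[of _ "completion M"] by auto
  interpret G: sigma_algebra "space M" "sigma_sets (space M) (past_sets s)" by (rule sigma_algebra_sigma_sets[OF p])
  have "{\<omega> \<in> space M. s \<le> \<tau> \<omega>} = space M - (\<Union>m::nat. {\<omega> \<in> space M. \<tau> \<omega> \<le> s - 1 / real (Suc m)})"
  proof (intro set_eqI iffI)
    fix \<omega> assume "\<omega> \<in> {\<omega> \<in> space M. s \<le> \<tau> \<omega>}"
    then have "\<omega> \<in> space M" and "s \<le> \<tau> \<omega>" by auto
    moreover have "\<not> \<tau> \<omega> \<le> s - 1 / real (Suc m)" for m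
    proof -
      have "0 < 1 / real (Suc m)" by simp
      then show ?thesis using \<open>s \<le> \<tau> \<omega>\<close> by linarith
    qed
    ultimately show "\<omega> \<in> space M - (\<Union>m::nat. {\<omega> \<in> space M. \<tau> \<omega> \<le> s - 1 / real (Suc m)})"
      by blast
  next
    fix \<omega> assume \<omega>: "\<omega> \<in> space M - (\<Union>m::nat. {\<omega> \<in> space M. \<tau> \<omega> \<le> s - 1 / real (Suc m)})"
    have "\<not> \<tau> \<omega> < s"
    proof
      assume "\<tau> \<omega> < s"
      then obtain m where "inverse (real (Suc m)) < s - \<tau> \<omega>" using reals_Archimedean[of "s - \<tau> \<omega>"] by auto
      then have "\<tau> \<omega> \<le> s - 1 / real (Suc m)" by (simp add: inverse_eq_divide del: of_nat_Suc)
      then show False using \<omega> by auto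
    qed
    then show "\<omega> \<in> {\<omega> \<in> space M. s \<le> \<tau> \<omega>}" using \<omega> by auto
  qed
  also have "\<dots> \<in> sigma_sets (space M) (past_sets s)"
    by (intro G.compl_sets G.countable_UN) (auto intro!: stopping_event_past[OF \<tau>] simp del: of_nat_Suc)
  finally show ?thesis .
qed

lemma payoff_grid_tendsto:
  assumes \<omega>: "\<omega> \<in> space M" and t: "0 \<le> t" and lim: "u \<longlonglongrightarrow> t" and gt: "\<And>n::nat. t < u n"
  shows "(\<lambda>n. payoff y (u n) \<omega>) \<longlonglongrightarrow> payoff y t \<omega>"
proof -
  have "filterlim u (at_right t) sequentially"
    unfolding filterlim_at using lim gt by (auto simp: less_imp_neq[symmetric])
  then have "(\<lambda>n. X (u n) \<omega>) \<longlonglongrightarrow> X t \<omega>"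
    using X_right[OF \<omega> t] unfolding continuous_within by (rule filterlim_compose[rotated])
  then show ?thesis unfolding payoff_def by (intro tendsto_intros lim)
qed

text \<open>The discretization from the right must be strict, because the filtration is augmented to be
  right-continuous: \<open>{\<tau> < s}\<close> lies in the past of \<open>s\<close> but \<open>{\<tau> \<le> s}\<close> need not.\<close>

lemma stopping_payoff_le:
  assumes \<tau>: "\<tau> \<in> stopping_times_upto M X T" and T: "0 < T"
    and b: "\<And>n. n0 \<le> n \<Longrightarrow> 0 < n \<Longrightarrow> bermudan (T / real n) (Suc n) y \<le> c"
  shows "(\<integral>\<omega>. payoff y (\<tau> \<omega>) \<omega> \<partial>completion M) \<le> c"
proof -
  have st: "stopping_time (aug_filtration M X) \<tau>" and \<tau>b: "\<And>\<omega>. \<omega> \<in> space M \<Longrightarrow> 0 \<le> \<tau> \<omega> \<and> \<tau> \<omega> \<le> T"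
    using \<tau> by (auto simp: stopping_times_upto_def)
  have \<tau>m[measurable]: "\<tau> \<in> borel_measurable (completion M)" by (rule stopping_time_measurable[OF st])
  define \<Delta> where "\<Delta> n = T / real (Suc n)" for n
  have \<Delta>: "0 < \<Delta> n" for n using T by (simp add: \<Delta>_def)
  \<comment> \<open>The successor places the grid time strictly after \<tau> even if \<tau> is on
    the grid. With mesh T / (n + 1) there can be n + 2 steps, the hypothesis \<open>b\<close> at n +
    1.\<close>
  define K where "K n \<omega> = Suc (nat \<lfloor>\<tau> \<omega> / \<Delta> n\<rfloor>)" for n \<omega>
  define u where "u \<omega> n = real (K n \<omega>) * \<Delta> n" for \<omega> n
  have fl: "real (nat \<lfloor>\<tau> \<omega> / \<Delta> n\<rfloor>) = of_int \<lfloor>\<tau> \<omega> / \<Delta> n\<rfloor>" if "\<omega> \<in> space M" for \<omega> n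
    using \<tau>b[OF that] \<Delta>[of n] by simp
  have u_gt: "\<tau> \<omega> < u \<omega> n" and u_le: "u \<omega> n \<le> \<tau> \<omega> + \<Delta> n" if "\<omega> \<in> space M" for \<omega> n
  proof -
    have "real (K n \<omega>) = of_int \<lfloor>\<tau> \<omega> / \<Delta> n\<rfloor> + 1" using fl[OF that, of n] by (simp add: K_def)
    then have "\<tau> \<omega> / \<Delta> n < real (K n \<omega>)" "real (K n \<omega>) \<le> \<tau> \<omega> / \<Delta> n + 1"
      using floor_correct[of "\<tau> \<omega> / \<Delta> n"] by linarith+
    then show "\<tau> \<omega> < u \<omega> n" "u \<omega> n \<le> \<tau> \<omega> + \<Delta> n" using \<Delta>[of n] unfolding u_def by (simp_all add: field_simps)
  qed
  have K_le: "K n \<omega> \<le> Suc (Suc n)" if "\<omega> \<in> space M" for n \<omega>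
  proof -
    have "\<tau> \<omega> / \<Delta> n \<le> T / \<Delta> n" using \<tau>b[OF that] \<Delta>[of n] by (intro divide_right_mono) auto
    also have "\<dots> = real (Suc n)" using T by (simp add: \<Delta>_def)
    finally have "\<lfloor>\<tau> \<omega> / \<Delta> n\<rfloor> \<le> int (Suc n)" by (simp add: floor_le_iff)
    then show ?thesis unfolding K_def by linarith
  qed
  have past: "{\<omega> \<in> space M. k < K n \<omega>} \<in> sigma_sets (space M) (past_sets (real k * \<Delta> n))" for k n
  proof -
    have "k < K n \<omega> \<longleftrightarrow> real k * \<Delta> n \<le> \<tau> \<omega>" if "\<omega> \<in> space M" for \<omega>
    proof -
      have "k < K n \<omega> \<longleftrightarrow> real k \<le> real (nat \<lfloor>\<tau> \<omega> / \<Delta> n\<rfloor>)" by (auto simp: K_def)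
      also have "\<dots> \<longleftrightarrow> real k \<le> \<tau> \<omega> / \<Delta> n" unfolding fl[OF that] by (metis le_floor_iff of_int_le_iff of_int_of_nat_eq)
      also have "\<dots> \<longleftrightarrow> real k * \<Delta> n \<le> \<tau> \<omega>" using \<Delta>[of n] by (simp add: field_simps)
      finally show ?thesis .
    qed
    then have "{\<omega> \<in> space M. k < K n \<omega>} = {\<omega> \<in> space M. real k * \<Delta> n \<le> \<tau> \<omega>}" by auto
    then show ?thesis using stopping_event_strict_past[OF st] by simp
  qed
  have step: "(\<integral>\<omega>. payoff y (u \<omega> n) \<omega> \<partial>completion M) \<le> c" if "n0 \<le> n" for n
  proof -
    have "(\<integral>\<omega>. payoff y (u \<omega> n) \<omega> \<partial>completion M) \<le> bermudan (\<Delta> n) (Suc (Suc n)) y"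
      unfolding u_def by (rule bermudan_dominates_grid[OF \<Delta>]) (auto intro: K_le past)
    also have "\<dots> \<le> c" unfolding \<Delta>_def by (rule b) (use that in auto)
    finally show ?thesis .
  qed
  have lim: "(\<lambda>n. payoff y (u \<omega> n) \<omega>) \<longlonglongrightarrow> payoff y (\<tau> \<omega>) \<omega>" if \<omega>: "\<omega> \<in> space M" for \<omega>
  proof (rule payoff_grid_tendsto[OF \<omega>])
    show "0 \<le> \<tau> \<omega>" using \<tau>b[OF \<omega>] by simp
    have "(\<lambda>n. T * inverse (real (Suc n))) \<longlonglongrightarrow> T * 0" by (intro tendsto_intros LIMSEQ_inverse_real_of_nat)
    then have "(\<lambda>n. \<tau> \<omega> + \<Delta> n) \<longlonglongrightarrow> \<tau> \<omega> + 0" unfolding \<Delta>_def divide_inverse by (intro tendsto_intros) simp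
    then show "u \<omega> \<longlonglongrightarrow> \<tau> \<omega>"
      by (intro tendsto_sandwich[of "\<lambda>_. \<tau> \<omega>" "u \<omega>" sequentially "\<lambda>n. \<tau> \<omega> + \<Delta> n"])
         (use u_gt[OF \<omega>] u_le[OF \<omega>] in \<open>auto intro!: always_eventually less_imp_le\<close>)
    show "\<tau> \<omega> < u \<omega> n" for n by (rule u_gt[OF \<omega>])
  qed
  have meas: "(\<lambda>\<omega>. payoff y (u \<omega> n) \<omega>) \<in> borel_measurable (completion M)" for n
  proof -
    \<comment> \<open>The random grid time takes countably many values, so measurability reduces to
      fixed times.\<close>
    have "K n \<in> completion M \<rightarrow>\<^sub>M count_space UNIV" unfolding K_def by measurable
    then show ?thesis unfolding u_def
      by (rule measurable_compose_countable[rotated]) (simp add: payoff_def)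
  qed
  have "(\<lambda>n. \<integral>\<omega>. payoff y (u \<omega> n) \<omega> \<partial>completion M) \<longlonglongrightarrow> (\<integral>\<omega>. payoff y (\<tau> \<omega>) \<omega> \<partial>completion M)"
  proof (rule integral_dominated_convergence[where w="\<lambda>_. 1"])
    show "(\<lambda>\<omega>. payoff y (\<tau> \<omega>) \<omega>) \<in> borel_measurable (completion M)"
      by (rule borel_measurable_LIMSEQ_real[OF _ meas]) (use lim in simp)
    show "AE \<omega> in completion M. (\<lambda>n. payoff y (u \<omega> n) \<omega>) \<longlonglongrightarrow> payoff y (\<tau> \<omega>) \<omega>"
      by (rule AE_I2) (use lim in simp)
    show "AE \<omega> in completion M. norm (payoff y (u \<omega> n) \<omega>) \<le> 1" for n
    proof (rule AE_I2)
      fix \<omega>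
      have "0 \<le> u \<omega> n" using \<Delta>[of n] by (simp add: u_def)
      then show "norm (payoff y (u \<omega> n) \<omega>) \<le> 1" using payoff_bounds[of "u \<omega> n" y \<omega>] by simp
    qed
  qed (use meas in auto)
  then show ?thesis
    by (rule LIMSEQ_le_const2) (use step in \<open>auto intro!: exI[of _ n0]\<close>)
qed

end

section \<open>The critical price\<close>

context put_model
begin

text \<open>Homogeneity in price and strike reduces everything to strike 1.\<close>

lemma payoff_scale:
  assumes "0 < K"
  shows "exp (- r * t) * max 0 (K - K * exp y * exp ((r - \<delta>) * t + X t \<omega>)) = K * payoff y t \<omega>"
proof -
  have "K - K * exp y * exp ((r - \<delta>) * t + X t \<omega>) = K * (1 - exp (y + (r - \<delta>) * t + X t \<omega>))"
  proof -
    have "exp (y + (r - \<delta>) * t + X t \<omega>) = exp y * exp ((r - \<delta>) * t + X t \<omega>)"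
      by (simp only: exp_add[symmetric] add.assoc)
    then show ?thesis by (simp only: right_diff_distrib mult.assoc mult_1_right)
  qed
  also have "max 0 \<dots> = K * max 0 (1 - exp (y + (r - \<delta>) * t + X t \<omega>))"
    using assms by (simp add: max_mult_distrib_left)
  finally show ?thesis by (simp add: payoff_def)
qed

lemma const_stopping_time:
  assumes "0 \<le> s" shows "(\<lambda>_. s) \<in> stopping_times_upto M X s"
  using assms by (simp add: stopping_times_upto_def stopping_time_const)

text \<open>Serves twice: it bounds the set whose real supremum defines the American price, and it
  settles the price x = 0, which has no logarithm.\<close>

lemma stopped_value_le:
  assumes K: "0 < K" and x: "0 \<le> x" and \<tau>: "\<tau> \<in> stopping_times_upto M X s"
  shows "(\<integral>\<omega>. exp (- r * \<tau> \<omega>) * max 0 (K - x * exp ((r - \<delta>) * \<tau> \<omega> + X (\<tau> \<omega>) \<omega>)) \<partial>completion M) \<le> K"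
proof -
  interpret Mc: prob_space "completion M" by (rule prob_space_completion)
  let ?f = "\<lambda>\<omega>. exp (- r * \<tau> \<omega>) * max 0 (K - x * exp ((r - \<delta>) * \<tau> \<omega> + X (\<tau> \<omega>) \<omega>))"
  have b: "?f \<omega> \<le> K" if "\<omega> \<in> space M" for \<omega>
  proof -
    have "0 \<le> \<tau> \<omega>" using \<tau> that by (auto simp: stopping_times_upto_def)
    then have "exp (- r * \<tau> \<omega>) \<le> 1" using r by simp
    then have "?f \<omega> \<le> 1 * K" using K x by (intro mult_mono) auto
    then show ?thesis by simp
  qed
  show ?thesis
  proof (cases "integrable (completion M) ?f")
    case True
    then show ?thesis by (rule Mc.integral_le_const) (use b in auto)
  next
    case False
    show ?thesis unfolding not_integrable_integral_eq[OF False] using K by simp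
  qed
qed

text \<open>The constant stopping time T - t makes the European put a lower bound.\<close>

lemma american_put_gt:
  assumes K: "0 < K" and s: "0 < T - t" and y: "y \<le> 0"
    and e: "1 - exp y < exp (- r * (T - t)) * (\<integral>x. max 0 (1 - exp (y + (r - \<delta>) * (T - t) + x)) \<partial>\<mu> (T - t))"
  shows "max 0 (K - K * exp y) < american_put M X r \<delta> K T t (K * exp y)"
proof -
  define s where "s = T - t"
  have s0: "0 < s" using s by (simp add: s_def)
  let ?v = "\<lambda>\<tau>. (\<integral>\<omega>. exp (- r * \<tau> \<omega>) * max 0 (K - K * exp y * exp ((r - \<delta>) * \<tau> \<omega> + X (\<tau> \<omega>) \<omega>)) \<partial>completion M)"
  have d: "distr M borel (X s) = \<mu> s"
  proof -
    have "distr M borel (X s) = distr M borel (\<lambda>\<omega>. X (0 + s) \<omega> - X 0 \<omega>)"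
      by (intro distr_cong) (auto simp: X_0)
    then show ?thesis using X_distr[of 0 s] s0 by simp
  qed
  have "?v (\<lambda>_. s) = (\<integral>\<omega>. K * payoff y s \<omega> \<partial>completion M)" by (simp only: payoff_scale[OF K])
  also have "\<dots> = K * (\<integral>\<omega>. payoff y s \<omega> \<partial>completion M)" by simp
  also have "(\<integral>\<omega>. payoff y s \<omega> \<partial>completion M) = (\<integral>\<omega>. payoff y s \<omega> \<partial>M)"
    by (rule integral_completion) (simp add: payoff_def)
  also have "\<dots> = exp (- r * s) * (\<integral>x. max 0 (1 - exp (y + (r - \<delta>) * s + x)) \<partial>\<mu> s)"
    unfolding payoff_def d[symmetric] by (subst integral_distr) auto
  finally have v: "?v (\<lambda>_. s) = K * (exp (- r * s) * (\<integral>x. max 0 (1 - exp (y + (r - \<delta>) * s + x)) \<partial>\<mu> s))" .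
  have "max 0 (K - K * exp y) = K * (1 - exp y)" using K y by (simp add: algebra_simps)
  also have "\<dots> < ?v (\<lambda>_. s)" unfolding v using K e by (simp add: s_def)
  also have "\<dots> \<le> american_put M X r \<delta> K T t (K * exp y)"
    unfolding american_put_def s_def[symmetric]
  proof (rule cSUP_upper)
    show "(\<lambda>_. s) \<in> stopping_times_upto M X s" by (rule const_stopping_time) (use s0 in simp)
    show "bdd_above (?v ` stopping_times_upto M X s)"
      by (rule bdd_aboveI[where M=K]) (use stopped_value_le[OF K, of "K * exp y"] K in auto)
  qed
  finally show ?thesis .
qed

lemma american_put_le:
  assumes K: "0 < K" and s: "0 < T - t" and y: "0 \<le> x" "x < K * exp y0"
    and e: "\<And>n y. n0 \<le> n \<Longrightarrow> 0 < n \<Longrightarrow> y \<le> y0 \<Longrightarrow> bermudan ((T - t) / real n) (Suc n) y \<le> 1 - exp y"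
  shows "american_put M X r \<delta> K T t x \<le> K - x"
  unfolding american_put_def
proof (rule cSUP_least)
  show "stopping_times_upto M X (T - t) \<noteq> {}" using const_stopping_time[of "T - t"] s by auto
  fix \<tau> assume \<tau>: "\<tau> \<in> stopping_times_upto M X (T - t)"
  show "(\<integral>\<omega>. exp (- r * \<tau> \<omega>) * max 0 (K - x * exp ((r - \<delta>) * \<tau> \<omega> + X (\<tau> \<omega>) \<omega>)) \<partial>completion M) \<le> K - x"
  proof (cases "x = 0")
    case True
    then show ?thesis using stopped_value_le[OF K y(1) \<tau>] by simp
  next
    case False
    then have x: "0 < x" using y by simp
    define y' where "y' = ln (x / K)"
    have xy: "x = K * exp y'" using x K by (simp add: y'_def)
    have y'0: "y' \<le> y0" using y(2) K unfolding xy by simp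
    have "(\<integral>\<omega>. payoff y' (\<tau> \<omega>) \<omega> \<partial>completion M) \<le> 1 - exp y'"
      by (rule stopping_payoff_le[OF \<tau> s, of n0]) (use e y'0 in auto)
    then have "K * (\<integral>\<omega>. payoff y' (\<tau> \<omega>) \<omega> \<partial>completion M) \<le> K * (1 - exp y')" using K by (intro mult_left_mono) auto
    then show ?thesis unfolding xy payoff_scale[OF K] by (simp add: algebra_simps)
  qed
qed

end

locale put_model_asymp = put_model A J \<mu> \<psi> \<kappa> r \<delta> M X + put_laws_asymp A J \<mu> \<psi> \<kappa> r \<delta> \<alpha> C
  for A J \<mu> :: "real \<Rightarrow> real measure" and \<psi> :: "real \<Rightarrow> real" and \<kappa> r \<delta> \<alpha> C :: real
    and M :: "'a measure" and X :: "real \<Rightarrow> 'a \<Rightarrow> real"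
begin

text \<open>Membership is kept beside the inequality because the lower bound on the infimum needs
  the set to be nonempty.\<close>

lemma critical_price_le:
  assumes K: "0 < K" and l1: "0 < l1" "l1 < lam"
  shows "\<forall>\<^sub>F s in at_right 0. K * exp (- l1 * h s) \<in> {x. 0 \<le> x \<and> american_put M X r \<delta> K T (T - s) x > max 0 (K - x)}
     \<and> critical_price M X r \<delta> K T (T - s) \<le> K * exp (- l1 * h s)"
  using small_pos european_gt_payoff[OF l1]
proof eventually_elim
  case (elim s)
  then have s: "0 < s" "s < 1" by auto
  have hp: "0 < h s" by (rule h_pos[OF s])
  have "max 0 (K - K * exp (- l1 * h s)) < american_put M X r \<delta> K T (T - s) (K * exp (- l1 * h s))"
    by (rule american_put_gt[OF K]) (use elim l1 hp in auto)
  then have m: "K * exp (- l1 * h s) \<in> {x. 0 \<le> x \<and> american_put M X r \<delta> K T (T - s) x > max 0 (K - x)}"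
    using K by simp
  then have "critical_price M X r \<delta> K T (T - s) \<le> K * exp (- l1 * h s)"
    unfolding critical_price_def by (rule cInf_lower) (auto intro!: bdd_belowI[of _ 0])
  with m show ?case by blast
qed

lemma critical_price_ge:
  assumes K: "0 < K" and l2: "lam < l2"
  shows "\<forall>\<^sub>F s in at_right 0. K * exp (- l2 * h s) \<le> critical_price M X r \<delta> K T (T - s)"
proof -
  have l1: "0 < lam / 2" "lam / 2 < lam" using lam_pos by auto
  show ?thesis using small_pos bermudan_eventually_payoff[OF l2] critical_price_le[OF K l1, of T]
  proof eventually_elim
    case (elim s)
    then obtain n0 where n0: "\<And>n y. n0 \<le> n \<Longrightarrow> 0 < n \<Longrightarrow> y \<le> - l2 * h s \<Longrightarrow> bermudan (s / real n) (Suc n) y \<le> 1 - exp y"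
      by blast
    show ?case unfolding critical_price_def
    proof (rule cInf_greatest)
      show "{x. 0 \<le> x \<and> american_put M X r \<delta> K T (T - s) x > max 0 (K - x)} \<noteq> {}" using elim by blast
      fix x assume x: "x \<in> {x. 0 \<le> x \<and> american_put M X r \<delta> K T (T - s) x > max 0 (K - x)}"
      show "K * exp (- l2 * h s) \<le> x"
      proof (rule ccontr)
        assume "\<not> K * exp (- l2 * h s) \<le> x"
        then have "american_put M X r \<delta> K T (T - s) x \<le> K - x"
          by (intro american_put_le[OF K, of T "T - s" x "- l2 * h s" n0]) (use elim x n0 in auto)
        then show False using x by auto
      qed
    qed
  qed
qed

lemma critical_price_tendsto:
  assumes K: "0 < K"
  shows "((\<lambda>t. (K - critical_price M X r \<delta> K T t) / ((T - t) powr (1 / \<alpha>) * \<bar>ln (T - t)\<bar> powr (1 - 1 / \<alpha>))) \<longlongrightarrow> K * lam) (at_left T)"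
proof -
  have "((\<lambda>s. (K - critical_price M X r \<delta> K T (T - s)) / h s) \<longlongrightarrow> K * lam) (at_right 0)"
  proof (rule order_tendstoI)
    fix a assume a: "a < K * lam"
    define m where "m = a / K"
    \<comment> \<open>The level a may be negative while l1 must be positive, hence the maximum with
      0.\<close>
    define l1 where "l1 = (max m 0 + lam) / 2"
    have "m < lam" using a K by (simp add: m_def field_simps)
    then have "0 < l1" "l1 < lam" "m < l1" using lam_pos by (auto simp: l1_def)
    then have l1: "0 < l1" "l1 < lam" "a / K < l1" by (simp_all add: m_def)
    \<comment> \<open>From 1 - exp (- l1 h) \<ge> l1 h - (l1 h)^2 / 2; the second-order term
      disappears after division by h.\<close>
    have "((\<lambda>s. l1 - l1\<^sup>2 * h s / 2) \<longlongrightarrow> l1 - l1\<^sup>2 * 0 / 2) (at_right 0)"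
      by (intro tendsto_intros h_tendsto_0) simp
    then have "\<forall>\<^sub>F s in at_right 0. a / K < l1 - l1\<^sup>2 * h s / 2" by (rule order_tendstoD(1)) (use l1 in simp)
    with small_pos critical_price_le[OF K l1(1,2), of T]
    show "\<forall>\<^sub>F s in at_right 0. a < (K - critical_price M X r \<delta> K T (T - s)) / h s"
    proof eventually_elim
      case (elim s)
      have hp: "0 < h s" using h_pos elim by auto
      have "exp (- l1 * h s) - 1 - (- l1 * h s) \<le> (- l1 * h s)\<^sup>2 / 2"
        by (rule exp_nonpos_le_quadratic) (use l1 hp in simp)
      then have "(l1 - l1\<^sup>2 * h s / 2) * h s \<le> 1 - exp (- l1 * h s)"
        by (simp add: power2_eq_square algebra_simps)
      moreover have "a / K * h s < (l1 - l1\<^sup>2 * h s / 2) * h s" using elim hp by (intro mult_strict_right_mono) auto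
      ultimately have "a / K * h s < 1 - exp (- l1 * h s)" by linarith
      then have "a * h s < K * (1 - exp (- l1 * h s))" using K by (simp add: field_simps)
      also have "\<dots> \<le> K - critical_price M X r \<delta> K T (T - s)" using elim by (simp add: algebra_simps)
      finally show ?case using hp by (simp add: field_simps)
    qed
  next
    fix a assume a: "K * lam < a"
    define m where "m = a / K"
    define l2 where "l2 = (m + lam) / 2"
    have "lam < m" using a K by (simp add: m_def field_simps)
    then have "lam < l2" "l2 < m" by (auto simp: l2_def)
    then have l2: "lam < l2" "l2 < a / K" by (simp_all add: m_def)
    from small_pos critical_price_ge[OF K l2(1), of T]
    show "\<forall>\<^sub>F s in at_right 0. (K - critical_price M X r \<delta> K T (T - s)) / h s < a"
    proof eventually_elim
      case (elim s)
      have hp: "0 < h s" using h_pos elim by auto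
      have "1 + - l2 * h s \<le> exp (- l2 * h s)" by (rule exp_ge_add_one_self)
      then have "K * (1 + - l2 * h s) \<le> K * exp (- l2 * h s)" using K by (intro mult_left_mono) auto
      then have "K - critical_price M X r \<delta> K T (T - s) \<le> K * l2 * h s" using elim by (simp add: algebra_simps)
      also have "\<dots> < a * h s" using l2(2) K hp by (intro mult_strict_right_mono) (auto simp: field_simps)
      finally show ?case using hp by (simp add: field_simps)
    qed
  qed
  note lim0 = this
  have F: "filterlim (\<lambda>t. T - t) (at_right 0) (at_left T)"
  proof -
    have "((\<lambda>t. T - t) \<longlongrightarrow> T - T) (at_left T)" by (intro tendsto_intros)
    moreover have "\<forall>\<^sub>F t in at_left T. T - t \<in> {0<..} \<and> T - t \<noteq> 0"
      by (auto simp: eventually_at_filter)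
    ultimately show ?thesis unfolding filterlim_at by simp
  qed
  have 1: "((\<lambda>t. (K - critical_price M X r \<delta> K T (T - (T - t))) / h (T - t)) \<longlongrightarrow> K * lam) (at_left T)"
    by (rule filterlim_compose[OF lim0 F])
  have sp: "\<forall>\<^sub>F t in at_left T. 0 < T - t \<and> T - t < 1"
    by (rule eventually_compose_filterlim[OF small_pos F])
  from 1 show ?thesis
  proof (rule Lim_transform_eventually)
    show "\<forall>\<^sub>F t in at_left T. (K - critical_price M X r \<delta> K T (T - (T - t))) / h (T - t)
      = (K - critical_price M X r \<delta> K T t) / ((T - t) powr (1 / \<alpha>) * \<bar>ln (T - t)\<bar> powr (1 - 1 / \<alpha>))"
      using sp by eventually_elim (auto simp: h_def)
  qed
qed

end

theorem theorem7p1: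
  fixes M :: "'a measure" and X :: "real \<Rightarrow> 'a \<Rightarrow> real" and \<nu> :: "real measure"
    and T K r \<delta> \<alpha> a\<^sub>0 \<eta>\<^sub>0 :: real and \<eta> :: "real \<Rightarrow> real"
  assumes T: "T > 0" and K: "K > 0" and r: "r > 0" and \<delta>: "\<delta> \<ge> 0"
    and levy: "levy_process M X \<nu>"
    and exp_cond: "(\<integral>\<^sup>+ y. ennreal (max 0 (exp y - 1)) \<partial>\<nu>) < ennreal (r - \<delta>)"
    and a0: "a\<^sub>0 < 0"
    and \<alpha>: "1 < \<alpha>" "\<alpha> < 2"
    and \<eta>_meas: "\<eta> \<in> borel_measurable borel"
    and \<eta>_pos: "\<forall>y\<in>{a\<^sub>0..<0}. \<eta> y > 0"
    and \<eta>_bdd: "\<exists>C. \<forall>y\<in>{a\<^sub>0..<0}. \<eta> y \<le> C"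
    and \<eta>_lim: "(\<eta> \<longlongrightarrow> \<eta>\<^sub>0) (at_left 0)" and \<eta>\<^sub>0: "\<eta>\<^sub>0 > 0"
    and dens: "\<forall>A\<in>sets borel. emeasure \<nu> (A \<inter> {a\<^sub>0<..<0}) =
                 (\<integral>\<^sup>+ y. ennreal (\<eta> y / \<bar>y\<bar> powr (1 + \<alpha>)) * indicator (A \<inter> {a\<^sub>0<..<0}) y \<partial>lborel)"
  shows "((\<lambda>t. (K - critical_price M X r \<delta> K T t) /
              ((T - t) powr (1 / \<alpha>) * \<bar>ln (T - t)\<bar> powr (1 - 1 / \<alpha>)))
          \<longlongrightarrow> K * (\<eta>\<^sub>0 * Gamma (2 - \<alpha>) / (\<alpha> - 1)) powr (1 / \<alpha>)) (at_left T)"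
proof -
  note L0 = levy[unfolded levy_process_def]
  note prob = L0[THEN conjunct1] and L1 = L0[THEN conjunct2]
  note meas = L1[THEN conjunct1, rule_format] and L2 = L1[THEN conjunct2]
  note zero = L2[THEN conjunct1, rule_format] and L3 = L2[THEN conjunct2]
  note right = L3[THEN conjunct1, rule_format] and L4 = L3[THEN conjunct2, THEN conjunct2]
  note indep = L4[THEN conjunct1, rule_format] and L5 = L4[THEN conjunct2]
  note stat = L5[THEN conjunct1, rule_format] and L6 = L5[THEN conjunct2]
  note sets = L6[THEN conjunct1] and L7 = L6[THEN conjunct2]
  note L8 = L7[THEN conjunct2]
  note fin = L8[THEN conjunct1] and L9 = L8[THEN conjunct2]
  note int = L9[THEN conjunct1, rule_format] and charf = L9[THEN conjunct2, rule_format]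
  note [measurable_cong] = sets
  have int_pos: "integrable \<nu> (\<lambda>y. max 0 (exp y - 1))"
  proof (rule integrableI_nonneg)
    show "(\<integral>\<^sup>+y. ennreal (max 0 (exp y - 1)) \<partial>\<nu>) < \<infinity>"
      using less_trans[OF exp_cond ennreal_less_top] by simp
  qed auto
  interpret stable_like_levy_measure \<nu> \<alpha> a\<^sub>0 \<eta>\<^sub>0 \<eta>
  proof
    show "sets \<nu> = sets borel" by (rule sets)
    show "(\<integral>\<^sup>+ y. ennreal (min 1 (y\<^sup>2)) \<partial>\<nu>) < \<infinity>" by (rule fin)
    show "integrable \<nu> (\<lambda>y. cis (u * y) - 1 - \<i> * complex_of_real u * complex_of_real (exp y - 1))" for u by (rule int)
  qed (use int_pos a0 \<alpha> \<eta>_meas \<eta>_pos \<eta>_bdd \<eta>_lim \<eta>\<^sub>0 dens in auto)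
  interpret P: prob_space M by (rule prob)
  \<comment> \<open>The strict inequality in \<open>exp_cond\<close> is precisely the positivity of
    \<gamma>.\<close>
  have "ennreal kappa < ennreal (r - \<delta>)"
    using exp_cond nn_integral_eq_integral[OF int_pos] by (simp add: kappa_def)
  then have kappa: "kappa < r - \<delta>" by (simp add: ennreal_less_iff kappa_nonneg)
  obtain A J \<mu> :: "real \<Rightarrow> real measure" where laws:
    "\<And>t. 0 \<le> t \<Longrightarrow> real_distribution (A t)"
    "\<And>t. 0 \<le> t \<Longrightarrow> real_distribution (J t)"
    "\<And>t. 0 \<le> t \<Longrightarrow> real_distribution (\<mu> t)"
    "\<And>t. 0 \<le> t \<Longrightarrow> \<mu> t = distr (A t \<Otimes>\<^sub>M J t) borel (\<lambda>(x, w). x + w - kappa * t)"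
    "\<And>s t. 0 \<le> s \<Longrightarrow> 0 \<le> t \<Longrightarrow> A (s + t) = (A s \<star> A t)"
    "\<And>s t. 0 \<le> s \<Longrightarrow> 0 \<le> t \<Longrightarrow> \<mu> (s + t) = (\<mu> s \<star> \<mu> t)"
    "\<And>t \<rho>. 0 \<le> t \<Longrightarrow> 0 \<le> \<rho> \<Longrightarrow> integrable (A t) (\<lambda>x. exp (\<rho> * x)) \<and> (\<integral>x. exp (\<rho> * x) \<partial>A t) = exp (t * neg_exponent \<nu> \<rho>)"
    "\<And>t. 0 \<le> t \<Longrightarrow> AE x in J t. 0 \<le> x"
    "\<And>t. 0 \<le> t \<Longrightarrow> integrable (J t) exp"
    "\<And>t. 0 \<le> t \<Longrightarrow> (\<integral>x. exp x \<partial>J t) \<le> exp (t * kappa)"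
    and char_\<mu>: "\<And>t u. 0 \<le> t \<Longrightarrow> char (\<mu> t) u = exp (t * (\<integral>y. cis (u * y) - 1 - \<i> * complex_of_real u * complex_of_real (exp y - 1) \<partial>\<nu>))"
    by (rule law_decomposition) (rule that)
  have psi1: "neg_exponent \<nu> 1 = 0" by (simp add: neg_exponent_def neg_kernel_def)
  have put: "put_laws A J \<mu> (neg_exponent \<nu>) kappa r \<delta>"
    by (rule put_laws.intro) (fact laws psi1 kappa kappa_nonneg r \<delta>)+
  have incr: "indep_increments M X"
  proof (intro indep_increments.intro indep_increments_axioms.intro)
    show "prob_space M" by (rule prob)
    show "X t \<in> borel_measurable M" for t by (rule meas)
    show "P.indep_vars (\<lambda>_. borel) (\<lambda>i \<omega>. X (ts (Suc i)) \<omega> - X (ts i) \<omega>) {..<n}"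
      if "0 \<le> ts 0" "\<And>i. i < n \<Longrightarrow> ts i < ts (Suc i)" for n :: nat and ts :: "nat \<Rightarrow> real"
      by (rule indep) (use that in auto)
    show "continuous (at_right t) (\<lambda>s. X s \<omega>)" if "\<omega> \<in> space M" "0 \<le> t" for \<omega> t using right that by simp
    show "X 0 \<omega> = 0" if "\<omega> \<in> space M" for \<omega> using zero that by simp
  qed
  \<comment> \<open>Stationarity reduces the increment to X t, and its law is identified with \<mu>
    t by the characteristic function alone.\<close>
  have law: "distr M borel (\<lambda>\<omega>. X (s + t) \<omega> - X s \<omega>) = \<mu> t" if "0 \<le> s" "0 < t" for s t
  proof -
    have "distr M borel (\<lambda>\<omega>. X (s + t) \<omega> - X s \<omega>) = distr M borel (X t)" by (rule stat) (use that in simp)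
    also have "\<dots> = \<mu> t"
    proof (rule Levy_uniqueness)
      show "real_distribution (distr M borel (X t))" using meas by simp
      show "real_distribution (\<mu> t)" by (rule laws) (use that in simp)
      show "char (distr M borel (X t)) = char (\<mu> t)"
      proof
        fix u
        have "char (distr M borel (X t)) u = (\<integral>\<omega>. cis (u * X t \<omega>) \<partial>M)"
          unfolding char_def cis_conv_exp by (rule integral_distr) (use meas in auto)
        also have "\<dots> = exp (complex_of_real t * (\<integral>y. cis (u * y) - 1 - \<i> * complex_of_real u * complex_of_real (exp y - 1) \<partial>\<nu>))"
          by (rule charf) (use that in simp)
        also have "\<dots> = char (\<mu> t) u" by (rule char_\<mu>[symmetric]) (use that in simp)
        finally show "char (distr M borel (X t)) u = char (\<mu> t) u" .
      qed
    qed
    finally show ?thesis .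
  qed
  have psi: "0 \<le> neg_exponent \<nu> \<rho>" if "1 \<le> \<rho>" for \<rho>
    unfolding neg_exponent_def using neg_kernel_nonneg[OF that] by (intro integral_nonneg_AE) auto
  have "put_model A J \<mu> (neg_exponent \<nu>) kappa r \<delta> M X"
    by (intro put_model.intro put_model_axioms.intro put incr law)
  moreover have "put_laws_asymp A J \<mu> (neg_exponent \<nu>) kappa r \<delta> \<alpha> stable_const"
    by (intro put_laws_asymp.intro put_laws_asymp_axioms.intro put \<alpha> stable_const_pos psi neg_exponent_asymp)
  ultimately interpret put_model_asymp A J \<mu> "neg_exponent \<nu>" kappa r \<delta> \<alpha> stable_const M X
    by (rule put_model_asymp.intro)
  \<comment> \<open>The factor \<alpha> inside \<open>lam\<close> cancels the one in the denominator
    of \<open>stable_const\<close>.\<close>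
  have "lam = (\<eta>\<^sub>0 * Gamma (2 - \<alpha>) / (\<alpha> - 1)) powr (1 / \<alpha>)"
    unfolding lam_def unfolding stable_const_def using \<alpha> by simp
  then show ?thesis using critical_price_tendsto[OF K, of T] by simp
qed

end
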